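(* Let $G$ be a locally compact group with closed normal subgroup $N\unlhd G$ and define a continuous homomorphism $\phi\colon G\to(0,\infty)$ by $$\phi(s):=\frac{d\,\mu_N\circ\mathrm{Ad}(s)}{d\mu_N}\qquad s\in G.$$ Then any two of the following statements imply the third: (i) $G$ is almost unimodular; (ii) $G/N$ is almost unimodular; (iii) $\ker\phi$ is open. In particular, if $N$ is compact or discrete then $G$ is almost unimodular if and only if $G/N$ is almost unimodular.
   Context: Locally compact groups are Hausdorff. $\Delta_G\colon G\to\mathbb{R}_+=(0,\infty)$ is the modular function, $\mu_G(E\cdot s)=\Delta_G(s)\mu_G(E)$ for a left Haar measure $\mu_G$. A locally compact group $G$ is almost unimodular if $\ker\Delta_G$ is open in $G$. $\mu_N$ is a left Haar measure on $N$ and $\mathrm{Ad}(s)(n)=sns^{-1}$ for $s\in G$, $n\in N$; since $\mu_N\circ\mathrm{Ad}(s)$ is a left Haar measure on $N$, the Radon–Nikodym derivative is a positive constant, and $s\mapsto\phi(s)$ is a continuous homomorphism. *)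

theory Defs
  imports "HOL-Analysis.Analysis" "HOL-Algebra.Coset"
begin

definition topological_group :: "('a, 'b) monoid_scheme \<Rightarrow> 'a topology \<Rightarrow> bool" where
  "topological_group G T \<longleftrightarrow>
     group G \<and> topspace T = carrier G \<and>
     continuous_map (prod_topology T T) T (\<lambda>(x, y). x \<otimes>\<^bsub>G\<^esub> y) \<and>
     continuous_map T T (\<lambda>x. inv\<^bsub>G\<^esub> x)"

definition locally_compact_group :: "('a, 'b) monoid_scheme \<Rightarrow> 'a topology \<Rightarrow> bool" where
  "locally_compact_group G T \<longleftrightarrow>
     topological_group G T \<and> locally_compact_space T \<and> Hausdorff_space T"

definition quotient_topology :: "('a, 'b) monoid_scheme \<Rightarrow> 'a topology \<Rightarrow> 'a set \<Rightarrow> 'a set topology" where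
  "quotient_topology G T N =
     topology (\<lambda>U. U \<subseteq> rcosets\<^bsub>G\<^esub> N \<and> openin T {x \<in> carrier G. N #>\<^bsub>G\<^esub> x \<in> U})"

lemma openin_quotient_topology:
  assumes "topspace T = carrier G"
  shows "openin (quotient_topology G T N) U \<longleftrightarrow>
    U \<subseteq> rcosets\<^bsub>G\<^esub> N \<and> openin T {x \<in> carrier G. N #>\<^bsub>G\<^esub> x \<in> U}"
proof -
  let ?P = "\<lambda>U. {x \<in> carrier G. N #>\<^bsub>G\<^esub> x \<in> U}"
  have "istopology (\<lambda>U. U \<subseteq> rcosets\<^bsub>G\<^esub> N \<and> openin T (?P U))"
    unfolding istopology_def
  proof (intro conjI allI impI)
    fix S R
    assume S: "S \<subseteq> rcosets\<^bsub>G\<^esub> N \<and> openin T (?P S)"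
      and R: "R \<subseteq> rcosets\<^bsub>G\<^esub> N \<and> openin T (?P R)"
    show "S \<inter> R \<subseteq> rcosets\<^bsub>G\<^esub> N" using S by blast
    have "?P (S \<inter> R) = ?P S \<inter> ?P R" by blast
    then show "openin T (?P (S \<inter> R))" using S R by (simp only: openin_Int)
  next
    fix K assume K: "\<forall>S\<in>K. S \<subseteq> rcosets\<^bsub>G\<^esub> N \<and> openin T (?P S)"
    show "\<Union>K \<subseteq> rcosets\<^bsub>G\<^esub> N" using K by blast
    have eq: "?P (\<Union>K) = \<Union>(?P ` K)" by blast
    have "openin T (\<Union>(?P ` K))" using K by (intro openin_Union) blast
    then show "openin T (?P (\<Union>K))" by (simp only: eq)
  qed
  then show ?thesis by (simp add: quotient_topology_def topology_inverse')
qed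

lemma quotient_map_quotient_topology:
  assumes "topspace T = carrier G"
  shows "quotient_map T (quotient_topology G T N) (\<lambda>x. N #>\<^bsub>G\<^esub> x)"
proof -
  have "{x \<in> carrier G. N #>\<^bsub>G\<^esub> x \<in> rcosets\<^bsub>G\<^esub> N} = topspace T"
    using assms by (auto simp: RCOSETS_def)
  then have "openin (quotient_topology G T N) (rcosets\<^bsub>G\<^esub> N)"
    by (simp add: openin_quotient_topology[OF assms])
  then have "topspace (quotient_topology G T N) = rcosets\<^bsub>G\<^esub> N"
    by (metis assms openin_quotient_topology openin_subset openin_topspace subset_antisym)
  then show ?thesis
    using assms by (auto simp: quotient_map_def openin_quotient_topology RCOSETS_def)
qed

text \<open>A left Haar measure is a nonzero left-invariant Radon measure on the Borel sets: finite on
  compact sets, outer regular on Borel sets and inner regular on open sets. Inner regularity is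
  not required of all Borel sets, since it can fail when the group is not sigma-compact.\<close>

definition left_haar_measure :: "('a, 'b) monoid_scheme \<Rightarrow> 'a topology \<Rightarrow> 'a measure \<Rightarrow> bool" where
  "left_haar_measure G T \<mu> \<longleftrightarrow>
     sets \<mu> = sets (sigma (topspace T) {U. openin T U}) \<and>
     emeasure \<mu> (space \<mu>) \<noteq> 0 \<and>
     (\<forall>K. compactin T K \<longrightarrow> emeasure \<mu> K < \<infinity>) \<and>
     (\<forall>E\<in>sets \<mu>. emeasure \<mu> E = (INF U\<in>{U. openin T U \<and> E \<subseteq> U}. emeasure \<mu> U)) \<and>
     (\<forall>U. openin T U \<longrightarrow> emeasure \<mu> U = (SUP K\<in>{K. compactin T K \<and> K \<subseteq> U}. emeasure \<mu> K)) \<and>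
     (\<forall>s\<in>carrier G. \<forall>E\<in>sets \<mu>. emeasure \<mu> (s <#\<^bsub>G\<^esub> E) = emeasure \<mu> E)"

text \<open>By existence and uniqueness up to scaling of left Haar measures, there is exactly one such
  \<open>c\<close> for each element \<open>s\<close> of a locally compact group.\<close>

definition modular_function :: "('a, 'b) monoid_scheme \<Rightarrow> 'a topology \<Rightarrow> 'a \<Rightarrow> real" where
  "modular_function G T s =
     (THE c. 0 < c \<and> (\<forall>\<mu>. left_haar_measure G T \<mu> \<longrightarrow>
        (\<forall>E\<in>sets \<mu>. emeasure \<mu> (E #>\<^bsub>G\<^esub> s) = ennreal c * emeasure \<mu> E)))"

definition pos_real_group :: "real monoid" where
  "pos_real_group = \<lparr>carrier = {0<..}, mult = (*), one = 1\<rparr>"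

definition almost_unimodular :: "('a, 'b) monoid_scheme \<Rightarrow> 'a topology \<Rightarrow> bool" where
  "almost_unimodular G T \<longleftrightarrow> openin T (kernel G pos_real_group (modular_function G T))"

definition Ad :: "('a, 'b) monoid_scheme \<Rightarrow> 'a \<Rightarrow> 'a \<Rightarrow> 'a" where
  "Ad G s n = s \<otimes>\<^bsub>G\<^esub> n \<otimes>\<^bsub>G\<^esub> inv\<^bsub>G\<^esub> s"

text \<open>The measure \<open>E \<mapsto> \<mu> (Ad G s ` E)\<close> on a normal subgroup is the image of \<open>\<mu>\<close> under the inverse
  of \<open>Ad G s\<close>. Its Radon--Nikodym derivative with respect to a left Haar measure \<open>\<mu>\<close> is constant;
  \<open>Ad_derivative\<close> is this constant. The constant \<open>RN_deriv\<close> of the library is not used because it is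
  an arbitrary representative of the density, hence not constant in general.\<close>

definition comp_Ad :: "('a, 'b) monoid_scheme \<Rightarrow> 'a measure \<Rightarrow> 'a \<Rightarrow> 'a measure" where
  "comp_Ad G \<mu> s = distr \<mu> \<mu> (Ad G (inv\<^bsub>G\<^esub> s))"

definition Ad_derivative :: "('a, 'b) monoid_scheme \<Rightarrow> 'a measure \<Rightarrow> 'a \<Rightarrow> real" where
  "Ad_derivative G \<mu> s = (THE c. 0 < c \<and> comp_Ad G \<mu> s = density \<mu> (\<lambda>_. ennreal c))"

end

theory Submission
  imports Defs
begin

text \<open>Let \<open>\<pi>\<close> be the projection of \<open>G\<close> onto \<open>G/N\<close>. Integrating first over the fibres \<open>x N\<close> and then over
  \<open>G/N\<close> is a left-invariant positive functional on the continuous functions with compact support on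
  \<open>G\<close>, so by uniqueness it is a multiple of Haar integration. Its behaviour under right translation
  by \<open>s\<close> gives \<open>\<Delta>(\<pi> s) = \<phi>(s) \<Delta>(s)\<close>, with the modular function of \<open>G/N\<close> on the left and that of
  \<open>G\<close> on the right. If two of these three homomorphisms are trivial on an open neighbourhood of the
  identity, then so is the third, and its kernel is open.

  Haar measure is constructed from covering numbers: a cluster point of the normalised covering
  numbers is a content on the compact sets, which Caratheodory's theorem extends to a Radon measure.
  Uniqueness is proved without Fubini's theorem, which is delicate for groups that are not
  sigma-compact: every \<open>f\<close> is uniformly close to a positive combination of left translates of any
  bump function \<open>g\<close> with small support, so that all invariant functionals have nearly the same
  ratio \<open>J f / J g\<close>.\<close>

section \<open>Radon measures and continuous functions with compact support\<close>

\<comment> \<open>otherwise ambiguous with the left coset \<open>x <# H\<close>\<close>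
no_notation subset_mset (infix \<open><#\<close> 50)

text \<open>Uniqueness speaks of arbitrary invariant functionals on nonnegative functions, not of
  measures. It therefore applies at once to the iterated integral over the fibres and to
  \<open>f\<close> \<mapsto> integral of \<open>f (h x)\<close>, without representing them by
  measures. Measures come back only at the end: bump functions recover their values on open sets
  from integrals, and outer regularity extends this to Borel sets, which inner regularity would not
  reach.

  Group and topology are explicit arguments because one theory has to serve three groups at once:
  \<open>G\<close>, its subgroup \<open>N\<close> and the quotient by \<open>N\<close>.

  The constants \<open>modular_function\<close> and \<open>Ad_derivative\<close> are defined by
  \<open>THE\<close>. Both are instances of one fact: a homeomorphism that intertwines left
  translations scales every Haar measure by the same positive factor.\<close>

definition Cc_plus :: "'a topology \<Rightarrow> ('a \<Rightarrow> real) set" where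
  "Cc_plus T = {f. continuous_map T euclideanreal f \<and> (\<forall>x\<in>topspace T. 0 \<le> f x) \<and>
     (\<exists>K. compactin T K \<and> (\<forall>x\<in>topspace T - K. f x = 0))}"

lemma Cc_plusI:
  assumes "continuous_map T euclideanreal f" "\<And>x. x \<in> topspace T \<Longrightarrow> 0 \<le> f x"
    "compactin T K" "\<And>x. x \<in> topspace T \<Longrightarrow> x \<notin> K \<Longrightarrow> f x = 0"
  shows "f \<in> Cc_plus T"
  using assms by (auto simp: Cc_plus_def)

lemma Cc_plusD:
  assumes "f \<in> Cc_plus T"
  shows "continuous_map T euclideanreal f" "\<And>x. x \<in> topspace T \<Longrightarrow> 0 \<le> f x"
  using assms by (auto simp: Cc_plus_def)

lemma Cc_plusE:
  assumes "f \<in> Cc_plus T"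
  obtains K where "compactin T K" "\<And>x. x \<in> topspace T \<Longrightarrow> x \<notin> K \<Longrightarrow> f x = 0"
  using assms by (auto simp: Cc_plus_def)

lemma Cc_plus_add: "f \<in> Cc_plus T \<Longrightarrow> g \<in> Cc_plus T \<Longrightarrow> (\<lambda>x. f x + g x) \<in> Cc_plus T"
proof -
  assume f: "f \<in> Cc_plus T" and g: "g \<in> Cc_plus T"
  obtain K where K: "compactin T K" "\<And>x. x \<in> topspace T \<Longrightarrow> x \<notin> K \<Longrightarrow> f x = 0"
    using f Cc_plusE by blast
  obtain L where L: "compactin T L" "\<And>x. x \<in> topspace T \<Longrightarrow> x \<notin> L \<Longrightarrow> g x = 0"
    using g Cc_plusE by blast
  show ?thesis
    by (rule Cc_plusI[where K="K \<union> L"])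
      (use Cc_plusD[OF f] Cc_plusD[OF g] K L in \<open>auto intro!: continuous_map_add compactin_Un\<close>)
qed

lemma Cc_plus_mult:
  assumes "0 \<le> c" "f \<in> Cc_plus T"
  shows "(\<lambda>x. c * f x) \<in> Cc_plus T"
proof -
  obtain K where K: "compactin T K" "\<And>x. x \<in> topspace T \<Longrightarrow> x \<notin> K \<Longrightarrow> f x = 0"
    using assms Cc_plusE by blast
  show ?thesis
    by (rule Cc_plusI[where K=K])
      (use assms Cc_plusD[OF assms(2)] K in \<open>auto intro!: continuous_map_real_mult\<close>)
qed

lemma Cc_plus_prod:
  assumes "f \<in> Cc_plus T" "g \<in> Cc_plus T"
  shows "(\<lambda>x. f x * g x) \<in> Cc_plus T"
proof -
  obtain K where "compactin T K" "\<And>x. x \<in> topspace T \<Longrightarrow> x \<notin> K \<Longrightarrow> f x = 0"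
    using assms(1) Cc_plusE by blast
  then show ?thesis
    by (intro Cc_plusI[where K=K])
      (use Cc_plusD[OF assms(1)] Cc_plusD[OF assms(2)] in \<open>auto intro!: continuous_map_real_mult\<close>)
qed

lemma Cc_plus_zero: "(\<lambda>x. 0) \<in> Cc_plus T"
  by (rule Cc_plusI[where K="{}"]) auto

lemma Cc_plus_sum:
  assumes "\<And>i. i \<in> I \<Longrightarrow> f i \<in> Cc_plus T"
  shows "(\<lambda>x. \<Sum>i\<in>I. f i x) \<in> Cc_plus T"
  using assms by (induction I rule: infinite_finite_induct) (auto intro: Cc_plus_zero Cc_plus_add)

lemma Cc_plus_compose:
  assumes f: "f \<in> Cc_plus Y" and h: "homeomorphic_map X Y h"
  shows "(\<lambda>x. f (h x)) \<in> Cc_plus X"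
proof -
  obtain K where K: "compactin Y K" "\<And>x. x \<in> topspace Y \<Longrightarrow> x \<notin> K \<Longrightarrow> f x = 0"
    using f Cc_plusE by blast
  obtain h' where h': "homeomorphic_maps X Y h h'"
    using h homeomorphic_map_maps by blast
  have ch: "continuous_map X Y h" "continuous_map Y X h'" and inv: "\<And>x. x \<in> topspace X \<Longrightarrow> h' (h x) = x"
    using h' by (auto simp: homeomorphic_maps_def)
  have hx: "h x \<in> topspace Y" if "x \<in> topspace X" for x
    using ch(1) that by (auto simp: continuous_map_def)
  show ?thesis
  proof (rule Cc_plusI[where K="h' ` K"])
    show "continuous_map X euclideanreal (\<lambda>x. f (h x))"
      using continuous_map_compose[OF ch(1) Cc_plusD(1)[OF f]] by (simp add: o_def)
    show "compactin X (h' ` K)" using K(1) ch(2) by (rule image_compactin)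
    show "f (h x) = 0" if "x \<in> topspace X" "x \<notin> h' ` K" for x
      using K(2)[OF hx[OF that(1)]] inv[OF that(1)] that(2) by force
  qed (use hx Cc_plusD(2)[OF f] in auto)
qed

lemma Cc_plus_bounded:
  assumes "f \<in> Cc_plus T"
  obtains B where "0 < B" "\<And>x. x \<in> topspace T \<Longrightarrow> f x \<le> B"
proof -
  obtain K where K: "compactin T K" "\<And>x. x \<in> topspace T \<Longrightarrow> x \<notin> K \<Longrightarrow> f x = 0"
    using assms Cc_plusE by blast
  have "compact (f ` K)"
    using image_compactin[OF K(1) Cc_plusD(1)[OF assms]] by simp
  then obtain B where B: "\<And>y. y \<in> f ` K \<Longrightarrow> norm y \<le> B"
    by (meson bounded_iff compact_imp_bounded)
  show ?thesis
  proof
    show "0 < max B 1" by simp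
    show "f x \<le> max B 1" if "x \<in> topspace T" for x
      using B[of "f x"] K(2)[OF that] by (cases "x \<in> K") auto
  qed
qed

section \<open>Radon measures and their images under homeomorphisms\<close>

text \<open>The purely topological part of \<open>left_haar_measure\<close>, split off so that it
  can be used for image measures and for measures built from contents, before invariance is
  known.\<close>

definition radon_measure :: "'a topology \<Rightarrow> 'a measure \<Rightarrow> bool" where
  "radon_measure T \<mu> \<longleftrightarrow>
     sets \<mu> = sets (sigma (topspace T) {U. openin T U}) \<and>
     (\<forall>K. compactin T K \<longrightarrow> emeasure \<mu> K < \<infinity>) \<and>
     (\<forall>E\<in>sets \<mu>. emeasure \<mu> E = (INF U\<in>{U. openin T U \<and> E \<subseteq> U}. emeasure \<mu> U)) \<and>
     (\<forall>U. openin T U \<longrightarrow> emeasure \<mu> U = (SUP K\<in>{K. compactin T K \<and> K \<subseteq> U}. emeasure \<mu> K))"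

lemma left_haar_measure_iff:
  "left_haar_measure G T \<mu> \<longleftrightarrow> radon_measure T \<mu> \<and> emeasure \<mu> (space \<mu>) \<noteq> 0 \<and>
     (\<forall>s\<in>carrier G. \<forall>E\<in>sets \<mu>. emeasure \<mu> (s <#\<^bsub>G\<^esub> E) = emeasure \<mu> E)"
  by (auto simp: left_haar_measure_def radon_measure_def)

lemma
  assumes "sets \<mu> = sets (sigma (topspace T) {U. openin T U})"
  shows space_borel_on: "space \<mu> = topspace T"
    and sets_borel_on: "sets \<mu> = sigma_sets (topspace T) {U. openin T U}"
proof -
  have sub: "{U. openin T U} \<subseteq> Pow (topspace T)" by (auto dest: openin_subset)
  show "space \<mu> = topspace T"
    using sets_eq_imp_space_eq[OF assms] sub by (simp add: space_measure_of_conv)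
  show "sets \<mu> = sigma_sets (topspace T) {U. openin T U}"
    using assms sub by simp
qed

lemma radon_space: "radon_measure T \<mu> \<Longrightarrow> space \<mu> = topspace T"
  unfolding radon_measure_def by (elim conjE) (rule space_borel_on)

lemma radon_sets: "radon_measure T \<mu> \<Longrightarrow> sets \<mu> = sigma_sets (topspace T) {U. openin T U}"
  unfolding radon_measure_def by (elim conjE) (rule sets_borel_on)

lemma radon_sets_eq: "radon_measure T \<mu> \<Longrightarrow> sets \<mu> = sets (sigma (topspace T) {U. openin T U})"
  unfolding radon_measure_def by (elim conjE)

lemma radon_inner:
  "radon_measure T \<mu> \<Longrightarrow> openin T U \<Longrightarrow> emeasure \<mu> U = (SUP K\<in>{K. compactin T K \<and> K \<subseteq> U}. emeasure \<mu> K)"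
  unfolding radon_measure_def by (elim conjE) blast

lemma radon_outer:
  "radon_measure T \<mu> \<Longrightarrow> E \<in> sets \<mu> \<Longrightarrow> emeasure \<mu> E = (INF U\<in>{U. openin T U \<and> E \<subseteq> U}. emeasure \<mu> U)"
  unfolding radon_measure_def by (elim conjE) blast

lemma radon_open: "radon_measure T \<mu> \<Longrightarrow> openin T U \<Longrightarrow> U \<in> sets \<mu>"
  by (auto simp: radon_sets)

lemma radon_compact_finite: "radon_measure T \<mu> \<Longrightarrow> compactin T K \<Longrightarrow> emeasure \<mu> K < \<infinity>"
  by (simp add: radon_measure_def)

lemma radon_closed:
  assumes "radon_measure T \<mu>" "closedin T C"
  shows "C \<in> sets \<mu>"
proof -
  have "topspace T - (topspace T - C) = C"
    using assms(2) closedin_subset by fastforce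
  moreover have "space \<mu> - (topspace T - C) \<in> sets \<mu>"
    using assms by (intro sets.compl_sets radon_open) auto
  ultimately show ?thesis using radon_space[OF assms(1)] by simp
qed

lemma radon_measurable:
  assumes "radon_measure T \<mu>" "continuous_map T euclideanreal f"
  shows "f \<in> borel_measurable \<mu>"
proof (rule borel_measurableI)
  fix S :: "real set" assume "open S"
  then have "openin T {x \<in> topspace T. f x \<in> S}"
    using assms(2) by (simp add: continuous_map_def)
  moreover have "{x \<in> topspace T. f x \<in> S} = f -` S \<inter> space \<mu>"
    using radon_space[OF assms(1)] by auto
  ultimately show "f -` S \<inter> space \<mu> \<in> sets \<mu>" using radon_open[OF assms(1)] by metis
qed

lemma measurable_continuous_map:
  assumes \<mu>: "radon_measure X \<mu>" and \<nu>: "sets \<nu> = sets (sigma (topspace Y) {U. openin Y U})"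
    and h: "continuous_map X Y h"
  shows "h \<in> measurable \<mu> \<nu>"
proof -
  have sub: "{U. openin Y U} \<subseteq> Pow (topspace Y)" by (auto dest: openin_subset)
  have "h \<in> measurable \<mu> (sigma (topspace Y) {U. openin Y U})"
  proof (rule measurable_measure_of[OF sub])
    show "h \<in> space \<mu> \<rightarrow> topspace Y" using h \<mu> by (auto simp: continuous_map_def radon_space)
    show "h -` U \<inter> space \<mu> \<in> sets \<mu>" if "U \<in> {U. openin Y U}" for U
    proof -
      have "h -` U \<inter> space \<mu> = {x \<in> topspace X. h x \<in> U}" using radon_space[OF \<mu>] by auto
      then show ?thesis using h that radon_open[OF \<mu>] by (auto simp: continuous_map_def)
    qed
  qed
  then show ?thesis using measurable_cong_sets[OF refl \<nu>] by blast
qed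

lemma emeasure_distr_homeomorphic:
  assumes \<mu>: "radon_measure T \<mu>" and h: "homeomorphic_map T T h" and E: "E \<in> sets \<mu>"
  shows "emeasure (distr \<mu> \<mu> h) E = emeasure \<mu> {x \<in> topspace T. h x \<in> E}"
proof -
  have "h \<in> measurable \<mu> \<mu>"
    by (rule measurable_continuous_map[OF \<mu> radon_sets_eq[OF \<mu>] homeomorphic_imp_continuous_map[OF h]])
  then have "emeasure (distr \<mu> \<mu> h) E = emeasure \<mu> (h -` E \<inter> space \<mu>)" using E by (rule emeasure_distr)
  also have "h -` E \<inter> space \<mu> = {x \<in> topspace T. h x \<in> E}" using radon_space[OF \<mu>] by auto
  finally show ?thesis .
qed

lemma radon_distr:
  assumes \<mu>: "radon_measure T \<mu>" and h: "homeomorphic_map T T h"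
  shows "radon_measure T (distr \<mu> \<mu> h)"
proof -
  obtain g where g: "homeomorphic_maps T T h g" using h homeomorphic_map_maps by blast
  have ch: "continuous_map T T h" and cg: "continuous_map T T g"
    and gh: "\<And>x. x \<in> topspace T \<Longrightarrow> g (h x) = x" and hg: "\<And>x. x \<in> topspace T \<Longrightarrow> h (g x) = x"
    using g by (auto simp: homeomorphic_maps_def)
  have hT: "h x \<in> topspace T" and gT: "g x \<in> topspace T" if "x \<in> topspace T" for x
    using ch cg that by (auto simp: continuous_map_def)
  define pre where "pre = (\<lambda>E. {x \<in> topspace T. h x \<in> E})"
  define prg where "prg = (\<lambda>E. {x \<in> topspace T. g x \<in> E})"
  have pre_prg: "pre (prg E) = E" "prg (pre E) = E" if "E \<subseteq> topspace T" for E
    using that gh hg hT gT by (auto simp: pre_def prg_def)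
  have pre_img: "pre E = g ` E" if "E \<subseteq> topspace T" for E
    using that gh hg hT gT by (force simp: pre_def image_iff)
  have prg_img: "prg E = h ` E" if "E \<subseteq> topspace T" for E
    using that gh hg hT gT by (force simp: prg_def image_iff)
  have pre_sub: "pre E \<subseteq> topspace T" and prg_sub: "prg E \<subseteq> topspace T" for E
    by (auto simp: pre_def prg_def)
  have open_pre: "openin T (pre U)" "openin T (prg U)" if "openin T U" for U
    using ch cg that by (auto simp: pre_def prg_def continuous_map_def)
  have compact_pre: "compactin T (pre K)" "compactin T (prg K)" if "compactin T K" for K
    using pre_img[OF compactin_subset_topspace[OF that]] prg_img[OF compactin_subset_topspace[OF that]]
      image_compactin[OF that cg] image_compactin[OF that ch] by auto
  have em: "emeasure (distr \<mu> \<mu> h) E = emeasure \<mu> (pre E)" if "E \<in> sets \<mu>" for E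
    unfolding pre_def by (rule emeasure_distr_homeomorphic[OF \<mu> h that])
  \<comment> \<open>Without a Hausdorff hypothesis a compact set need not be Borel. Its
    \<open>emeasure\<close> is then 0 by default, which settles the corresponding cases
    below.\<close>
  have nE: "E \<notin> sets \<mu> \<Longrightarrow> emeasure (distr \<mu> \<mu> h) E = 0" for E
    by (rule emeasure_notin_sets) simp
  have hm: "h \<in> measurable \<mu> \<mu>"
    by (rule measurable_continuous_map[OF \<mu> radon_sets_eq[OF \<mu>] ch])
  have open_sub: "openin T U \<Longrightarrow> U \<subseteq> topspace T" for U by (rule openin_subset)
  show ?thesis
    unfolding radon_measure_def
  proof (intro conjI allI impI ballI)
    show "sets (distr \<mu> \<mu> h) = sets (sigma (topspace T) {U. openin T U})"
      using radon_sets_eq[OF \<mu>] by simp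
    show "emeasure (distr \<mu> \<mu> h) K < \<infinity>" if K: "compactin T K" for K
      using em[of K] nE[of K] radon_compact_finite[OF \<mu> compact_pre(1)[OF K]] by (cases "K \<in> sets \<mu>") auto
    show "emeasure (distr \<mu> \<mu> h) E = (INF U\<in>{U. openin T U \<and> E \<subseteq> U}. emeasure (distr \<mu> \<mu> h) U)"
      if "E \<in> sets (distr \<mu> \<mu> h)" for E
    proof -
      have E: "E \<in> sets \<mu>" using that by simp
      have ET: "E \<subseteq> topspace T" using sets.sets_into_space[OF E] radon_space[OF \<mu>] by simp
      have "pre E = h -` E \<inter> space \<mu>" using radon_space[OF \<mu>] by (auto simp: pre_def)
      then have pE: "pre E \<in> sets \<mu>" using measurable_sets[OF hm E] by simp
      have "{V. openin T V \<and> pre E \<subseteq> V} = pre ` {U. openin T U \<and> E \<subseteq> U}"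
      proof (intro equalityI subsetI)
        fix V assume V: "V \<in> {V. openin T V \<and> pre E \<subseteq> V}"
        then have "prg (pre E) \<subseteq> prg V" by (auto simp: prg_def)
        then have "E \<subseteq> prg V" using pre_prg(2)[OF ET] by simp
        moreover have "V = pre (prg V)" using pre_prg(1)[OF open_sub] V by simp
        ultimately show "V \<in> pre ` {U. openin T U \<and> E \<subseteq> U}" using V open_pre by blast
      qed (use open_pre in \<open>auto simp: pre_def\<close>)
      then have "emeasure \<mu> (pre E) = (INF U\<in>{U. openin T U \<and> E \<subseteq> U}. emeasure \<mu> (pre U))"
        using radon_outer[OF \<mu> pE] by (simp add: image_image)
      also have "\<dots> = (INF U\<in>{U. openin T U \<and> E \<subseteq> U}. emeasure (distr \<mu> \<mu> h) U)"
        by (rule INF_cong) (use em radon_open[OF \<mu>] in auto)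
      finally show ?thesis using em[OF E] by simp
    qed
    show "emeasure (distr \<mu> \<mu> h) U = (SUP K\<in>{K. compactin T K \<and> K \<subseteq> U}. emeasure (distr \<mu> \<mu> h) K)"
      if U: "openin T U" for U
    proof (rule antisym)
      have "emeasure (distr \<mu> \<mu> h) U = (SUP K\<in>{K. compactin T K \<and> K \<subseteq> pre U}. emeasure \<mu> K)"
        using em[OF radon_open[OF \<mu> U]] radon_inner[OF \<mu> open_pre(1)[OF U]] by simp
      also have "\<dots> \<le> (SUP K\<in>{K. compactin T K \<and> K \<subseteq> U}. emeasure (distr \<mu> \<mu> h) K)"
      proof (rule SUP_least)
        fix K assume "K \<in> {K. compactin T K \<and> K \<subseteq> pre U}"
        then have K: "compactin T K" "K \<subseteq> pre U" by auto
        have KT: "K \<subseteq> topspace T" by (rule compactin_subset_topspace[OF K(1)])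
        have "prg K \<subseteq> prg (pre U)" using K(2) by (auto simp: prg_def)
        then have sub: "prg K \<subseteq> U" using pre_prg(2)[OF open_sub[OF U]] by simp
        show "emeasure \<mu> K \<le> (SUP K\<in>{K. compactin T K \<and> K \<subseteq> U}. emeasure (distr \<mu> \<mu> h) K)"
        proof (cases "K \<in> sets \<mu>")
          case True
          have gm: "g \<in> measurable \<mu> \<mu>"
            by (rule measurable_continuous_map[OF \<mu> radon_sets_eq[OF \<mu>] cg])
          have "prg K = g -` K \<inter> space \<mu>" using radon_space[OF \<mu>] by (auto simp: prg_def)
          then have "prg K \<in> sets \<mu>" using measurable_sets[OF gm True] by simp
          then have "emeasure (distr \<mu> \<mu> h) (prg K) = emeasure \<mu> K"
            using em pre_prg(1)[OF KT] by simp
          moreover have "prg K \<in> {K. compactin T K \<and> K \<subseteq> U}" using compact_pre(2)[OF K(1)] sub by simp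
          ultimately show ?thesis by (metis (no_types, lifting) SUP_upper)
        qed (simp add: emeasure_notin_sets)
      qed
      finally show "emeasure (distr \<mu> \<mu> h) U \<le> (SUP K\<in>{K. compactin T K \<and> K \<subseteq> U}. emeasure (distr \<mu> \<mu> h) K)" .
      show "(SUP K\<in>{K. compactin T K \<and> K \<subseteq> U}. emeasure (distr \<mu> \<mu> h) K) \<le> emeasure (distr \<mu> \<mu> h) U"
        using radon_open[OF \<mu> U] by (intro SUP_least emeasure_mono) auto
    qed
  qed
qed

section \<open>Locally compact Hausdorff spaces: bump functions and comparison of Radon
  measures\<close>

locale lc_space =
  fixes T :: "'a topology"
  assumes locally_compact: "locally_compact_space T" and Hausdorff: "Hausdorff_space T"
begin

lemma compact_closed: "compactin T K \<Longrightarrow> closedin T K"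
  by (rule compactin_imp_closedin[OF Hausdorff])

lemma compactin_Int: "compactin T K \<Longrightarrow> compactin T L \<Longrightarrow> compactin T (K \<inter> L)"
  by (simp add: closed_Int_compactin compact_closed)

lemma compact_nbhd:
  assumes "openin T U" "x \<in> U"
  obtains V K where "openin T V" "compactin T K" "x \<in> V" "V \<subseteq> K" "K \<subseteq> U"
proof -
  have "neighbourhood_base_of (compactin T) T"
    using locally_compact Hausdorff locally_compact_space_neighbourhood_base by blast
  then show ?thesis using assms that unfolding neighbourhood_base_of by metis
qed

lemma Urysohn_Cc_plus:
  assumes K: "compactin T K" and U: "openin T U" "K \<subseteq> U"
  obtains f where "f \<in> Cc_plus T" "\<And>x. x \<in> topspace T \<Longrightarrow> f x \<le> 1"
    "\<And>x. x \<in> K \<Longrightarrow> f x = 1" "\<And>x. x \<in> topspace T \<Longrightarrow> x \<notin> U \<Longrightarrow> f x = 0"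
proof -
  obtain V L where VL: "openin T V" "compactin T L" "K \<subseteq> V" "V \<subseteq> L"
    using locally_compact Hausdorff K locally_compact_space_compact_closed_compact[of T] by metis
  \<comment> \<open>Vanishing off \<open>U \<inter> V\<close>, not only off \<open>U\<close>, puts
    the support inside the compact set \<open>L\<close>.\<close>
  let ?C = "topspace T - U \<inter> V"
  have C: "closedin T ?C" using U VL by blast
  have cr: "completely_regular_space T"
    using locally_compact Hausdorff locally_compact_regular_imp_completely_regular_space by blast
  have dis: "disjnt K ?C" using U VL by (auto simp: disjnt_iff)
  obtain f where f: "continuous_map T (subtopology euclidean {0..1::real}) f"
      "f ` ?C \<subseteq> {0}" "f ` K \<subseteq> {1}"
    using Urysohn_completely_regular_compact_closed[OF zero_le_one cr K C dis] by metis
  have f01: "continuous_map T euclideanreal f" "\<And>x. x \<in> topspace T \<Longrightarrow> 0 \<le> f x \<and> f x \<le> 1"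
    using f(1) by (auto simp: continuous_map_in_subtopology Pi_iff)
  have f0: "f x = 0" if "x \<in> topspace T" "x \<notin> U \<inter> V" for x
    using f(2) that by blast
  show ?thesis
  proof
    show "f \<in> Cc_plus T"
      by (rule Cc_plusI[where K=L]) (use f01 f0 VL in blast)+
  qed (use f01 f f0 in auto)
qed

lemma Cc_plus_integrable:
  assumes "radon_measure T \<mu>" "f \<in> Cc_plus T"
  shows "integrable \<mu> f"
proof -
  obtain K where K: "compactin T K" "\<And>x. x \<in> topspace T \<Longrightarrow> x \<notin> K \<Longrightarrow> f x = 0"
    using assms(2) Cc_plusE by blast
  obtain B where B: "\<And>x. x \<in> topspace T \<Longrightarrow> f x \<le> B" using assms(2) Cc_plus_bounded by blast
  show ?thesis
  proof (rule integrableI_bounded_set)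
    show "K \<in> sets \<mu>" using assms(1) K(1) compact_closed radon_closed by blast
    show "f \<in> borel_measurable \<mu>" using assms Cc_plusD(1) radon_measurable by blast
    show "emeasure \<mu> K < \<infinity>" using assms(1) K(1) by (rule radon_compact_finite)
    show "AE x in \<mu>. x \<in> K \<longrightarrow> norm (f x) \<le> B" "AE x in \<mu>. x \<notin> K \<longrightarrow> f x = 0"
      using K B Cc_plusD(2)[OF assms(2)] radon_space[OF assms(1)] by (auto intro!: AE_I2)
  qed
qed

text \<open>A bump function between the indicators of a compact \<open>K\<close> and of
  \<open>U\<close> carries the inequality from integrals to measures; inner regularity then lets
  \<open>K\<close> exhaust \<open>U\<close>. An inequality is enough because it can be used a second
  time with the measures exchanged and \<open>1 / c\<close> in place of \<open>c\<close>.\<close>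

lemma radon_open_le:
  assumes \<mu>: "radon_measure T \<mu>" and \<nu>: "radon_measure T \<nu>" and c: "0 \<le> c"
    and eq: "\<And>f. f \<in> Cc_plus T \<Longrightarrow> c * (\<integral>x. f x \<partial>\<mu>) \<le> (\<integral>x. f x \<partial>\<nu>)"
    and U: "openin T U"
  shows "ennreal c * emeasure \<mu> U \<le> emeasure \<nu> U"
proof -
  have "ennreal c * emeasure \<mu> K \<le> emeasure \<nu> U" if K: "compactin T K" "K \<subseteq> U" for K
  proof -
    obtain f where f: "f \<in> Cc_plus T" "\<And>x. x \<in> topspace T \<Longrightarrow> f x \<le> 1"
      "\<And>x. x \<in> K \<Longrightarrow> f x = 1" "\<And>x. x \<in> topspace T \<Longrightarrow> x \<notin> U \<Longrightarrow> f x = 0"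
      using Urysohn_Cc_plus[OF K(1) U K(2)] by blast
    have KT: "K \<subseteq> topspace T" using K(1) compactin_subset_topspace by blast
    have Km: "K \<in> sets \<mu>" using K(1) \<mu> compact_closed radon_closed by blast
    have nn: "(\<integral>\<^sup>+x. ennreal (f x) \<partial>M) = ennreal (\<integral>x. f x \<partial>M)" if "radon_measure T M" for M
      using Cc_plus_integrable[OF that f(1)] Cc_plusD(2)[OF f(1)] radon_space[OF that]
      by (intro nn_integral_eq_integral) (auto intro!: AE_I2)
    have "emeasure \<mu> K = (\<integral>\<^sup>+x. indicator K x \<partial>\<mu>)" using Km by simp
    also have "\<dots> \<le> (\<integral>\<^sup>+x. ennreal (f x) \<partial>\<mu>)"
      using f(3) by (intro nn_integral_mono) (auto simp: indicator_def)
    also have "\<dots> = ennreal (\<integral>x. f x \<partial>\<mu>)" by (rule nn[OF \<mu>])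
    finally have "ennreal c * emeasure \<mu> K \<le> ennreal c * ennreal (\<integral>x. f x \<partial>\<mu>)"
      by (rule mult_left_mono) simp
    also have "\<dots> = ennreal (c * (\<integral>x. f x \<partial>\<mu>))" using c by (simp add: ennreal_mult')
    also have "\<dots> \<le> ennreal (\<integral>x. f x \<partial>\<nu>)" using eq[OF f(1)] by (rule ennreal_leI)
    also have "\<dots> = (\<integral>\<^sup>+x. ennreal (f x) \<partial>\<nu>)" by (rule nn[OF \<nu>, symmetric])
    also have "\<dots> \<le> (\<integral>\<^sup>+x. indicator U x \<partial>\<nu>)"
      using f(2,4) radon_space[OF \<nu>] by (intro nn_integral_mono) (auto simp: indicator_def)
    also have "\<dots> = emeasure \<nu> U" using radon_open[OF \<nu> U] by simp
    finally show ?thesis .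
  qed
  then have "(SUP K\<in>{K. compactin T K \<and> K \<subseteq> U}. ennreal c * emeasure \<mu> K) \<le> emeasure \<nu> U"
    by (intro SUP_least) auto
  moreover have "emeasure \<mu> U = (SUP K\<in>{K. compactin T K \<and> K \<subseteq> U}. emeasure \<mu> K)"
    using \<mu> U by (simp add: radon_measure_def)
  ultimately show ?thesis by (simp add: SUP_mult_left_ennreal)
qed

text \<open>Two opposite inequalities on open sets, with factors \<open>c\<close> and
  \<open>1 / c\<close>, survive the infimum over open supersets and so hold for every Borel
  set.\<close>

lemma radon_eq_scaled:
  assumes \<mu>: "radon_measure T \<mu>" and \<nu>: "radon_measure T \<nu>" and c: "0 < c"
    and eq: "\<And>f. f \<in> Cc_plus T \<Longrightarrow> (\<integral>x. f x \<partial>\<nu>) = c * (\<integral>x. f x \<partial>\<mu>)"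
    and E: "E \<in> sets \<mu>"
  shows "emeasure \<nu> E = ennreal c * emeasure \<mu> E"
proof -
  have 1: "ennreal c * emeasure \<mu> U \<le> emeasure \<nu> U" if "openin T U" for U
    by (rule radon_open_le[OF \<mu> \<nu> less_imp_le[OF c] _ that]) (simp add: eq)
  have 2: "ennreal (1 / c) * emeasure \<nu> U \<le> emeasure \<mu> U" if "openin T U" for U
    by (rule radon_open_le[OF \<nu> \<mu> _ _ that]) (use c in \<open>simp_all add: eq\<close>)
  have "E \<in> sets \<nu>" using E \<mu> \<nu> radon_sets by metis
  have inv: "ennreal c * ennreal (1 / c) = 1" using c by (subst ennreal_mult[symmetric]) auto
  have mono: "ennreal c * emeasure M E \<le> emeasure M' E"
    if M: "radon_measure T M" "radon_measure T M'" "E \<in> sets M" "E \<in> sets M'"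
      and le: "\<And>U. openin T U \<Longrightarrow> ennreal c * emeasure M U \<le> emeasure M' U" for M M' c
  proof -
    have "ennreal c * emeasure M E \<le> emeasure M' U" if "U \<in> {U. openin T U \<and> E \<subseteq> U}" for U
    proof -
      have "emeasure M E \<le> emeasure M U" using that radon_open[OF M(1)] by (intro emeasure_mono) auto
      then have "ennreal c * emeasure M E \<le> ennreal c * emeasure M U" by (rule mult_left_mono) simp
      with le that show ?thesis by (blast intro: order_trans)
    qed
    moreover have "emeasure M' E = (INF U\<in>{U. openin T U \<and> E \<subseteq> U}. emeasure M' U)"
      using M by (simp add: radon_measure_def)
    ultimately show ?thesis by (simp add: le_INF_iff)
  qed
  have "emeasure \<nu> E = ennreal c * (ennreal (1 / c) * emeasure \<nu> E)"
    unfolding mult.assoc[symmetric] inv by simp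
  also have "\<dots> \<le> ennreal c * emeasure \<mu> E"
    using mono[OF \<nu> \<mu> \<open>E \<in> sets \<nu>\<close> E 2] by (intro mult_left_mono) auto
  finally show ?thesis using mono[OF \<mu> \<nu> E \<open>E \<in> sets \<nu>\<close> 1] by (rule antisym)
qed

lemma Cc_plus_integral_pos:
  assumes \<mu>: "radon_measure T \<mu>" and f: "f \<in> Cc_plus T"
    and pos: "\<And>U. openin T U \<Longrightarrow> U \<noteq> {} \<Longrightarrow> emeasure \<mu> U \<noteq> 0"
    and x: "x \<in> topspace T" "f x \<noteq> 0"
  shows "0 < (\<integral>x. f x \<partial>\<mu>)"
proof -
  let ?U = "{y \<in> topspace T. f y \<in> - {0}}"
  have "openin T ?U"
    using Cc_plusD(1)[OF f] unfolding continuous_map_def by (metis openin_open_subtopology open_Compl closed_singleton open_openin)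
  then have "emeasure \<mu> ?U \<noteq> 0" using pos x by blast
  moreover have "?U = {y \<in> space \<mu>. f y \<noteq> 0}" using radon_space[OF \<mu>] by auto
  ultimately have "\<not> (AE y in \<mu>. f y = 0)"
    using radon_open[OF \<mu> \<open>openin T ?U\<close>] by (simp add: AE_iff_measurable[OF _ refl])
  moreover have AE: "AE y in \<mu>. 0 \<le> f y"
    using Cc_plusD(2)[OF f] radon_space[OF \<mu>] by (auto intro!: AE_I2)
  ultimately have "(\<integral>x. f x \<partial>\<mu>) \<noteq> 0"
    using integral_nonneg_eq_0_iff_AE[OF Cc_plus_integrable[OF \<mu> f] AE] by simp
  moreover have "0 \<le> (\<integral>x. f x \<partial>\<mu>)"
    using AE by (rule integral_nonneg_AE)
  ultimately show ?thesis by simp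
qed

end

section \<open>Locally compact groups\<close>

context group
begin

lemma inv_mult_cancel:
  assumes "x \<in> carrier G" "y \<in> carrier G"
  shows "inv x \<otimes> (x \<otimes> y) = y" "x \<otimes> (inv x \<otimes> y) = y"
  using assms by (simp_all flip: m_assoc)

end

locale lc_group = group G + lc_space T for G (structure) and T +
  assumes topspace: "topspace T = carrier G"
    and mult_continuous: "continuous_map (prod_topology T T) T (\<lambda>(x, y). x \<otimes> y)"
    and inv_continuous: "continuous_map T T (\<lambda>x. inv x)"

lemma lc_group_iff: "lc_group G T \<longleftrightarrow> locally_compact_group G T"
  by (auto simp: lc_group_def lc_group_axioms_def lc_space_def locally_compact_group_def topological_group_def)

context lc_group
begin

lemma continuous_mult:
  assumes "continuous_map X T f" "continuous_map X T g"
  shows "continuous_map X T (\<lambda>x. f x \<otimes> g x)"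
  using continuous_map_compose[OF continuous_map_pairedI[OF assms] mult_continuous]
  by (simp add: o_def)

lemma continuous_inv: "continuous_map X T f \<Longrightarrow> continuous_map X T (\<lambda>x. inv (f x))"
  using continuous_map_compose[OF _ inv_continuous] by (simp add: o_def)

lemma continuous_const: "s \<in> carrier G \<Longrightarrow> continuous_map X T (\<lambda>x. s)"
  by (simp add: topspace)

lemma homeomorphic_left: "s \<in> carrier G \<Longrightarrow> homeomorphic_map T T (\<lambda>x. s \<otimes> x)"
  unfolding homeomorphic_map_maps homeomorphic_maps_def
  by (rule exI[of _ "\<lambda>x. inv s \<otimes> x"])
    (auto intro!: continuous_mult continuous_const simp: topspace simp flip: m_assoc)

lemma homeomorphic_right: "s \<in> carrier G \<Longrightarrow> homeomorphic_map T T (\<lambda>x. x \<otimes> s)"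
  unfolding homeomorphic_map_maps homeomorphic_maps_def
  by (rule exI[of _ "\<lambda>x. x \<otimes> inv s"])
    (auto intro!: continuous_mult continuous_const simp: topspace m_assoc)

lemma homeomorphic_inv: "homeomorphic_map T T (\<lambda>x. inv x)"
  unfolding homeomorphic_map_maps homeomorphic_maps_def
  by (rule exI[of _ "\<lambda>x. inv x"]) (auto intro!: inv_continuous simp: topspace)

lemma l_coset_image: "s <# E = (\<lambda>x. s \<otimes> x) ` E"
  by (auto simp: l_coset_def)

lemma r_coset_image: "E #> s = (\<lambda>x. x \<otimes> s) ` E"
  by (auto simp: r_coset_def)

lemma l_coset_vimage:
  "s \<in> carrier G \<Longrightarrow> E \<subseteq> carrier G \<Longrightarrow> s <# E = {x \<in> carrier G. inv s \<otimes> x \<in> E}"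
  unfolding l_coset_image by (force simp: image_iff simp flip: m_assoc)

lemma r_coset_vimage:
  "s \<in> carrier G \<Longrightarrow> E \<subseteq> carrier G \<Longrightarrow> E #> s = {x \<in> carrier G. x \<otimes> inv s \<in> E}"
  unfolding r_coset_image by (force simp: image_iff m_assoc)

lemma open_l_coset: "s \<in> carrier G \<Longrightarrow> openin T U \<Longrightarrow> openin T (s <# U)"
  unfolding l_coset_image
  using homeomorphic_map_openness[OF homeomorphic_left openin_subset] by blast

lemma open_r_coset: "s \<in> carrier G \<Longrightarrow> openin T U \<Longrightarrow> openin T (U #> s)"
  unfolding r_coset_image
  using homeomorphic_map_openness[OF homeomorphic_right openin_subset] by blast

lemma compact_l_coset: "s \<in> carrier G \<Longrightarrow> compactin T K \<Longrightarrow> compactin T (s <# K)"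
  unfolding l_coset_image
  by (meson homeomorphic_left homeomorphic_imp_continuous_map image_compactin)

lemma compact_set_mult:
  assumes "compactin T K" "compactin T L"
  shows "compactin T (K <#> L)"
proof -
  have "K <#> L = (\<lambda>(x, y). x \<otimes> y) ` (K \<times> L)" by (force simp: set_mult_def)
  then show ?thesis using image_compactin[OF _ mult_continuous] assms by (simp add: compactin_Times)
qed

lemma compact_inv: "compactin T K \<Longrightarrow> compactin T ((\<lambda>x. inv x) ` K)"
  by (rule image_compactin[OF _ inv_continuous])

lemma compact_nbhd_one:
  obtains V C where "openin T V" "compactin T C" "\<one> \<in> V" "V \<subseteq> C"
  using compact_nbhd[OF openin_topspace, of \<one>] topspace one_closed by metis

lemma symmetric_nbhd:
  assumes "openin T V" "\<one> \<in> V"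
  obtains W where "openin T W" "\<one> \<in> W" "W \<subseteq> V" "\<And>w. w \<in> W \<Longrightarrow> inv w \<in> V"
proof
  show "openin T (V \<inter> {x \<in> topspace T. inv x \<in> V})"
    using assms inv_continuous by (auto simp: continuous_map_def)
qed (use assms topspace in auto)

text \<open>For \<open>y\<close> in a compact set the tube lemma gives one neighbourhood of the
  identity on which \<open>f (y \<otimes> v) - f y\<close> is small. For all other \<open>y\<close>
  both values vanish.\<close>

lemma uniformly_continuous_left:
  assumes f: "f \<in> Cc_plus T" and e: "0 < (e::real)"
  obtains V where "openin T V" "\<one> \<in> V"
    "\<And>y v. y \<in> carrier G \<Longrightarrow> v \<in> V \<Longrightarrow> \<bar>f (y \<otimes> v) - f y\<bar> < e"
proof -
  obtain K where K: "compactin T K" "\<And>x. x \<in> topspace T \<Longrightarrow> x \<notin> K \<Longrightarrow> f x = 0"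
    using f Cc_plusE by blast
  obtain V0 C where V0: "openin T V0" "compactin T C" "\<one> \<in> V0" "V0 \<subseteq> C" by (rule compact_nbhd_one)
  have KT: "K \<subseteq> carrier G" "C \<subseteq> carrier G"
    using K(1) V0(2) compactin_subset_topspace topspace by blast+
  \<comment> \<open>If \<open>y \<otimes> v\<close> lies in \<open>K\<close> with \<open>v\<close>
    in \<open>C\<close>, then \<open>y\<close> lies in this product. So off \<open>L\<close> no such
    translate of \<open>y\<close> meets \<open>K\<close>.\<close>
  define L where "L = K <#> (\<lambda>x. inv x) ` C"
  have L: "compactin T L" unfolding L_def by (intro compact_set_mult compact_inv K V0)
  have LT: "L \<subseteq> carrier G" using L compactin_subset_topspace topspace by blast
  define h where "h = (\<lambda>p. f (fst p \<otimes> snd p) - f (fst p))"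
  have h: "continuous_map (prod_topology T T) euclideanreal h"
  proof -
    have "continuous_map (prod_topology T T) euclideanreal (f \<circ> (\<lambda>p. fst p \<otimes> snd p))"
      by (intro continuous_map_compose[OF _ Cc_plusD(1)[OF f]] continuous_mult continuous_map_fst continuous_map_snd)
    moreover have "continuous_map (prod_topology T T) euclideanreal (f \<circ> fst)"
      by (intro continuous_map_compose[OF continuous_map_fst Cc_plusD(1)[OF f]])
    ultimately show ?thesis unfolding h_def o_def by (rule continuous_map_diff)
  qed
  define W where "W = {p \<in> topspace (prod_topology T T). h p \<in> {-e<..<e}}"
  have W: "openin (prod_topology T T) W"
    unfolding W_def by (rule openin_continuous_map_preimage[OF h]) simp
  have "L \<times> {\<one>} \<subseteq> W"
    using LT e by (auto simp: W_def h_def topspace)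
  then obtain U V where UV: "openin T U" "openin T V" "L \<subseteq> U" "\<one> \<in> V" "U \<times> V \<subseteq> W"
    using tube_lemma_left[OF W L, of \<one>] topspace by auto
  show ?thesis
  proof
    show "openin T (V \<inter> V0)" "\<one> \<in> V \<inter> V0" using UV V0 by auto
    show "\<bar>f (y \<otimes> v) - f y\<bar> < e" if y: "y \<in> carrier G" and v: "v \<in> V \<inter> V0" for y v
    proof (cases "y \<in> L")
      case True
      then have "(y, v) \<in> W" using UV v by blast
      then show ?thesis by (auto simp: W_def h_def)
    next
      case False
      have vG: "v \<in> carrier G" using v V0 KT by blast
      have "y = (y \<otimes> v) \<otimes> inv v" using y vG by (simp add: m_assoc)
      then have "y \<otimes> v \<notin> K" using False v V0(4) unfolding L_def set_mult_def by blast
      moreover have "y \<notin> K"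
      proof
        assume "y \<in> K"
        have "\<one> \<in> (\<lambda>x. inv x) ` C" using V0 by (metis imageI inv_one subsetD)
        then have "y \<otimes> \<one> \<in> L" using \<open>y \<in> K\<close> unfolding L_def set_mult_def by blast
        then show False using False y by simp
      qed
      ultimately show ?thesis using K(2) y vG e by (simp add: topspace)
    qed
  qed
qed

lemma uniformly_continuous_right:
  assumes f: "f \<in> Cc_plus T" and e: "0 < (e::real)"
  obtains V where "openin T V" "\<one> \<in> V"
    "\<And>y v. y \<in> carrier G \<Longrightarrow> v \<in> V \<Longrightarrow> \<bar>f (v \<otimes> y) - f y\<bar> < e"
proof -
  obtain V where V: "openin T V" "\<one> \<in> V"
    "\<And>y v. y \<in> carrier G \<Longrightarrow> v \<in> V \<Longrightarrow> \<bar>f (inv (y \<otimes> v)) - f (inv y)\<bar> < e"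
    using uniformly_continuous_left[OF Cc_plus_compose[OF f homeomorphic_inv] e] by blast
  obtain W where W: "openin T W" "\<one> \<in> W" "W \<subseteq> V" "\<And>w. w \<in> W \<Longrightarrow> inv w \<in> V"
    using symmetric_nbhd[OF V(1,2)] by blast
  show ?thesis
  proof
    show "\<bar>f (w \<otimes> y) - f y\<bar> < e" if "y \<in> carrier G" "w \<in> W" for y w
    proof -
      have "w \<in> carrier G" using W(1) that openin_subset topspace by blast
      then show ?thesis using V(3)[of "inv y" "inv w"] W(4)[OF that(2)] that by (simp add: inv_mult_group)
    qed
  qed (fact W)+
qed

section \<open>Left-invariant positive functionals\<close>

text \<open>The domain is a cone, without subtraction, so positivity has to be stated as
  monotonicity. Monotonicity on \<open>carrier G\<close> also makes \<open>J f\<close> independent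
  of the values of \<open>f\<close> outside the group.\<close>

definition invariant_functional :: "(('a \<Rightarrow> real) \<Rightarrow> real) \<Rightarrow> bool" where
  "invariant_functional J \<longleftrightarrow>
     (\<forall>f\<in>Cc_plus T. \<forall>g\<in>Cc_plus T. J (\<lambda>x. f x + g x) = J f + J g) \<and>
     (\<forall>f\<in>Cc_plus T. \<forall>c\<ge>0. J (\<lambda>x. c * f x) = c * J f) \<and>
     (\<forall>f\<in>Cc_plus T. \<forall>g\<in>Cc_plus T. (\<forall>x\<in>carrier G. f x \<le> g x) \<longrightarrow> J f \<le> J g) \<and>
     (\<forall>f\<in>Cc_plus T. \<forall>s\<in>carrier G. J (\<lambda>x. f (s \<otimes> x)) = J f)"

lemma
  assumes "invariant_functional J" and f: "f \<in> Cc_plus T"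
  shows functional_add: "g \<in> Cc_plus T \<Longrightarrow> J (\<lambda>x. f x + g x) = J f + J g"
    and functional_mult: "0 \<le> c \<Longrightarrow> J (\<lambda>x. c * f x) = c * J f"
    and functional_mono: "g \<in> Cc_plus T \<Longrightarrow> (\<And>x. x \<in> carrier G \<Longrightarrow> f x \<le> g x) \<Longrightarrow> J f \<le> J g"
    and functional_left: "s \<in> carrier G \<Longrightarrow> J (\<lambda>x. f (s \<otimes> x)) = J f"
  using assms by (auto simp: invariant_functional_def)

lemma functional_zero: "invariant_functional J \<Longrightarrow> J (\<lambda>x. 0) = 0"
  using functional_mult[OF _ Cc_plus_zero, of J 0] by simp

lemma functional_nonneg: "invariant_functional J \<Longrightarrow> f \<in> Cc_plus T \<Longrightarrow> 0 \<le> J f"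
  using functional_mono[OF _ Cc_plus_zero, of J f] functional_zero[of J] Cc_plusD(2)[of f] topspace by auto

lemma functional_translates:
  assumes J: "invariant_functional J" and g: "g \<in> Cc_plus T"
    and s: "\<And>j. j < (m::nat) \<Longrightarrow> 0 \<le> c j \<and> s j \<in> carrier G"
  shows "(\<lambda>x. \<Sum>j<m. c j * g (inv (s j) \<otimes> x)) \<in> Cc_plus T"
    and "J (\<lambda>x. \<Sum>j<m. c j * g (inv (s j) \<otimes> x)) = (\<Sum>j<m. c j) * J g"
proof -
  have tr: "(\<lambda>x. g (inv (s j) \<otimes> x)) \<in> Cc_plus T" if "j < m" for j
    using Cc_plus_compose[OF g homeomorphic_left] s[OF that] by simp
  have Cc: "(\<lambda>x. \<Sum>j<k. c j * g (inv (s j) \<otimes> x)) \<in> Cc_plus T" if "k \<le> m" for k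
    by (intro Cc_plus_sum Cc_plus_mult tr) (use s that in auto)
  then show "(\<lambda>x. \<Sum>j<m. c j * g (inv (s j) \<otimes> x)) \<in> Cc_plus T" by simp
  have "J (\<lambda>x. \<Sum>j<k. c j * g (inv (s j) \<otimes> x)) = (\<Sum>j<k. c j) * J g" if "k \<le> m" for k
    using that
  proof (induction k)
    case 0
    then show ?case using functional_zero[OF J] by simp
  next
    case (Suc k)
    then have k: "k < m" "0 \<le> c k" "s k \<in> carrier G" using s by auto
    have "J (\<lambda>x. c k * g (inv (s k) \<otimes> x)) = c k * J g"
      using functional_mult[OF J tr[OF k(1)] k(2)] functional_left[OF J g, of "inv (s k)"] k by simp
    then show ?case
      using functional_add[OF J Cc[of k] Cc_plus_mult[OF k(2) tr[OF k(1)]]] Suc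
      by (simp add: distrib_right)
  qed
  then show "J (\<lambda>x. \<Sum>j<m. c j * g (inv (s j) \<otimes> x)) = (\<Sum>j<m. c j) * J g" by simp
qed

text \<open>The error is measured by a multiple of some \<open>F\<close> in the cone, as constants
  need not have compact support. Since nothing can be subtracted, the two bounds are obtained by
  adding \<open>e * F\<close> to either side.\<close>

lemma functional_approx:
  assumes J: "invariant_functional J" and f: "f \<in> Cc_plus T" and F: "F \<in> Cc_plus T"
    and g: "g \<in> Cc_plus T" and e: "0 \<le> e"
    and s: "\<And>j. j < (m::nat) \<Longrightarrow> 0 \<le> c j \<and> s j \<in> carrier G"
    and app: "\<And>x. x \<in> carrier G \<Longrightarrow> \<bar>f x - (\<Sum>j<m. c j * g (inv (s j) \<otimes> x))\<bar> \<le> e * F x"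
  shows "\<bar>J f - (\<Sum>j<m. c j) * J g\<bar> \<le> e * J F"
proof -
  let ?S = "\<lambda>x. \<Sum>j<m. c j * g (inv (s j) \<otimes> x)"
  have S: "?S \<in> Cc_plus T" and JS: "J ?S = (\<Sum>j<m. c j) * J g"
    using functional_translates[OF J g, of m c s] s by auto
  have eF: "(\<lambda>x. e * F x) \<in> Cc_plus T" using e F by (rule Cc_plus_mult)
  have JeF: "J (\<lambda>x. e * F x) = e * J F" by (rule functional_mult[OF J F e])
  have "J f \<le> J (\<lambda>x. ?S x + e * F x)"
    by (rule functional_mono[OF J f Cc_plus_add[OF S eF]]) (use app in \<open>fastforce simp: abs_le_iff\<close>)
  moreover have "J ?S \<le> J (\<lambda>x. f x + e * F x)"
    by (rule functional_mono[OF J S Cc_plus_add[OF f eF]]) (use app in \<open>fastforce simp: abs_le_iff\<close>)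
  ultimately show ?thesis
    using functional_add[OF J S eF] functional_add[OF J f eF] JS JeF by (simp add: abs_le_iff)
qed

section \<open>Left Haar measures as invariant functionals\<close>

lemma
  assumes "left_haar_measure G T \<mu>"
  shows haar_radon: "radon_measure T \<mu>"
    and haar_nonzero: "emeasure \<mu> (space \<mu>) \<noteq> 0"
    and haar_left: "s \<in> carrier G \<Longrightarrow> E \<in> sets \<mu> \<Longrightarrow> emeasure \<mu> (s <# E) = emeasure \<mu> E"
  using assms unfolding left_haar_measure_iff by blast+

text \<open>Finitely many translates of \<open>U\<close> cover any given compact set. If
  \<open>U\<close> were null, all compact sets would be null, and inner regularity of the whole
  space would make the measure zero.\<close>

lemma haar_open_pos:
  assumes \<mu>: "left_haar_measure G T \<mu>" and U: "openin T U" "U \<noteq> {}"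
  shows "emeasure \<mu> U \<noteq> 0"
proof
  assume 0: "emeasure \<mu> U = 0"
  note r = haar_radon[OF \<mu>]
  have UG: "U \<subseteq> carrier G" using U openin_subset topspace by blast
  obtain u where u: "u \<in> U" using U by blast
  have "emeasure \<mu> K = 0" if K: "compactin T K" for K
  proof -
    have KG: "K \<subseteq> carrier G" using K compactin_subset_topspace topspace by blast
    have "K \<subseteq> (\<Union>s\<in>carrier G. s <# U)"
    proof
      fix k assume "k \<in> K"
      then have k: "k \<in> carrier G" using KG by blast
      then have "k = (k \<otimes> inv u) \<otimes> u" using u UG by (simp add: m_assoc subsetD)
      then have "k \<in> (k \<otimes> inv u) <# U" using u unfolding l_coset_image by blast
      moreover have "k \<otimes> inv u \<in> carrier G" using k u UG by auto
      ultimately show "k \<in> (\<Union>s\<in>carrier G. s <# U)" by blast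
    qed
    then obtain \<F> where "finite \<F>" "\<F> \<subseteq> (\<lambda>s. s <# U) ` carrier G" "K \<subseteq> \<Union>\<F>"
      using compactinD[OF K, of "(\<lambda>s. s <# U) ` carrier G"] open_l_coset[OF _ U(1)] by blast
    then obtain F where F: "finite F" "F \<subseteq> carrier G" "K \<subseteq> (\<Union>s\<in>F. s <# U)"
      using finite_subset_image by metis
    have "emeasure \<mu> K \<le> emeasure \<mu> (\<Union>s\<in>F. s <# U)"
      using F open_l_coset[OF _ U(1)] radon_open[OF r] by (intro emeasure_mono F(3) sets.finite_UN) auto
    also have "\<dots> \<le> (\<Sum>s\<in>F. emeasure \<mu> (s <# U))"
      using F open_l_coset[OF _ U(1)] radon_open[OF r] by (intro emeasure_subadditive_finite) auto
    also have "\<dots> = 0"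
      using F haar_left[OF \<mu> _ radon_open[OF r U(1)]] 0 by (simp add: subset_iff)
    finally show ?thesis by simp
  qed
  then have "(SUP K\<in>{K. compactin T K \<and> K \<subseteq> topspace T}. emeasure \<mu> K) = 0"
    by (simp flip: bot_ennreal)
  then have "emeasure \<mu> (space \<mu>) = 0" using radon_inner[OF r openin_topspace] radon_space[OF r] by metis
  then show False using haar_nonzero[OF \<mu>] by simp
qed

lemma haar_integral_pos:
  assumes "left_haar_measure G T \<mu>" "f \<in> Cc_plus T" "x \<in> carrier G" "f x \<noteq> 0"
  shows "0 < (\<integral>x. f x \<partial>\<mu>)"
  using Cc_plus_integral_pos[OF haar_radon[OF assms(1)] assms(2) haar_open_pos[OF assms(1)]] assms(3,4)
  by (simp add: topspace)

lemma haar_distr_left: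
  assumes \<mu>: "left_haar_measure G T \<mu>" and s: "s \<in> carrier G"
  shows "distr \<mu> \<mu> (\<lambda>x. s \<otimes> x) = \<mu>"
proof (rule measure_eqI)
  note r = haar_radon[OF \<mu>]
  have m: "(\<lambda>x. s \<otimes> x) \<in> measurable \<mu> \<mu>"
    by (rule measurable_continuous_map[OF r radon_sets_eq[OF r] homeomorphic_imp_continuous_map[OF homeomorphic_left[OF s]]])
  fix A assume "A \<in> sets (distr \<mu> \<mu> (\<lambda>x. s \<otimes> x))"
  then have A: "A \<in> sets \<mu>" by simp
  have "A \<subseteq> carrier G" using sets.sets_into_space[OF A] radon_space[OF r] topspace by simp
  then have "(\<lambda>x. s \<otimes> x) -` A \<inter> space \<mu> = inv s <# A"
    using s by (auto simp: l_coset_vimage radon_space[OF r] topspace)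
  then show "emeasure (distr \<mu> \<mu> (\<lambda>x. s \<otimes> x)) A = emeasure \<mu> A"
    using haar_left[OF \<mu> _ A] s by (simp add: emeasure_distr[OF m A])
qed simp

lemma haar_integral_left:
  assumes \<mu>: "left_haar_measure G T \<mu>" and s: "s \<in> carrier G" and f: "f \<in> borel_measurable \<mu>"
  shows "(\<integral>x. f (s \<otimes> x) \<partial>\<mu>) = (\<integral>x. f x \<partial>\<mu> :: real)"
proof -
  note r = haar_radon[OF \<mu>]
  have m: "(\<lambda>x. s \<otimes> x) \<in> measurable \<mu> \<mu>"
    by (rule measurable_continuous_map[OF r radon_sets_eq[OF r] homeomorphic_imp_continuous_map[OF homeomorphic_left[OF s]]])
  show ?thesis
    using integral_distr[OF m f] haar_distr_left[OF \<mu> s] by simp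
qed

lemma haar_functional:
  assumes \<mu>: "left_haar_measure G T \<mu>"
  shows "invariant_functional (\<lambda>f. \<integral>x. f x \<partial>\<mu>)"
proof -
  note r = haar_radon[OF \<mu>]
  note int = Cc_plus_integrable[OF r]
  show ?thesis
    unfolding invariant_functional_def
  proof (intro conjI ballI allI impI)
    show "(\<integral>x. f x \<partial>\<mu>) \<le> (\<integral>x. g x \<partial>\<mu>)"
      if "f \<in> Cc_plus T" "g \<in> Cc_plus T" "\<forall>x\<in>carrier G. f x \<le> g x" for f g
      using that int radon_space[OF r] topspace by (intro integral_mono) auto
    show "(\<integral>x. f (s \<otimes> x) \<partial>\<mu>) = (\<integral>x. f x \<partial>\<mu>)" if "f \<in> Cc_plus T" "s \<in> carrier G" for f s
      using haar_integral_left[OF \<mu> that(2) borel_measurable_integrable[OF int[OF that(1)]]] .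
  qed (use int in auto)
qed

end

section \<open>Uniqueness of Haar measure\<close>

context lc_group
begin

text \<open>The order of quantifiers is the point. \<open>V\<close> is fixed before
  \<open>g\<close>, so one bump \<open>g\<close> can serve two functions at the same time; and the
  coefficients do not refer to any functional, so their sum is the same for all of them.\<close>

definition approx_by_translates :: "('a \<Rightarrow> real) \<Rightarrow> ('a \<Rightarrow> real) \<Rightarrow> real \<Rightarrow> 'a set \<Rightarrow> bool" where
  "approx_by_translates f F e V \<longleftrightarrow>
     (\<forall>g\<in>Cc_plus T. (\<exists>x\<in>carrier G. g x \<noteq> 0) \<longrightarrow> (\<forall>x\<in>carrier G - V. g x = 0) \<longrightarrow>
        (\<exists>(m::nat) c s. (\<forall>j<m. 0 \<le> c j \<and> s j \<in> carrier G) \<and>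
          (\<forall>x\<in>carrier G. \<bar>f x - (\<Sum>j<m. c j * g (inv (s j) \<otimes> x))\<bar> \<le> e * F x)))"

lemma approx_by_translatesE:
  assumes "approx_by_translates f F e V" "g \<in> Cc_plus T" "\<exists>x\<in>carrier G. g x \<noteq> 0" "\<forall>x\<in>carrier G - V. g x = 0"
  obtains m :: nat and c s where "\<And>j. j < m \<Longrightarrow> 0 \<le> c j \<and> s j \<in> carrier G"
    "\<And>x. x \<in> carrier G \<Longrightarrow> \<bar>f x - (\<Sum>j<m. c j * g (inv (s j) \<otimes> x))\<bar> \<le> e * F x"
proof -
  have "\<exists>(m::nat) c s. (\<forall>j<m. 0 \<le> c j \<and> s j \<in> carrier G) \<and>
          (\<forall>x\<in>carrier G. \<bar>f x - (\<Sum>j<m. c j * g (inv (s j) \<otimes> x))\<bar> \<le> e * F x)"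
    using assms unfolding approx_by_translates_def by blast
  then show ?thesis using that by (elim exE conjE) blast
qed

text \<open>Up to a factor, \<open>f x\<close> is close to the integral of \<open>f y * g (y\<inverse> x)\<close> over \<open>y\<close>, and this integral is
  close to a Riemann sum in which \<open>y\<close> runs through finitely many points of the support of \<open>f\<close>.
  The bound \<open>F\<close> must not depend on the accuracy \<open>e\<close>: it is 1 on a compact set that contains the
  supports of all functions involved.\<close>

lemma Cc_plus_approx:
  assumes \<mu>: "left_haar_measure G T \<mu>" and f: "f \<in> Cc_plus T"
  obtains F where "F \<in> Cc_plus T"
    "\<And>e. 0 < e \<Longrightarrow> \<exists>V. openin T V \<and> \<one> \<in> V \<and> approx_by_translates f F e V"
proof -
  note r = haar_radon[OF \<mu>]
  note int = Cc_plus_integrable[OF r]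
  have space: "space \<mu> = carrier G" using radon_space[OF r] topspace by simp
  obtain K where K: "compactin T K" "\<And>x. x \<in> topspace T \<Longrightarrow> x \<notin> K \<Longrightarrow> f x = 0"
    using f Cc_plusE by blast
  obtain V0 C where V0: "openin T V0" "compactin T C" "\<one> \<in> V0" "V0 \<subseteq> C" by (rule compact_nbhd_one)
  have KG: "K \<subseteq> carrier G" and CG: "C \<subseteq> carrier G"
    using K(1) V0(2) compactin_subset_topspace topspace by blast+
  have f0: "0 \<le> f x" if "x \<in> carrier G" for x using that Cc_plusD(2)[OF f] topspace by simp
  have KC: "compactin T (K <#> C)" using K(1) V0(2) by (rule compact_set_mult)
  obtain F where F: "F \<in> Cc_plus T" "\<And>x. x \<in> K <#> C \<Longrightarrow> F x = 1"
    using Urysohn_Cc_plus[OF KC openin_topspace] KC compactin_subset_topspace by metis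
  have F0: "0 \<le> F x" if "x \<in> carrier G" for x using that Cc_plusD(2)[OF F(1)] topspace by simp
  have K_sub: "x \<in> K <#> C" if "x \<in> K" for x
  proof -
    have "x \<otimes> \<one> \<in> K <#> C" using that V0 unfolding set_mult_def by blast
    then show ?thesis using that KG by auto
  qed
  show ?thesis
  proof (rule that[OF F(1)])
    fix e :: real assume e: "0 < e"
    obtain V1 where V1: "openin T V1" "\<one> \<in> V1"
      "\<And>y v. y \<in> carrier G \<Longrightarrow> v \<in> V1 \<Longrightarrow> \<bar>f (y \<otimes> v) - f y\<bar> < e / 2"
      using uniformly_continuous_left[OF f, of "e / 2"] e by (metis half_gt_zero)
    let ?V = "V1 \<inter> V0"
    have appr: "\<exists>(m::nat) c s. (\<forall>j<m. 0 \<le> c j \<and> s j \<in> carrier G) \<and>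
          (\<forall>x\<in>carrier G. \<bar>f x - (\<Sum>j<m. c j * g (inv (s j) \<otimes> x))\<bar> \<le> e * F x)"
      if g: "g \<in> Cc_plus T" and gx: "\<exists>x\<in>carrier G. g x \<noteq> 0" and gV: "\<forall>x\<in>carrier G - ?V. g x = 0" for g
    proof -
      have g0: "0 \<le> g x" if "x \<in> carrier G" for x using that Cc_plusD(2)[OF g] topspace by simp
      have ginv: "(\<lambda>y. g (inv y)) \<in> Cc_plus T" by (rule Cc_plus_compose[OF g homeomorphic_inv])
      \<comment> \<open>The factor by which \<open>f\<close> will be multiplied. Substituting
        \<open>x \<otimes> y\<close> for \<open>y\<close> turns \<open>g (inv y \<otimes> x)\<close>
        into \<open>g (inv y)\<close>, so the weights in the averages below have the same total mass
        \<open>c0\<close> for every \<open>x\<close>.\<close>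
      define c0 where "c0 = (\<integral>y. g (inv y) \<partial>\<mu>)"
      obtain x0 where x0: "x0 \<in> carrier G" "g x0 \<noteq> 0" using gx by blast
      have c0: "0 < c0"
        unfolding c0_def by (rule haar_integral_pos[OF \<mu> ginv, of "inv x0"]) (use x0 in auto)
      have gi: "g (inv y \<otimes> x) = (\<lambda>y. g (inv y)) (inv x \<otimes> y)" if "x \<in> carrier G" "y \<in> carrier G" for x y
        using that by (simp add: inv_mult_group)
      have gCc: "(\<lambda>y. g (inv y \<otimes> x)) \<in> Cc_plus T" if x: "x \<in> carrier G" for x
        by (rule Cc_plus_compose[OF Cc_plus_compose[OF g homeomorphic_right[OF x]] homeomorphic_inv])
      have gint: "(\<integral>y. g (inv y \<otimes> x) \<partial>\<mu>) = c0" if x: "x \<in> carrier G" for x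
      proof -
        have "(\<integral>y. g (inv y \<otimes> x) \<partial>\<mu>) = (\<integral>y. (\<lambda>y. g (inv y)) (inv x \<otimes> y) \<partial>\<mu>)"
          by (rule Bochner_Integration.integral_cong) (use gi[OF x] space in auto)
        also have "\<dots> = c0"
          unfolding c0_def using x by (intro functional_left[OF haar_functional[OF \<mu>] ginv]) auto
        finally show ?thesis .
      qed
      define h where "h = (\<lambda>x. \<integral>y. f y * g (inv y \<otimes> x) \<partial>\<mu>)"
      have fgint: "integrable \<mu> (\<lambda>y. f y * g (inv y \<otimes> x))" if "x \<in> carrier G" for x
        by (rule int[OF Cc_plus_prod[OF f gCc[OF that]]])
      \<comment> \<open>\<open>h x\<close> averages \<open>f\<close> with weight
        \<open>g (inv y \<otimes> x)\<close>, which vanishes unless \<open>inv y \<otimes> x\<close>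
        lies in \<open>V1\<close>. There \<open>f y\<close> differs from \<open>f x\<close> by at
        most \<open>e / 2\<close>.\<close>
      have step1: "\<bar>c0 * f x - h x\<bar> \<le> e / 2 * c0" if x: "x \<in> carrier G" for x
      proof -
        have "c0 * f x - h x = (\<integral>y. f x * g (inv y \<otimes> x) - f y * g (inv y \<otimes> x) \<partial>\<mu>)"
          using int[OF gCc[OF x]] fgint[OF x] gint[OF x] by (simp add: h_def)
        also have "\<bar>\<dots>\<bar> \<le> (\<integral>y. \<bar>f x * g (inv y \<otimes> x) - f y * g (inv y \<otimes> x)\<bar> \<partial>\<mu>)"
          by (rule integral_abs_bound)
        also have "\<dots> \<le> (\<integral>y. e / 2 * g (inv y \<otimes> x) \<partial>\<mu>)"
        proof (rule integral_mono)
          show "integrable \<mu> (\<lambda>y. \<bar>f x * g (inv y \<otimes> x) - f y * g (inv y \<otimes> x)\<bar>)"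
            using int[OF gCc[OF x]] fgint[OF x] by (intro integrable_abs Bochner_Integration.integrable_diff) auto
          show "integrable \<mu> (\<lambda>y. e / 2 * g (inv y \<otimes> x))" using int[OF gCc[OF x]] by simp
          fix y assume "y \<in> space \<mu>"
          then have y: "y \<in> carrier G" using space by simp
          show "\<bar>f x * g (inv y \<otimes> x) - f y * g (inv y \<otimes> x)\<bar> \<le> e / 2 * g (inv y \<otimes> x)"
          proof (cases "inv y \<otimes> x \<in> V1")
            case True
            have "y \<otimes> (inv y \<otimes> x) = x" using x y by (simp flip: m_assoc)
            then have "\<bar>f x - f y\<bar> \<le> e / 2" using V1(3)[OF y True] by simp
            then have "\<bar>f x - f y\<bar> * g (inv y \<otimes> x) \<le> e / 2 * g (inv y \<otimes> x)"
              using g0[of "inv y \<otimes> x"] x y by (intro mult_right_mono) auto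
            moreover have "\<bar>f x * g (inv y \<otimes> x) - f y * g (inv y \<otimes> x)\<bar> = \<bar>f x - f y\<bar> * g (inv y \<otimes> x)"
              using g0[of "inv y \<otimes> x"] x y by (simp add: abs_mult flip: left_diff_distrib)
            ultimately show ?thesis by simp
          next
            case False
            then have "g (inv y \<otimes> x) = 0" using gV x y by blast
            then show ?thesis by simp
          qed
        qed
        also have "\<dots> = e / 2 * c0" using gint[OF x] by simp
        finally show ?thesis .
      qed
      define I where "I = (\<integral>y. f y \<partial>\<mu>)"
      have I0: "0 \<le> I" unfolding I_def by (rule functional_nonneg[OF haar_functional[OF \<mu>] f])
      \<comment> \<open>Chosen so that the Riemann sum costs at most the other half
        \<open>e / 2 * c0\<close> of the error. The summand 1 prevents division by zero when
        \<open>I\<close> is 0.\<close>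
      define d where "d = e * c0 / (2 * (I + 1))"
      have d: "0 < d" using e c0 I0 by (simp add: d_def)
      have dI: "d * I \<le> e / 2 * c0"
      proof -
        have "d * I \<le> d * (I + 1)" using d by simp
        also have "\<dots> = e / 2 * c0" using I0 by (simp add: d_def field_simps)
        finally show ?thesis .
      qed
      obtain W0 where W0: "openin T W0" "\<one> \<in> W0"
        "\<And>y v. y \<in> carrier G \<Longrightarrow> v \<in> W0 \<Longrightarrow> \<bar>g (v \<otimes> y) - g y\<bar> < d"
        using uniformly_continuous_right[OF g d] by blast
      obtain W where W: "openin T W" "\<one> \<in> W" "\<And>w. w \<in> W \<Longrightarrow> inv w \<in> W0"
        using symmetric_nbhd[OF W0(1,2)] by metis
      have WG: "W \<subseteq> carrier G" using W(1) openin_subset topspace by blast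
      have "K \<subseteq> (\<Union>s\<in>K. s <# W)"
      proof
        fix k assume k: "k \<in> K"
        then have "k \<otimes> \<one> \<in> k <# W" using W(2) unfolding l_coset_image by blast
        then have "k \<in> k <# W" using k KG by (simp add: subset_iff)
        then show "k \<in> (\<Union>s\<in>K. s <# W)" using k by blast
      qed
      then obtain \<F> where "finite \<F>" "\<F> \<subseteq> (\<lambda>s. s <# W) ` K" "K \<subseteq> \<Union>\<F>"
        using compactinD[OF K(1), of "(\<lambda>s. s <# W) ` K"] open_l_coset[OF _ W(1)] KG by blast
      then obtain S where S: "finite S" "S \<subseteq> K" "K \<subseteq> (\<Union>s\<in>S. s <# W)"
        using finite_subset_image by metis
      obtain m :: nat and s where s: "S = s ` {..<m}"
        using finite_imp_nat_seg_image_inj_on[OF S(1)] lessThan_def by metis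
      have sK: "s j \<in> K" if "j < m" for j using that s S(2) by auto
      have sG: "s j \<in> carrier G" if "j < m" for j using sK[OF that] KG by blast
      define A where "A = (\<lambda>j. s j <# W)"
      \<comment> \<open>Taking the first index whose translate contains \<open>y\<close> turns the
        finite cover of \<open>K\<close> into a partition into Borel sets
        \<open>D j\<close>.\<close>
      define k where "k = (\<lambda>y. LEAST j. y \<in> A j)"
      have k: "k y < m" "y \<in> A (k y)" if "y \<in> K" for y
      proof -
        have "y \<in> (\<Union>j<m. A j)" using S(3) that unfolding s A_def by blast
        then obtain j where j: "j < m" "y \<in> A j" by blast
        show "y \<in> A (k y)" unfolding k_def by (rule LeastI[of _ j]) (rule j)
        show "k y < m" using Least_le[of "\<lambda>j. y \<in> A j", OF j(2)] j(1) by (simp add: k_def)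
      qed
      define D where "D = (\<lambda>j. {y \<in> K. k y = j})"
      have D: "D j = K \<inter> A j - (\<Union>i<j. A i)" if "j < m" for j
      proof -
        have "k y = j \<longleftrightarrow> y \<in> A j \<and> (\<forall>i<j. y \<notin> A i)" if "y \<in> K" for y
          using k[OF that] not_less_Least[of _ "\<lambda>j. y \<in> A j"] unfolding k_def
          by (metis linorder_neqE_nat)
        then show ?thesis by (auto simp: D_def)
      qed
      have Am: "A j \<in> sets \<mu>" if "j < m" for j
        unfolding A_def using radon_open[OF r open_l_coset[OF sG[OF that] W(1)]] .
      have Dm: "D j \<in> sets \<mu>" if "j < m" for j
        unfolding D[OF that] using that Am radon_closed[OF r compact_closed[OF K(1)]]
        by (intro sets.Diff sets.Int sets.finite_UN) auto
      define a where "a = (\<lambda>j. \<integral>y. indicator (D j) y * f y \<partial>\<mu>)"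
      have a0: "0 \<le> a j" for j
        unfolding a_def by (rule integral_nonneg_AE) (use f0 space in \<open>auto intro!: AE_I2 mult_nonneg_nonneg\<close>)
      have iD: "integrable \<mu> (\<lambda>y. indicator (D j) y * f y)" if "j < m" for j
        using integrable_mult_indicator[OF Dm[OF that] int[OF f]] by simp
      have pick: "(\<Sum>j<m. indicator (D j) y * q j) = (q (k y) :: real)" if "y \<in> K" for y q
      proof -
        have "(\<Sum>j<m. indicator (D j) y * q j) = (\<Sum>j<m. if j = k y then q j else 0)"
          by (rule sum.cong) (use that in \<open>auto simp: D_def indicator_def\<close>)
        then show ?thesis using k(1)[OF that] by simp
      qed
      have step2: "\<bar>h x - (\<Sum>j<m. a j * g (inv (s j) \<otimes> x))\<bar> \<le> d * I" if x: "x \<in> carrier G" for x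
      proof -
        let ?q = "\<lambda>y. \<Sum>j<m. indicator (D j) y * f y * g (inv (s j) \<otimes> x)"
        have qint: "integrable \<mu> ?q"
          using iD by (intro Bochner_Integration.integrable_sum integrable_mult_left) auto
        have "(\<integral>y. ?q y \<partial>\<mu>) = (\<Sum>j<m. a j * g (inv (s j) \<otimes> x))"
          unfolding a_def using iD by (subst Bochner_Integration.integral_sum) auto
        then have "h x - (\<Sum>j<m. a j * g (inv (s j) \<otimes> x)) = (\<integral>y. f y * g (inv y \<otimes> x) - ?q y \<partial>\<mu>)"
          using fgint[OF x] qint by (simp add: h_def)
        also have "\<bar>\<dots>\<bar> \<le> (\<integral>y. \<bar>f y * g (inv y \<otimes> x) - ?q y\<bar> \<partial>\<mu>)"
          by (rule integral_abs_bound)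
        also have "\<dots> \<le> (\<integral>y. d * f y \<partial>\<mu>)"
        proof (rule integral_mono)
          show "integrable \<mu> (\<lambda>y. \<bar>f y * g (inv y \<otimes> x) - ?q y\<bar>)"
            using qint fgint[OF x] by (intro integrable_abs Bochner_Integration.integrable_diff) auto
          show "integrable \<mu> (\<lambda>y. d * f y)" using int[OF f] by simp
          fix y assume "y \<in> space \<mu>"
          then have y: "y \<in> carrier G" using space by simp
          show "\<bar>f y * g (inv y \<otimes> x) - ?q y\<bar> \<le> d * f y"
          proof (cases "y \<in> K")
            case True
            let ?z = "inv (s (k y)) \<otimes> x"
            have "?q y = f y * g ?z"
              using pick[OF True, of "\<lambda>j. f y * g (inv (s j) \<otimes> x)"] by (simp add: mult.assoc)
            then have "\<bar>f y * g (inv y \<otimes> x) - ?q y\<bar> = f y * \<bar>g (inv y \<otimes> x) - g ?z\<bar>"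
              using f0[OF y] by (simp add: abs_mult flip: right_diff_distrib)
            moreover have "\<bar>g (inv y \<otimes> x) - g ?z\<bar> \<le> d"
            proof -
              have sk: "s (k y) \<in> carrier G" using sG k(1)[OF True] by blast
              obtain w where w: "w \<in> W" "y = s (k y) \<otimes> w"
                using k(2)[OF True] by (auto simp: A_def l_coset_image)
              \<comment> \<open>Replacing \<open>y\<close> by the sample point
                \<open>s (k y)\<close> changes the argument of \<open>g\<close> by the left factor
                \<open>inv w\<close>. This is why uniform continuity from the right-hand version was
                needed for \<open>g\<close>.\<close>
              have "inv y = inv w \<otimes> inv (s (k y))"
                using w sk WG by (metis inv_mult_group subsetD)
              then have "inv y \<otimes> x = inv w \<otimes> ?z" using w sk WG x by (simp add: m_assoc subsetD)
              then show ?thesis using W0(3)[of ?z "inv w"] W(3)[OF w(1)] sk x by simp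
            qed
            ultimately show ?thesis using f0[OF y] by (metis mult.commute mult_left_mono)
          next
            case False
            then have "f y = 0" using K(2) y topspace by simp
            then show ?thesis by simp
          qed
        qed
        also have "\<dots> = d * I" by (simp add: I_def)
        finally show ?thesis .
      qed
      \<comment> \<open>On \<open>K <#> C\<close> the bound \<open>F\<close> is 1 and the two
        estimates add up after division by \<open>c0\<close>. Elsewhere everything vanishes: all
        sample points lie in \<open>K\<close> and \<open>g\<close> vanishes off
        \<open>C\<close>.\<close>
      have final: "\<bar>f x - (\<Sum>j<m. a j / c0 * g (inv (s j) \<otimes> x))\<bar> \<le> e * F x" if x: "x \<in> carrier G" for x
      proof (cases "x \<in> K <#> C")
        case True
        let ?S = "\<Sum>j<m. a j * g (inv (s j) \<otimes> x)"
        have "\<bar>c0 * f x - ?S\<bar> \<le> e * c0"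
          using step1[OF x] step2[OF x] dI by linarith
        then have "\<bar>c0 * f x - ?S\<bar> / c0 \<le> e" using c0 by (simp add: pos_divide_le_eq)
        moreover have "\<bar>c0 * f x - ?S\<bar> / c0 = \<bar>f x - ?S / c0\<bar>"
        proof -
          have "\<bar>c0 * f x - ?S\<bar> / c0 = \<bar>(c0 * f x - ?S) / c0\<bar>" using c0 by simp
          also have "(c0 * f x - ?S) / c0 = f x - ?S / c0" using c0 by (simp add: diff_divide_distrib)
          finally show ?thesis .
        qed
        ultimately show ?thesis using F(2)[OF True] by (simp add: sum_divide_distrib)
      next
        case False
        then have "f x = 0" using K_sub K(2) x topspace by auto
        moreover have "g (inv (s j) \<otimes> x) = 0" if j: "j < m" for j
        proof (rule ccontr)
          assume "g (inv (s j) \<otimes> x) \<noteq> 0"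
          then have "inv (s j) \<otimes> x \<in> C" using gV V0(4) x sG[OF j] by blast
          then have "s j \<otimes> (inv (s j) \<otimes> x) \<in> K <#> C" using sK[OF j] unfolding set_mult_def by blast
          then show False using False x sG[OF j] by (simp flip: m_assoc)
        qed
        ultimately show ?thesis using e F0[OF x] by simp
      qed
      show ?thesis
        by (rule exI[of _ m], rule exI[of _ "\<lambda>j. a j / c0"], rule exI[of _ s])
          (use a0 c0 sG final in auto)
    qed
    show "\<exists>V. openin T V \<and> \<one> \<in> V \<and> approx_by_translates f F e V"
      unfolding approx_by_translates_def by (rule exI[of _ ?V]) (use V0 V1 appr in blast)
  qed
qed

end

text \<open>The same \<open>r\<close> is nearly a ratio of \<open>q\<close> to \<open>b\<close> and
  of \<open>p\<close> to \<open>a\<close>. The permitted error grows with \<open>r\<close>, so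
  \<open>r\<close> has to be bounded independently of \<open>e\<close> first; this is where
  \<open>a\<close> must be positive.\<close>

lemma proportional_limit:
  fixes a b p q :: real
  assumes a: "0 < a" and b: "0 \<le> b"
    and app: "\<And>e. 0 < e \<Longrightarrow> \<exists>r\<ge>0. \<bar>q - r * b\<bar> \<le> e * (1 + r) \<and> \<bar>p - r * a\<bar> \<le> e * (1 + r)"
  shows "q * a = p * b"
proof (rule ccontr)
  assume ne: "q * a \<noteq> p * b"
  \<comment> \<open>For \<open>e \<le> a / 2\<close> the second estimate gives
    \<open>r * a \<le> \<bar>p\<bar> + a / 2 + a / 2 * r\<close>, and solving for \<open>r\<close>
    yields this bound.\<close>
  define B where "B = 2 * \<bar>p\<bar> / a + 1"
  have B: "1 \<le> B" using a by (simp add: B_def)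
  define P where "P = (1 + B) * (a + b)"
  have pos: "0 < P" using a b B by (simp add: P_def)
  \<comment> \<open>The first term of the minimum secures \<open>r \<le> B\<close>; the second makes
    the total error at most half of the supposed nonzero difference.\<close>
  define e where "e = min (a / 2) (\<bar>q * a - p * b\<bar> / (2 * P))"
  have e: "0 < e" using a pos ne by (simp add: e_def)
  have eP: "e \<le> \<bar>q * a - p * b\<bar> / (2 * P)" unfolding e_def by (rule min.cobounded2)
  obtain r where r: "0 \<le> r" "\<bar>q - r * b\<bar> \<le> e * (1 + r)" "\<bar>p - r * a\<bar> \<le> e * (1 + r)"
    using app[OF e] by blast
  have ea: "e \<le> a / 2" unfolding e_def by (rule min.cobounded1)
  have "e * (1 + r) \<le> a / 2 * (1 + r)" using ea r(1) by (intro mult_right_mono) simp_all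
  then have "r * a \<le> \<bar>p\<bar> + a / 2 + a / 2 * r" using r(3) by (auto simp: algebra_simps)
  then have "r * a \<le> 2 * \<bar>p\<bar> + a" by (simp add: algebra_simps)
  then have rB: "r \<le> B" using a by (simp add: B_def field_simps)
  have eB: "e * (1 + r) \<le> e * (1 + B)" using e rB by simp
  have "\<bar>q * a - p * b\<bar> = \<bar>(q - r * b) * a - (p - r * a) * b\<bar>" by (simp add: algebra_simps)
  also have "\<dots> \<le> \<bar>q - r * b\<bar> * a + \<bar>p - r * a\<bar> * b"
    using a b by (metis abs_mult abs_of_nonneg abs_triangle_ineq4 less_imp_le)
  also have "\<dots> \<le> e * (1 + B) * a + e * (1 + B) * b"
    using r eB a b by (intro add_mono mult_right_mono) auto
  also have "\<dots> = e * P" by (simp add: P_def algebra_simps)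
  also have "\<dots> \<le> \<bar>q * a - p * b\<bar> / (2 * P) * P" using eP pos by (intro mult_right_mono) simp_all
  also have "\<dots> = \<bar>q * a - p * b\<bar> / 2" using pos by simp
  finally show False using ne by simp
qed

context lc_group
begin

lemma small_bump:
  assumes "openin T V" "\<one> \<in> V"
  obtains g where "g \<in> Cc_plus T" "g \<one> = 1" "\<And>x. x \<in> carrier G - V \<Longrightarrow> g x = 0"
  using Urysohn_Cc_plus[of "{\<one>}" V] assms topspace by (metis Diff_iff compactin_sing empty_subsetI insert_subset one_closed singletonI)

text \<open>A fixed bump \<open>f0\<close> serves as the unit of comparison, so the constant is
  \<open>J f0 / I f0\<close>. It may be 0 because \<open>J\<close> may be the zero
  functional.\<close>

lemma haar_unique:
  assumes \<mu>: "left_haar_measure G T \<mu>" and J: "invariant_functional J"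
  obtains c where "0 \<le> c" "\<And>f. f \<in> Cc_plus T \<Longrightarrow> J f = c * (\<integral>x. f x \<partial>\<mu>)"
proof -
  define I where "I = (\<lambda>f :: 'a \<Rightarrow> real. \<integral>x. f x \<partial>\<mu>)"
  have I: "invariant_functional I" unfolding I_def by (rule haar_functional[OF \<mu>])
  obtain f0 where f0: "f0 \<in> Cc_plus T" "f0 \<one> = 1"
    using small_bump[of "topspace T"] topspace openin_topspace one_closed by metis
  have pos: "0 < I g" if "g \<in> Cc_plus T" "x \<in> carrier G" "g x \<noteq> 0" for g x
    unfolding I_def using haar_integral_pos[OF \<mu> that] .
  have a: "0 < I f0" by (rule pos[OF f0(1) one_closed]) (simp add: f0)
  have main: "J f * I f0 = J f0 * I f" if f: "f \<in> Cc_plus T" for f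
  proof (rule proportional_limit[OF a functional_nonneg[OF I f]])
    fix e :: real assume e: "0 < e"
    let ?P = "\<lambda>f F e V. openin T V \<and> \<one> \<in> V \<and> approx_by_translates f F e V"
    obtain F1 where F1: "F1 \<in> Cc_plus T" "\<And>e. 0 < e \<Longrightarrow> \<exists>V. ?P f F1 e V"
      by (rule Cc_plus_approx[OF \<mu> f]) blast
    obtain F2 where F2: "F2 \<in> Cc_plus T" "\<And>e. 0 < e \<Longrightarrow> \<exists>V. ?P f0 F2 e V"
      by (rule Cc_plus_approx[OF \<mu> f0(1)]) blast
    \<comment> \<open>An upper bound for both functionals on both error functions. Approximating to
      accuracy \<open>e / C\<close> makes every error at most \<open>e\<close>, and this works
      because \<open>F1\<close> and \<open>F2\<close> are fixed before the accuracy.\<close>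
    define C where "C = J F1 + I F1 + J F2 + I F2 + 1"
    have nn: "0 \<le> J F1" "0 \<le> I F1" "0 \<le> J F2" "0 \<le> I F2"
      using functional_nonneg[OF I] functional_nonneg[OF J] F1(1) F2(1) by auto
    have C: "0 < C" using nn by (simp add: C_def)
    have eC: "0 < e / C" using e C by simp
    obtain V1 where V1: "?P f F1 (e / C) V1" using F1(2)[OF eC] by blast
    obtain V2 where V2: "?P f0 F2 (e / C) V2" using F2(2)[OF eC] by blast
    obtain g where g: "g \<in> Cc_plus T" "g \<one> = 1" "\<And>x. x \<in> carrier G - (V1 \<inter> V2) \<Longrightarrow> g x = 0"
      using small_bump[of "V1 \<inter> V2"] V1 V2 by blast
    have Ig: "0 < I g" by (rule pos[OF g(1) one_closed]) (simp add: g)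
    define r where "r = J g / I g"
    have r0: "0 \<le> r" using functional_nonneg[OF J g(1)] Ig by (simp add: r_def)
    \<comment> \<open>The sum of the coefficients is common to \<open>J\<close> and
      \<open>I\<close>. As \<open>r * I g = J g\<close>, it cancels from
      \<open>J f' - r * I f'\<close>, leaving only the two approximation errors.\<close>
    have est: "\<bar>J f' - r * I f'\<bar> \<le> e * (1 + r)"
      if f': "f' \<in> Cc_plus T" and F: "F \<in> Cc_plus T" and V: "?P f' F (e / C) V" "V1 \<inter> V2 \<subseteq> V"
        and FC: "J F \<le> C" "I F \<le> C" for f' F V
    proof -
      have "\<exists>x\<in>carrier G. g x \<noteq> 0" using g(2) by (intro bexI[of _ \<one>]) auto
      moreover have "\<forall>x\<in>carrier G - V. g x = 0" using g(3) V(2) by blast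
      ultimately obtain m :: nat and c s where s: "\<And>j. j < m \<Longrightarrow> 0 \<le> c j \<and> s j \<in> carrier G"
          "\<And>x. x \<in> carrier G \<Longrightarrow> \<bar>f' x - (\<Sum>j<m. c j * g (inv (s j) \<otimes> x))\<bar> \<le> e / C * F x"
        using approx_by_translatesE[OF V(1)[THEN conjunct2, THEN conjunct2] g(1)] by blast
      let ?S = "\<Sum>j<m. c j"
      have 1: "\<bar>J f' - ?S * J g\<bar> \<le> e / C * J F"
        by (rule functional_approx[OF J f' F g(1) less_imp_le[OF eC] s])
      have 2: "\<bar>I f' - ?S * I g\<bar> \<le> e / C * I F"
        by (rule functional_approx[OF I f' F g(1) less_imp_le[OF eC] s])
      have "e / C * J F \<le> e / C * C" "e / C * I F \<le> e / C * C"
        using FC eC by (auto intro!: mult_left_mono simp del: times_divide_eq_left)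
      then have 3: "\<bar>J f' - ?S * J g\<bar> \<le> e" "\<bar>I f' - ?S * I g\<bar> \<le> e" using 1 2 C by auto
      have "J f' - r * I f' = (J f' - ?S * J g) - r * (I f' - ?S * I g)"
        using Ig by (simp add: r_def algebra_simps)
      also have "\<bar>\<dots>\<bar> \<le> \<bar>J f' - ?S * J g\<bar> + r * \<bar>I f' - ?S * I g\<bar>"
        using r0 by (metis abs_mult abs_of_nonneg abs_triangle_ineq4)
      also have "\<dots> \<le> e + r * e" using 3 r0 by (intro add_mono mult_left_mono) auto
      finally show ?thesis by (simp add: algebra_simps)
    qed
    have "\<bar>J f - r * I f\<bar> \<le> e * (1 + r)"
      by (rule est[OF f F1(1) V1]) (use nn in \<open>auto simp: C_def\<close>)
    moreover have "\<bar>J f0 - r * I f0\<bar> \<le> e * (1 + r)"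
      by (rule est[OF f0(1) F2(1) V2]) (use nn in \<open>auto simp: C_def\<close>)
    ultimately show "\<exists>r\<ge>0. \<bar>J f - r * I f\<bar> \<le> e * (1 + r) \<and> \<bar>J f0 - r * I f0\<bar> \<le> e * (1 + r)"
      using r0 by blast
  qed
  show ?thesis
  proof
    show "0 \<le> J f0 / I f0" using functional_nonneg[OF J f0(1)] a by simp
    show "J f = J f0 / I f0 * (\<integral>x. f x \<partial>\<mu>)" if "f \<in> Cc_plus T" for f
      using main[OF that] a by (simp add: I_def field_simps)
  qed
qed

end

section \<open>From contents to Radon measures\<close>

text \<open>Real values encode finiteness. No regularity is asked of \<open>H\<close>, since a limit
  of covering numbers gives none.\<close>

locale compact_content = lc_space T for T :: "'a topology" +
  fixes H :: "'a set \<Rightarrow> real"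
  assumes H_nonneg: "compactin T K \<Longrightarrow> 0 \<le> H K"
    and H_mono: "compactin T K \<Longrightarrow> compactin T L \<Longrightarrow> K \<subseteq> L \<Longrightarrow> H K \<le> H L"
    and H_subadditive: "compactin T K \<Longrightarrow> compactin T L \<Longrightarrow> H (K \<union> L) \<le> H K + H L"
    and H_additive: "compactin T K \<Longrightarrow> compactin T L \<Longrightarrow> K \<inter> L = {} \<Longrightarrow> H (K \<union> L) = H K + H L"
begin

definition inner_content :: "'a set \<Rightarrow> ennreal" where
  "inner_content U = (SUP K\<in>{K. compactin T K \<and> K \<subseteq> U}. ennreal (H K))"

definition outer_content :: "'a set \<Rightarrow> ennreal" where
  "outer_content E = (INF U\<in>{U. openin T U \<and> E \<subseteq> U}. inner_content U)"

text \<open>This measure need not agree with \<open>H\<close> on compact sets, where it is only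
  known to be at least \<open>H\<close>. The lower bound is what inner regularity of open sets
  requires.\<close>

definition content_measure :: "'a measure" where
  "content_measure = measure_of (topspace T) (sigma_sets (topspace T) {U. openin T U}) outer_content"

lemma H_empty: "H {} = 0"
  using H_additive[of "{}" "{}"] by simp

lemma inner_content_upper: "compactin T K \<Longrightarrow> K \<subseteq> U \<Longrightarrow> ennreal (H K) \<le> inner_content U"
  unfolding inner_content_def by (rule SUP_upper) simp

lemma inner_content_least:
  "(\<And>K. compactin T K \<Longrightarrow> K \<subseteq> U \<Longrightarrow> ennreal (H K) \<le> c) \<Longrightarrow> inner_content U \<le> c"
  unfolding inner_content_def by (rule SUP_least) simp

lemma inner_content_mono: "U \<subseteq> V \<Longrightarrow> inner_content U \<le> inner_content V"
  by (rule inner_content_least) (auto intro: inner_content_upper)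

lemma outer_content_lower: "openin T U \<Longrightarrow> E \<subseteq> U \<Longrightarrow> outer_content E \<le> inner_content U"
  unfolding outer_content_def by (rule INF_lower) simp

lemma outer_content_greatest:
  "(\<And>U. openin T U \<Longrightarrow> E \<subseteq> U \<Longrightarrow> c \<le> inner_content U) \<Longrightarrow> c \<le> outer_content E"
  unfolding outer_content_def by (rule INF_greatest) simp

lemma outer_content_open: "openin T U \<Longrightarrow> outer_content U = inner_content U"
  by (rule antisym[OF outer_content_lower outer_content_greatest]) (auto intro: inner_content_mono)

lemma outer_content_mono: "E \<subseteq> F \<Longrightarrow> outer_content E \<le> outer_content F"
  by (rule outer_content_greatest) (auto intro: outer_content_lower)

lemma outer_content_empty: "outer_content {} = 0"
proof -
  have "inner_content {} \<le> 0" by (rule inner_content_least) (simp add: H_empty)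
  then show ?thesis using outer_content_open[of "{}"] by simp
qed

lemma H_UN_le:
  assumes "finite I" "\<And>i. i \<in> I \<Longrightarrow> compactin T (L i)"
  shows "H (\<Union>i\<in>I. L i) \<le> (\<Sum>i\<in>I. H (L i))"
  using assms
proof (induction I)
  case empty
  then show ?case by (simp add: H_empty)
next
  case (insert i I)
  have "compactin T (\<Union>j\<in>I. L j)" using insert by (intro compactin_Union) auto
  then have "H (L i \<union> (\<Union>j\<in>I. L j)) \<le> H (L i) + H (\<Union>j\<in>I. L j)"
    using insert by (intro H_subadditive) auto
  then show ?case using insert by simp
qed

text \<open>A compact subset of the union is cut into finitely many compact pieces, each inside a
  single \<open>U i\<close>; local compactness provides the pieces and finite subadditivity of
  \<open>H\<close> sums them.\<close>

lemma inner_content_UN: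
  fixes U :: "nat \<Rightarrow> 'a set"
  assumes U: "\<And>i. openin T (U i)"
  shows "inner_content (\<Union>i. U i) \<le> (\<Sum>i. inner_content (U i))"
proof (rule inner_content_least)
  fix K assume K: "compactin T K" "K \<subseteq> (\<Union>i. U i)"
  have "\<exists>i V L. openin T V \<and> compactin T L \<and> x \<in> V \<and> V \<subseteq> L \<and> L \<subseteq> U i" if x: "x \<in> K" for x
  proof -
    obtain i where "x \<in> U i" using subsetD[OF K(2) x] by blast
    then show ?thesis using compact_nbhd[OF U[of i], of x] by metis
  qed
  then obtain i V L where VL: "\<And>x. x \<in> K \<Longrightarrow>
      openin T (V x) \<and> compactin T (L x) \<and> x \<in> V x \<and> V x \<subseteq> L x \<and> L x \<subseteq> U (i x)"
    by metis
  have "\<exists>\<F>. finite \<F> \<and> \<F> \<subseteq> V ` K \<and> K \<subseteq> \<Union>\<F>"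
    by (rule compactinD[OF K(1)]) (use VL in blast)+
  then obtain D where D: "finite D" "D \<subseteq> K" "K \<subseteq> (\<Union>x\<in>D. V x)"
    using finite_subset_image by metis
  \<comment> \<open>Several chosen points may have their neighbourhoods in the same open set. They
    are grouped by that index, so that each \<open>U j\<close> is charged only once.\<close>
  define M where "M = (\<lambda>j. K \<inter> (\<Union>x\<in>{x\<in>D. i x = j}. L x))"
  have M: "compactin T (M j)" "M j \<subseteq> U j" for j
  proof -
    have "compactin T (\<Union>x\<in>{x\<in>D. i x = j}. L x)" using D VL by (intro compactin_Union) auto
    then show "compactin T (M j)" unfolding M_def using K(1) by (intro compactin_Int)
    show "M j \<subseteq> U j" unfolding M_def using D VL by blast
  qed
  have "K \<subseteq> (\<Union>j\<in>i ` D. M j)"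
  proof
    fix x assume x: "x \<in> K"
    then obtain y where y: "y \<in> D" "x \<in> V y" using D by blast
    then have "x \<in> L y" using VL D by blast
    then show "x \<in> (\<Union>j\<in>i ` D. M j)" using x y unfolding M_def by blast
  qed
  then have K_eq: "K = (\<Union>j\<in>i ` D. M j)" unfolding M_def by blast
  have "ennreal (H K) \<le> ennreal (\<Sum>j\<in>i ` D. H (M j))"
    using H_UN_le[of "i ` D" M] D(1) M(1) K_eq by (intro ennreal_leI) auto
  also have "\<dots> = (\<Sum>j\<in>i ` D. ennreal (H (M j)))" using M(1) H_nonneg by simp
  also have "\<dots> \<le> (\<Sum>j\<in>i ` D. inner_content (U j))" by (intro sum_mono inner_content_upper M)
  also have "\<dots> \<le> (\<Sum>j. inner_content (U j))" using D(1) by (intro sum_le_suminf) auto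
  finally show "ennreal (H K) \<le> (\<Sum>j. inner_content (U j))" .
qed

lemma outer_content_countably_subadditive:
  fixes A :: "nat \<Rightarrow> 'a set"
  assumes A: "\<And>i. A i \<subseteq> topspace T"
  shows "outer_content (\<Union>i. A i) \<le> (\<Sum>i. outer_content (A i))"
proof (rule ennreal_le_epsilon)
  fix e :: real assume e: "0 < e" and fin: "(\<Sum>i. outer_content (A i)) < top_class.top"
  have "\<exists>U. openin T U \<and> A n \<subseteq> U \<and> inner_content U \<le> outer_content (A n) + e * (1/2)^Suc n" for n
  proof -
    have "outer_content (A n) \<noteq> \<infinity>" using fin by (auto simp: less_top dest!: ennreal_suminf_lessD)
    then have "\<exists>U\<in>{U. openin T U \<and> A n \<subseteq> U}. inner_content U < outer_content (A n) + e * (1/2)^Suc n"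
      using e by (intro INF_approx_ennreal) (auto simp: outer_content_def)
    then show ?thesis by (auto intro: less_imp_le)
  qed
  then obtain U where U: "\<And>n. openin T (U n)" "\<And>n. A n \<subseteq> U n"
    "\<And>n. inner_content (U n) \<le> outer_content (A n) + e * (1/2)^Suc n" by metis
  have "outer_content (\<Union>i. A i) \<le> inner_content (\<Union>i. U i)"
    using U by (intro outer_content_lower) auto
  also have "\<dots> \<le> (\<Sum>i. inner_content (U i))" by (rule inner_content_UN[OF U(1)])
  also have "\<dots> \<le> (\<Sum>n. outer_content (A n) + e * (1/2) ^ Suc n)"
    by (intro suminf_le allI U) auto
  also have "\<dots> = (\<Sum>n. outer_content (A n)) + (\<Sum>n. ennreal e * ennreal ((1/2) ^ Suc n))"
    using e by (subst suminf_add[symmetric])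
      (auto simp del: ennreal_suminf_cmult simp add: ennreal_mult[symmetric])
  also have "\<dots> = (\<Sum>n. outer_content (A n)) + e"
    unfolding ennreal_suminf_cmult
    by (subst suminf_ennreal_eq[OF zero_le_power power_half_series]) auto
  finally show "outer_content (\<Union>i. A i) \<le> (\<Sum>n. outer_content (A n)) + e" .
qed

lemma outer_measure_space_content: "outer_measure_space (Pow (topspace T)) outer_content"
  unfolding outer_measure_space_def
proof (intro conjI)
  show "positive (Pow (topspace T)) outer_content" by (simp add: positive_def outer_content_empty)
  show "increasing (Pow (topspace T)) outer_content" by (auto simp: increasing_def intro: outer_content_mono)
  show "countably_subadditive (Pow (topspace T)) outer_content"
    unfolding countably_subadditive_def by (auto intro!: outer_content_countably_subadditive)
qed

lemma outer_content_Un: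
  assumes "A \<subseteq> topspace T" "B \<subseteq> topspace T"
  shows "outer_content (A \<union> B) \<le> outer_content A + outer_content B"
proof -
  interpret P: sigma_algebra "topspace T" "Pow (topspace T)" by (rule sigma_algebra_Pow)
  have "subadditive (Pow (topspace T)) outer_content"
    using outer_measure_space_content unfolding outer_measure_space_def
    by (intro P.countably_subadditive_subadditive) auto
  then have "\<And>x y. x \<subseteq> topspace T \<Longrightarrow> y \<subseteq> topspace T \<Longrightarrow> x \<inter> y = {} \<Longrightarrow>
      outer_content (x \<union> y) \<le> outer_content x + outer_content y"
    by (simp add: subadditive_def)
  from this[of A "B - A"] have "outer_content (A \<union> B) \<le> outer_content A + outer_content (B - A)"
    using assms by auto
  also have "\<dots> \<le> outer_content A + outer_content B" by (intro add_left_mono outer_content_mono) auto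
  finally show ?thesis .
qed

text \<open>First \<open>V \<inter> U\<close> is exhausted by a compact \<open>K\<close>, then the
  open set \<open>V - K\<close>, which contains \<open>V - U\<close>, by a compact \<open>L\<close>.
  The two are disjoint, so additivity of \<open>H\<close> applies inside \<open>V\<close>. The order
  matters: \<open>V - U\<close> itself need not be open.\<close>

lemma inner_content_split:
  assumes U: "openin T U" and V: "openin T V"
  shows "inner_content (V \<inter> U) + outer_content (V - U) \<le> inner_content V"
proof -
  have le: "ennreal (H K) + outer_content (V - U) \<le> inner_content V" if K: "compactin T K" "K \<subseteq> V \<inter> U" for K
  proof -
    have VK: "openin T (V - K)" using V compact_closed[OF K(1)] by (rule openin_diff)
    have "ennreal (H L) + ennreal (H K) \<le> inner_content V" if L: "compactin T L" "L \<subseteq> V - K" for L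
    proof -
      have "ennreal (H L) + ennreal (H K) = ennreal (H (L \<union> K))"
      proof -
        have "L \<inter> K = {}" using L by blast
        then show ?thesis using H_additive[OF L(1) K(1)] H_nonneg[OF L(1)] H_nonneg[OF K(1)] by simp
      qed
      also have "\<dots> \<le> inner_content V" using L K by (intro inner_content_upper compactin_Un) auto
      finally show ?thesis .
    qed
    then have "(SUP L\<in>{L. compactin T L \<and> L \<subseteq> V - K}. ennreal (H L) + ennreal (H K)) \<le> inner_content V"
      by (intro SUP_least) auto
    moreover have "{L. compactin T L \<and> L \<subseteq> V - K} \<noteq> {}" by (auto intro!: exI[of _ "{}"])
    ultimately have "inner_content (V - K) + ennreal (H K) \<le> inner_content V"
      unfolding inner_content_def[of "V - K"] by (subst (asm) ennreal_SUP_add_left)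
    moreover have "outer_content (V - U) \<le> inner_content (V - K)"
      using K VK by (intro outer_content_lower) auto
    ultimately show ?thesis by (metis add.commute add_left_mono order_trans)
  qed
  then have "(SUP K\<in>{K. compactin T K \<and> K \<subseteq> V \<inter> U}. ennreal (H K) + outer_content (V - U)) \<le> inner_content V"
    by (intro SUP_least) auto
  moreover have "{K. compactin T K \<and> K \<subseteq> V \<inter> U} \<noteq> {}" by (auto intro!: exI[of _ "{}"])
  ultimately show ?thesis
    unfolding inner_content_def[of "V \<inter> U"] by (subst (asm) ennreal_SUP_add_left)
qed

text \<open>The Caratheodory condition asks for arbitrary test sets \<open>X\<close>; the case of
  open test sets is enough because \<open>outer_content\<close> is an infimum over them.\<close>

lemma open_lambda_system:
  assumes U: "openin T U"
  shows "U \<in> lambda_system (topspace T) (Pow (topspace T)) outer_content"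
  unfolding lambda_system_def
proof (intro CollectI conjI ballI)
  show "U \<in> Pow (topspace T)" using U openin_subset by blast
  fix X assume "X \<in> Pow (topspace T)"
  then have X: "X \<subseteq> topspace T" by simp
  show "outer_content (U \<inter> X) + outer_content ((topspace T - U) \<inter> X) = outer_content X"
  proof (rule antisym)
    show "outer_content (U \<inter> X) + outer_content ((topspace T - U) \<inter> X) \<le> outer_content X"
    proof (rule outer_content_greatest)
      fix V assume V: "openin T V" "X \<subseteq> V"
      have "outer_content (U \<inter> X) \<le> inner_content (V \<inter> U)" using U V by (intro outer_content_lower) auto
      moreover have "outer_content ((topspace T - U) \<inter> X) \<le> outer_content (V - U)"
        using V by (intro outer_content_mono) auto
      ultimately show "outer_content (U \<inter> X) + outer_content ((topspace T - U) \<inter> X) \<le> inner_content V"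
        using inner_content_split[OF U V(1)] by (meson add_mono order_trans)
    qed
    have "X = (U \<inter> X) \<union> ((topspace T - U) \<inter> X)" using X by blast
    then show "outer_content X \<le> outer_content (U \<inter> X) + outer_content ((topspace T - U) \<inter> X)"
      using outer_content_Un[of "U \<inter> X" "(topspace T - U) \<inter> X"] X by (metis Diff_subset le_infI1 le_infI2)
  qed
qed

lemma
  shows sets_content_measure: "sets content_measure = sigma_sets (topspace T) {U. openin T U}"
    and emeasure_content_measure: "E \<in> sets content_measure \<Longrightarrow> emeasure content_measure E = outer_content E"
proof -
  interpret P: sigma_algebra "topspace T" "Pow (topspace T)" by (rule sigma_algebra_Pow)
  let ?L = "lambda_system (topspace T) (Pow (topspace T)) outer_content"
  let ?B = "sigma_sets (topspace T) {U. openin T U}"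
  have sub: "{U. openin T U} \<subseteq> Pow (topspace T)" by (auto dest: openin_subset)
  have L: "measure_space (topspace T) ?L outer_content"
    by (rule P.caratheodory_lemma[OF outer_measure_space_content])
  have B: "sigma_algebra (topspace T) ?B" by (rule sigma_algebra_sigma_sets[OF sub])
  have "?B \<subseteq> ?L"
    using L open_lambda_system unfolding measure_space_def
    by (intro sigma_algebra.sigma_sets_subset) auto
  then have M: "measure_space (topspace T) ?B outer_content" by (rule measure_down[OF L B])
  have BP: "?B \<subseteq> Pow (topspace T)" using sigma_sets_into_sp[OF sub] by blast
  show sets: "sets content_measure = ?B"
    unfolding content_measure_def
    by (simp add: sets_measure_of[OF BP] sigma_algebra.sigma_sets_eq[OF B])
  show "emeasure content_measure E = outer_content E" if "E \<in> sets content_measure"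
    unfolding content_measure_def
    by (rule emeasure_measure_of_sigma[OF B]) (use M that sets in \<open>auto simp: measure_space_def\<close>)
qed

lemma content_measure_open:
  "openin T U \<Longrightarrow> emeasure content_measure U = inner_content U"
  by (simp add: emeasure_content_measure sets_content_measure outer_content_open)

lemma radon_content_measure: "radon_measure T content_measure"
  unfolding radon_measure_def
proof (intro conjI allI impI ballI)
  have sub: "{U. openin T U} \<subseteq> Pow (topspace T)" by (auto dest: openin_subset)
  show "sets content_measure = sets (sigma (topspace T) {U. openin T U})"
    using sub by (simp add: sets_content_measure)
  have cm: "K \<in> sets content_measure" if K: "compactin T K" for K
  proof -
    have "topspace T - (topspace T - K) = K" using compactin_subset_topspace[OF K] by blast
    moreover have "topspace T - (topspace T - K) \<in> sigma_sets (topspace T) {U. openin T U}"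
      using compact_closed[OF K] by (intro sigma_sets.Compl sigma_sets.Basic) auto
    ultimately show ?thesis by (simp add: sets_content_measure)
  qed
  show "emeasure content_measure K < \<infinity>" if K: "compactin T K" for K
  proof -
    \<comment> \<open>\<open>H K\<close> does not bound the measure of \<open>K\<close>, so
      finiteness is taken from a larger compact set with \<open>K\<close> in its interior.\<close>
    obtain V L where VL: "openin T V" "compactin T L" "K \<subseteq> V" "V \<subseteq> L"
      using locally_compact Hausdorff K locally_compact_space_compact_closed_compact[of T] by metis
    have "emeasure content_measure K \<le> inner_content V"
      using VL by (simp add: emeasure_content_measure[OF cm[OF K]] outer_content_lower)
    also have "\<dots> \<le> ennreal (H L)"
      using VL by (intro inner_content_least ennreal_leI H_mono) auto
    also have "\<dots> < \<infinity>" by simp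
    finally show ?thesis .
  qed
  show "emeasure content_measure E = (INF U\<in>{U. openin T U \<and> E \<subseteq> U}. emeasure content_measure U)"
    if "E \<in> sets content_measure" for E
    unfolding emeasure_content_measure[OF that] outer_content_def[of E]
    by (rule INF_cong) (auto simp: content_measure_open)
  show "emeasure content_measure U = (SUP K\<in>{K. compactin T K \<and> K \<subseteq> U}. emeasure content_measure K)"
    if U: "openin T U" for U
  proof (rule antisym)
    \<comment> \<open>Every open superset of \<open>K\<close> already has \<open>K\<close> among its
      compact subsets. This is the bridge from the supremum of \<open>H\<close> to the supremum of
      the measure.\<close>
    have "ennreal (H K) \<le> emeasure content_measure K" if "compactin T K" for K
      unfolding emeasure_content_measure[OF cm[OF that]]
      using that by (intro outer_content_greatest inner_content_upper)
    then show "emeasure content_measure U \<le> (SUP K\<in>{K. compactin T K \<and> K \<subseteq> U}. emeasure content_measure K)"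
      unfolding content_measure_open[OF U] by (intro inner_content_least) (auto intro: SUP_upper2)
    show "(SUP K\<in>{K. compactin T K \<and> K \<subseteq> U}. emeasure content_measure K) \<le> emeasure content_measure U"
      using U by (intro SUP_least emeasure_mono) (auto simp: sets_content_measure)
  qed
qed

end

section \<open>Existence of Haar measure\<close>

context lc_group
begin

section \<open>Covering numbers\<close>

definition nbhds_one :: "'a set set" where
  "nbhds_one = {V. openin T V \<and> \<one> \<in> V}"

definition covers :: "'a set \<Rightarrow> 'a set \<Rightarrow> 'a set \<Rightarrow> bool" where
  "covers S V K \<longleftrightarrow> finite S \<and> S \<subseteq> carrier G \<and> K \<subseteq> (\<Union>s\<in>S. s <# V)"

text \<open>Haar's covering number, usually written (K:V). The \<open>LEAST\<close> is meaningful
  once some finite cover exists, which \<open>covers_exists\<close> supplies for compact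
  \<open>K\<close>.\<close>

definition cover_num :: "'a set \<Rightarrow> 'a set \<Rightarrow> nat" where
  "cover_num K V = (LEAST n. \<exists>S. covers S V K \<and> card S = n)"

lemma covers_exists:
  assumes V: "V \<in> nbhds_one" and K: "compactin T K"
  obtains S where "covers S V K"
proof -
  have KG: "K \<subseteq> carrier G" using compactin_subset_topspace[OF K] topspace by simp
  have sub: "K \<subseteq> \<Union>((\<lambda>s. s <# V) ` K)"
  proof
    fix k assume k: "k \<in> K"
    then have "k \<otimes> \<one> \<in> k <# V" using V unfolding l_coset_image nbhds_one_def by blast
    then have "k \<in> k <# V" using k KG by (simp add: subset_iff)
    then show "k \<in> \<Union>((\<lambda>s. s <# V) ` K)" using k by blast
  qed
  have "\<exists>\<F>. finite \<F> \<and> \<F> \<subseteq> (\<lambda>s. s <# V) ` K \<and> K \<subseteq> \<Union>\<F>"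
    using V open_l_coset KG by (intro compactinD[OF K _ sub]) (auto simp: nbhds_one_def)
  then obtain S where "finite S" "S \<subseteq> K" "K \<subseteq> (\<Union>s\<in>S. s <# V)"
    using finite_subset_image by metis
  then show ?thesis using that KG unfolding covers_def by blast
qed

lemma cover_num_le: "covers S V K \<Longrightarrow> cover_num K V \<le> card S"
  unfolding cover_num_def by (rule Least_le) blast

lemma cover_num_witness:
  assumes "V \<in> nbhds_one" "compactin T K"
  obtains S where "covers S V K" "card S = cover_num K V"
proof -
  have "\<exists>n S. covers S V K \<and> card S = n" using covers_exists[OF assms] by blast
  then have "\<exists>S. covers S V K \<and> card S = cover_num K V"
    unfolding cover_num_def by (rule LeastI_ex)
  then show ?thesis using that by blast
qed

lemma cover_num_mono:
  assumes "V \<in> nbhds_one" "compactin T L" "K \<subseteq> L"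
  shows "cover_num K V \<le> cover_num L V"
proof -
  obtain S where S: "covers S V L" "card S = cover_num L V" using cover_num_witness assms by blast
  then have "covers S V K" using assms(3) unfolding covers_def by blast
  then show ?thesis using S(2) cover_num_le by metis
qed

lemma cover_num_Un:
  assumes "V \<in> nbhds_one" "compactin T K" "compactin T L"
  shows "cover_num (K \<union> L) V \<le> cover_num K V + cover_num L V"
proof -
  obtain S where S: "covers S V K" "card S = cover_num K V" using cover_num_witness assms by blast
  obtain R where R: "covers R V L" "card R = cover_num L V" using cover_num_witness assms by blast
  have "covers (S \<union> R) V (K \<union> L)" using S R unfolding covers_def by blast
  then have "cover_num (K \<union> L) V \<le> card (S \<union> R)" by (rule cover_num_le)
  also have "\<dots> \<le> card S + card R" by (rule card_Un_le)
  finally show ?thesis using S R by simp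
qed

lemma l_coset_l_coset:
  "s \<in> carrier G \<Longrightarrow> t \<in> carrier G \<Longrightarrow> V \<subseteq> carrier G \<Longrightarrow> s <# (t <# V) = (s \<otimes> t) <# V"
  unfolding l_coset_image image_image by (intro image_cong refl) (auto simp: m_assoc)

lemma nbhds_one_carrier: "V \<in> nbhds_one \<Longrightarrow> V \<subseteq> carrier G"
  unfolding nbhds_one_def using openin_subset topspace by blast

lemma cover_num_l_coset_le:
  assumes V: "V \<in> nbhds_one" and K: "compactin T K" and s: "s \<in> carrier G"
  shows "cover_num (s <# K) V \<le> cover_num K V"
proof -
  obtain S where S: "covers S V K" "card S = cover_num K V" using cover_num_witness assms by blast
  have "s <# K \<subseteq> (\<Union>t\<in>S. s <# (t <# V))" using S(1) unfolding covers_def l_coset_image[of s] by blast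
  also have "\<dots> = (\<Union>t\<in>(\<lambda>t. s \<otimes> t) ` S. t <# V)"
    using S(1) l_coset_l_coset[OF s _ nbhds_one_carrier[OF V]] unfolding covers_def by (auto simp: subset_iff)
  finally have "covers ((\<lambda>t. s \<otimes> t) ` S) V (s <# K)"
    using S(1) s unfolding covers_def by auto
  then have "cover_num (s <# K) V \<le> card ((\<lambda>t. s \<otimes> t) ` S)" by (rule cover_num_le)
  also have "\<dots> \<le> card S" using S(1) by (intro card_image_le) (simp add: covers_def)
  finally show ?thesis using S(2) by simp
qed

lemma l_coset_inv:
  assumes "s \<in> carrier G" "K \<subseteq> carrier G"
  shows "inv s <# (s <# K) = K"
  using l_coset_l_coset[of "inv s" s K] assms by (simp add: lcos_mult_one)

lemma cover_num_l_coset: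
  assumes V: "V \<in> nbhds_one" and K: "compactin T K" and s: "s \<in> carrier G"
  shows "cover_num (s <# K) V = cover_num K V"
proof (rule antisym[OF cover_num_l_coset_le[OF assms]])
  have "K \<subseteq> carrier G" using compactin_subset_topspace[OF K] topspace by simp
  then show "cover_num K V \<le> cover_num (s <# K) V"
    using cover_num_l_coset_le[OF V compact_l_coset[OF s K], of "inv s"] s l_coset_inv[OF s] by simp
qed

lemma cover_num_pos:
  assumes "V \<in> nbhds_one" "compactin T K" "K \<noteq> {}"
  shows "0 < cover_num K V"
proof (rule ccontr)
  assume "\<not> 0 < cover_num K V"
  then obtain S where "covers S V K" "card S = 0" using cover_num_witness assms by (metis neq0_conv)
  then show False using assms(3) unfolding covers_def by auto
qed

text \<open>Each translate of \<open>V0\<close> in a cover of \<open>K\<close> is itself covered by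
  a translated cover of \<open>K0\<close>. The gain is a bound on the quotient of (K:V) by (K0:V)
  that does not depend on \<open>V\<close>, without which no limit could be taken.\<close>

lemma cover_num_mult:
  assumes V: "V \<in> nbhds_one" and K: "compactin T K" and K0: "compactin T K0"
    and V0: "V0 \<in> nbhds_one" "V0 \<subseteq> K0"
  shows "cover_num K V \<le> cover_num K V0 * cover_num K0 V"
proof -
  obtain S where S: "covers S V0 K" "card S = cover_num K V0" using cover_num_witness K V0 by blast
  obtain R where R: "covers R V K0" "card R = cover_num K0 V" using cover_num_witness V K0 by blast
  have RG: "R \<subseteq> carrier G" and SG: "S \<subseteq> carrier G" using R S by (auto simp: covers_def)
  let ?P = "(\<lambda>(s, r). s \<otimes> r) ` (S \<times> R)"
  have "K \<subseteq> (\<Union>p\<in>?P. p <# V)"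
  proof
    fix x assume "x \<in> K"
    then obtain s where s: "s \<in> S" "x \<in> s <# V0" using S(1) unfolding covers_def by blast
    then obtain v where v: "v \<in> V0" "x = s \<otimes> v" unfolding l_coset_image by blast
    then obtain r where r: "r \<in> R" "v \<in> r <# V" using R(1) V0(2) unfolding covers_def by blast
    have "x \<in> s <# (r <# V)" using v(2) r(2) unfolding l_coset_image[of s] by blast
    then have "x \<in> (s \<otimes> r) <# V"
      using s r RG SG l_coset_l_coset[OF _ _ nbhds_one_carrier[OF V]] by (simp add: subset_iff)
    then show "x \<in> (\<Union>p\<in>?P. p <# V)" using s r by force
  qed
  then have "covers ?P V K" using R S unfolding covers_def by (auto simp: subset_iff)
  then have "cover_num K V \<le> card ?P" by (rule cover_num_le)
  also have "\<dots> \<le> card (S \<times> R)" using R(1) S(1) by (intro card_image_le) (simp add: covers_def)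
  finally show ?thesis using R S by (simp add: card_cartesian_product)
qed

text \<open>If one translate met both sets, at \<open>s \<otimes> v\<close> and
  \<open>s \<otimes> w\<close>, then right multiplication by \<open>inv v \<otimes> w\<close> would
  carry a point of \<open>K\<close> into \<open>L\<close>. The tube lemma forbids this for elements
  near the identity, and continuity of \<open>inv v \<otimes> w\<close> brings it there.\<close>

lemma nbhd_separating:
  assumes K: "compactin T K" and L: "compactin T L" and disj: "K \<inter> L = {}"
  obtains W where "W \<in> nbhds_one"
    "\<And>s. s \<in> carrier G \<Longrightarrow> (s <# W) \<inter> K = {} \<or> (s <# W) \<inter> L = {}"
proof -
  have KG: "K \<subseteq> carrier G" and LG: "L \<subseteq> carrier G"
    using K L compactin_subset_topspace topspace by blast+
  define P where "P = {p \<in> topspace (prod_topology T T). fst p \<otimes> snd p \<in> topspace T - L}"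
  have "openin (prod_topology T T) P"
    unfolding P_def using compact_closed[OF L]
    by (intro openin_continuous_map_preimage[OF continuous_mult[OF continuous_map_fst continuous_map_snd]]) auto
  moreover have "K \<times> {\<one>} \<subseteq> P" using KG disj by (auto simp: P_def topspace subset_iff)
  ultimately obtain U0 W0 where W0: "openin T W0" "K \<subseteq> U0" "\<one> \<in> W0" "U0 \<times> W0 \<subseteq> P"
    using tube_lemma_left[OF _ K, of T P \<one>] topspace by auto
  define Q where "Q = {p \<in> topspace (prod_topology T T). inv (fst p) \<otimes> snd p \<in> W0}"
  have "openin (prod_topology T T) Q"
    unfolding Q_def using W0(1)
    by (intro openin_continuous_map_preimage[OF continuous_mult[OF continuous_inv[OF continuous_map_fst] continuous_map_snd]])
  moreover have "(\<one>, \<one>) \<in> Q" using W0(3) by (simp add: Q_def topspace)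
  ultimately obtain W1 W2 where W12: "openin T W1" "openin T W2" "\<one> \<in> W1" "\<one> \<in> W2" "W1 \<times> W2 \<subseteq> Q"
    using openin_prod_topology_alt[of T T Q] by metis
  show ?thesis
  proof
    show "W1 \<inter> W2 \<in> nbhds_one" using W12 by (auto simp: nbhds_one_def)
    show "(s <# (W1 \<inter> W2)) \<inter> K = {} \<or> (s <# (W1 \<inter> W2)) \<inter> L = {}" if s: "s \<in> carrier G" for s
    proof (rule ccontr)
      assume "\<not> ((s <# (W1 \<inter> W2)) \<inter> K = {} \<or> (s <# (W1 \<inter> W2)) \<inter> L = {})"
      then obtain v w where vw: "v \<in> W1 \<inter> W2" "w \<in> W1 \<inter> W2" "s \<otimes> v \<in> K" "s \<otimes> w \<in> L"
        unfolding l_coset_image by blast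
      have "(v, w) \<in> Q" using vw W12(5) by blast
      then have "inv v \<otimes> w \<in> W0" and vG: "v \<in> carrier G" "w \<in> carrier G" by (auto simp: Q_def topspace)
      then have "(s \<otimes> v, inv v \<otimes> w) \<in> P" using vw(3) W0 by blast
      then have "(s \<otimes> v) \<otimes> (inv v \<otimes> w) \<notin> L" by (simp add: P_def)
      moreover have "v \<otimes> (inv v \<otimes> w) = w" using vG by (simp flip: m_assoc)
      then have "(s \<otimes> v) \<otimes> (inv v \<otimes> w) = s \<otimes> w" using s vG by (simp add: m_assoc)
      ultimately show False using vw(4) by simp
    qed
  qed
qed

text \<open>In an optimal cover of the union, the members that meet \<open>K\<close> and those that
  meet \<open>L\<close> form disjoint families, each covering its own set.\<close>

lemma cover_num_disjoint:
  assumes V: "V \<in> nbhds_one" and K: "compactin T K" and L: "compactin T L"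
    and sep: "\<And>s. s \<in> carrier G \<Longrightarrow> (s <# V) \<inter> K = {} \<or> (s <# V) \<inter> L = {}"
  shows "cover_num (K \<union> L) V = cover_num K V + cover_num L V"
proof (rule antisym[OF cover_num_Un[OF V K L]])
  obtain S where S: "covers S V (K \<union> L)" "card S = cover_num (K \<union> L) V"
    using cover_num_witness[OF V compactin_Un[OF K L]] by blast
  let ?A = "{s \<in> S. (s <# V) \<inter> K \<noteq> {}}" and ?B = "{s \<in> S. (s <# V) \<inter> L \<noteq> {}}"
  have fin: "finite S" using S by (simp add: covers_def)
  have "K \<subseteq> (\<Union>s\<in>?A. s <# V)" "L \<subseteq> (\<Union>s\<in>?B. s <# V)" using S(1) unfolding covers_def by blast+
  then have "covers ?A V K" "covers ?B V L" using S(1) unfolding covers_def by auto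
  then have "cover_num K V + cover_num L V \<le> card ?A + card ?B" by (intro add_mono cover_num_le)
  also have "\<dots> = card (?A \<union> ?B)"
    using fin S(1) sep by (intro card_Un_disjoint[symmetric]) (auto simp: covers_def)
  also have "\<dots> \<le> card S" using fin by (intro card_mono) auto
  finally show "cover_num K V + cover_num L V \<le> cover_num (K \<union> L) V" using S(2) by simp
qed

section \<open>Cluster points of covering ratios\<close>

text \<open>The limit of \<open>V\<close> shrinking to the identity. A filter is used instead of a
  sequence because the identity need not have a countable base of neighbourhoods.\<close>

definition small_nbhds :: "'a set filter" where
  "small_nbhds = (INF W\<in>nbhds_one. principal {V \<in> nbhds_one. V \<subseteq> W})"

lemma eventually_small_nbhds:
  "eventually P small_nbhds \<longleftrightarrow> (\<exists>W\<in>nbhds_one. \<forall>V\<in>nbhds_one. V \<subseteq> W \<longrightarrow> P V)"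
proof -
  have "\<exists>x\<in>nbhds_one. principal {V \<in> nbhds_one. V \<subseteq> x}
      \<le> inf (principal {V \<in> nbhds_one. V \<subseteq> a}) (principal {V \<in> nbhds_one. V \<subseteq> b})"
    if "a \<in> nbhds_one" "b \<in> nbhds_one" for a b
    by (rule bexI[of _ "a \<inter> b"]) (use that in \<open>auto simp: nbhds_one_def\<close>)
  moreover have "topspace T \<in> nbhds_one"
    using openin_topspace[of T] topspace by (simp add: nbhds_one_def del: openin_topspace)
  ultimately have "eventually P small_nbhds \<longleftrightarrow>
      (\<exists>W\<in>nbhds_one. eventually P (principal {V \<in> nbhds_one. V \<subseteq> W}))"
    unfolding small_nbhds_def by (intro eventually_INF_base) blast+
  then show ?thesis unfolding eventually_principal by blast
qed

end

text \<open>Passing to a finer filter turns a cluster point into a genuine limit, so that the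
  ordinary limit rules can transfer inequalities and identities to \<open>l\<close>.\<close>

lemma compact_cluster_filter:
  fixes f :: "'a \<Rightarrow> 'b :: topological_space"
  assumes S: "compact S" and F: "F \<noteq> bot" and ev: "eventually (\<lambda>x. f x \<in> S) F"
  obtains F' l where "F' \<noteq> bot" "F' \<le> F" "l \<in> S" "(f \<longlongrightarrow> l) F'"
proof -
  have "filtermap f F \<noteq> bot" using F by (simp add: filtermap_bot_iff)
  moreover have "eventually (\<lambda>x. x \<in> S) (filtermap f F)" using ev by (simp add: eventually_filtermap)
  ultimately obtain l where l: "l \<in> S" "inf (nhds l) (filtermap f F) \<noteq> bot"
    using S unfolding compact_filter by blast
  \<comment> \<open>The coarsest filter finer than \<open>F\<close> along which \<open>f\<close>
    converges to \<open>l\<close>. It is proper precisely because \<open>l\<close> is a cluster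
    point.\<close>
  let ?F = "inf F (filtercomap f (nhds l))"
  show ?thesis
  proof
    show "?F \<noteq> bot"
    proof
      assume "?F = bot"
      then have "eventually (\<lambda>x. False) ?F" by simp
      then obtain P Q where PQ: "eventually P F" "eventually Q (filtercomap f (nhds l))" "\<And>x. P x \<Longrightarrow> Q x \<Longrightarrow> False"
        unfolding eventually_inf by blast
      obtain R where R: "eventually R (nhds l)" "\<And>x. R (f x) \<Longrightarrow> Q x"
        using PQ(2) unfolding eventually_filtercomap by blast
      have "eventually (\<lambda>y. \<not> R y) (filtermap f F)"
        unfolding eventually_filtermap by (rule eventually_mono[OF PQ(1)]) (use PQ(3) R(2) in blast)
      then have "eventually (\<lambda>y. False) (inf (nhds l) (filtermap f F))"
        unfolding eventually_inf using R(1) by blast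
      then show False using l(2) trivial_limit_def by blast
    qed
    show "(f \<longlongrightarrow> l) ?F"
      unfolding filterlim_def by (rule order_trans[OF filtermap_mono[OF inf_le2] filtermap_filtercomap])
  qed (use l in auto)
qed

text \<open>Tychonoff's theorem for a box, read in the topology of the function type.\<close>

lemma compact_Pi_real:
  fixes b :: "'i \<Rightarrow> real"
  shows "compact {f. \<forall>i. 0 \<le> f i \<and> f i \<le> b i}"
proof -
  have "compactin (product_topology (\<lambda>i. euclidean) UNIV) (PiE UNIV (\<lambda>i. {0..b i}))"
    unfolding compactin_PiE by simp
  moreover have "PiE UNIV (\<lambda>i. {0..b i}) = {f. \<forall>i. 0 \<le> f i \<and> f i \<le> b i}" by (auto simp: PiE_def)
  ultimately show ?thesis by (simp add: euclidean_product_topology)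
qed

context lc_group
begin

lemma haar_content_exists:
  obtains H K0 where "compact_content T H" "compactin T K0" "H K0 = 1"
    "\<And>s K. s \<in> carrier G \<Longrightarrow> compactin T K \<Longrightarrow> H (s <# K) = H K"
proof -
  obtain V0 K0 where V0: "openin T V0" "compactin T K0" "\<one> \<in> V0" "V0 \<subseteq> K0" by (rule compact_nbhd_one)
  have V0n: "V0 \<in> nbhds_one" using V0 by (simp add: nbhds_one_def)
  have pos: "0 < cover_num K0 V" if "V \<in> nbhds_one" for V
    using cover_num_pos[OF that V0(2)] V0 by blast
  \<comment> \<open>The value 0 at sets that are not compact keeps \<open>h V\<close> inside the box
    for every argument, as the compactness argument needs total functions.\<close>
  define h where "h = (\<lambda>V K. if compactin T K then real (cover_num K V) / real (cover_num K0 V) else 0)"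
  define b where "b = (\<lambda>K. real (cover_num K V0))"
  have hb: "0 \<le> h V K \<and> h V K \<le> b K" if V: "V \<in> nbhds_one" for V K
  proof (cases "compactin T K")
    case True
    have "real (cover_num K V) \<le> real (cover_num K V0 * cover_num K0 V)"
      using cover_num_mult[OF V True V0(2) V0n V0(4)] of_nat_le_iff by blast
    then show ?thesis using pos[OF V] True by (simp add: h_def b_def field_simps)
  qed (simp add: h_def b_def)
  have evn: "eventually (\<lambda>V. V \<in> nbhds_one) small_nbhds"
    unfolding eventually_small_nbhds using V0n by blast
  have nb: "small_nbhds \<noteq> bot"
    unfolding trivial_limit_def eventually_small_nbhds by auto
  have evb: "eventually (\<lambda>V. h V \<in> {f. \<forall>i. 0 \<le> f i \<and> f i \<le> b i}) small_nbhds"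
    by (rule eventually_mono[OF evn]) (use hb in auto)
  obtain F' H where F': "F' \<noteq> bot" "F' \<le> small_nbhds" "(h \<longlongrightarrow> H) F'"
    and H: "H \<in> {f. \<forall>i. 0 \<le> f i \<and> f i \<le> b i}"
    by (rule compact_cluster_filter[OF compact_Pi_real nb evb])
  \<comment> \<open>Evaluation at \<open>K\<close> is continuous in the product topology, so the
    single limit \<open>H\<close> works for all compact sets simultaneously.\<close>
  have lim: "((\<lambda>V. h V K) \<longlongrightarrow> H K) F'" for K
    using F'(3) by (rule continuous_on_tendsto_compose[OF continuous_on_product_coordinates]) auto
  have ev: "eventually (\<lambda>V. V \<in> nbhds_one) F'" using evn F'(2) filter_leD by blast
  have eq: "H K = H L" if "\<And>V. V \<in> nbhds_one \<Longrightarrow> h V K = h V L" for K L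
  proof -
    have "((\<lambda>V. h V K) \<longlongrightarrow> H L) F'"
      by (rule Lim_transform_eventually[OF lim[of L]]) (use that in \<open>auto intro: eventually_mono[OF ev]\<close>)
    then show ?thesis using tendsto_unique[OF F'(1) lim] by blast
  qed
  show ?thesis
  proof
    show "compactin T K0" by fact
    have "((\<lambda>V. h V K0) \<longlongrightarrow> 1) F'"
    proof (rule tendsto_eventually)
      show "\<forall>\<^sub>F V in F'. h V K0 = 1"
        by (rule eventually_mono[OF ev]) (use pos V0(2) in \<open>auto simp: h_def\<close>)
    qed
    then show "H K0 = 1" using tendsto_unique[OF F'(1) lim] by blast
    show "H (s <# K) = H K" if "s \<in> carrier G" "compactin T K" for s K
      by (rule eq) (use that cover_num_l_coset compact_l_coset in \<open>simp add: h_def\<close>)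
    show "compact_content T H"
    proof unfold_locales
      show "0 \<le> H K" if "compactin T K" for K using H by simp
      fix K L assume K: "compactin T K" and L: "compactin T L"
      show "H K \<le> H L" if "K \<subseteq> L"
      proof (rule tendsto_le[OF F'(1) lim lim])
        show "\<forall>\<^sub>F V in F'. h V K \<le> h V L"
          by (rule eventually_mono[OF ev])
            (use cover_num_mono[OF _ L that] pos K L in \<open>simp add: h_def divide_right_mono\<close>)
      qed
      have KL: "compactin T (K \<union> L)" using K L by (rule compactin_Un)
      show "H (K \<union> L) \<le> H K + H L"
      proof (rule tendsto_le[OF F'(1) tendsto_add[OF lim lim] lim])
        show "\<forall>\<^sub>F V in F'. h V (K \<union> L) \<le> h V K + h V L"
        proof (rule eventually_mono[OF ev])
          fix V assume "V \<in> nbhds_one"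
          then have "real (cover_num (K \<union> L) V) \<le> real (cover_num K V) + real (cover_num L V)"
            using cover_num_Un[OF _ K L] by (metis of_nat_add of_nat_le_iff)
          then show "h V (K \<union> L) \<le> h V K + h V L"
            using K L KL by (simp add: h_def divide_right_mono flip: add_divide_distrib)
        qed
      qed
      show "H (K \<union> L) = H K + H L" if disj: "K \<inter> L = {}"
      proof -
        obtain W where W: "W \<in> nbhds_one"
          "\<And>s. s \<in> carrier G \<Longrightarrow> (s <# W) \<inter> K = {} \<or> (s <# W) \<inter> L = {}"
          using nbhd_separating[OF K L disj] by blast
        \<comment> \<open>Before the limit, additivity is obtained only for \<open>V\<close> inside
          the separating neighbourhood. The filter eventually stays there, but how small
          \<open>V\<close> must be depends on \<open>K\<close> and \<open>L\<close>.\<close>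
        have "h V (K \<union> L) = h V K + h V L" if V: "V \<in> nbhds_one" "V \<subseteq> W" for V
        proof -
          have "(s <# V) \<inter> K = {} \<or> (s <# V) \<inter> L = {}" if "s \<in> carrier G" for s
            using W(2)[OF that] V(2) unfolding l_coset_image by blast
          then show ?thesis
            using cover_num_disjoint[OF V(1) K L] K L KL by (simp add: h_def add_divide_distrib)
        qed
        then have "eventually (\<lambda>V. h V (K \<union> L) = h V K + h V L) small_nbhds"
          unfolding eventually_small_nbhds using W(1) by blast
        then have "eventually (\<lambda>V. h V (K \<union> L) = h V K + h V L) F'"
          by (rule filter_leD[OF F'(2)])
        then have "eventually (\<lambda>V. h V K + h V L = h V (K \<union> L)) F'"
          by (rule eventually_mono) simp
        then have "((\<lambda>V. h V (K \<union> L)) \<longlongrightarrow> H K + H L) F'"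
          by (rule Lim_transform_eventually[OF tendsto_add[OF lim lim]])
        then show ?thesis using tendsto_unique[OF F'(1) lim] by blast
      qed
    qed
  qed
qed

theorem haar_measure_exists:
  obtains \<mu> where "left_haar_measure G T \<mu>"
proof -
  obtain H K0 where H: "compact_content T H" "compactin T K0" "H K0 = 1"
    "\<And>s K. s \<in> carrier G \<Longrightarrow> compactin T K \<Longrightarrow> H (s <# K) = H K"
    using haar_content_exists by blast
  interpret C: compact_content T H by (rule H(1))
  note r = C.radon_content_measure
  have "1 \<le> emeasure C.content_measure (topspace T)"
    using C.inner_content_upper[OF H(2) compactin_subset_topspace[OF H(2)]] H(3)
    by (simp add: C.content_measure_open)
  \<comment> \<open>An inequality valid for every \<open>s\<close> and every set suffices: applied
    to \<open>inv s\<close> and the translated set it gives the reverse one. The same device is used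
    for \<open>out_le\<close>.\<close>
  moreover have le: "C.inner_content U \<le> C.inner_content (s <# U)"
    if "s \<in> carrier G" for s U
  proof (rule C.inner_content_least)
    fix K assume K: "compactin T K" "K \<subseteq> U"
    have "ennreal (H (s <# K)) \<le> C.inner_content (s <# U)"
      using K by (intro C.inner_content_upper compact_l_coset[OF that]) (auto simp: l_coset_image)
    then show "ennreal (H K) \<le> C.inner_content (s <# U)" using H(4)[OF that K(1)] by simp
  qed
  have out_le: "C.outer_content (s <# E) \<le> C.outer_content E" if s: "s \<in> carrier G" for s E
  proof (rule C.outer_content_greatest)
    fix U assume U: "openin T U" "E \<subseteq> U"
    then have UG: "U \<subseteq> carrier G" using openin_subset topspace by blast
    have "C.outer_content (s <# E) \<le> C.inner_content (s <# U)"
      using U by (intro C.outer_content_lower open_l_coset[OF s]) (auto simp: l_coset_image)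
    also have "\<dots> \<le> C.inner_content U"
      using le[of "inv s" "s <# U"] s l_coset_inv[OF s UG] by simp
    finally show "C.outer_content (s <# E) \<le> C.inner_content U" .
  qed
  have "emeasure C.content_measure (s <# E) = emeasure C.content_measure E"
    if s: "s \<in> carrier G" and E: "E \<in> sets C.content_measure" for s E
  proof -
    have EG: "E \<subseteq> carrier G" using sets.sets_into_space[OF E] radon_space[OF r] topspace by simp
    have m: "(\<lambda>x. inv s \<otimes> x) \<in> measurable C.content_measure C.content_measure"
      using s by (intro measurable_continuous_map[OF r radon_sets_eq[OF r]]
          homeomorphic_imp_continuous_map homeomorphic_left) simp
    have "s <# E = (\<lambda>x. inv s \<otimes> x) -` E \<inter> space C.content_measure"
      using l_coset_vimage[OF s EG] radon_space[OF r] topspace by auto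
    then have "s <# E \<in> sets C.content_measure" using measurable_sets[OF m E] by simp
    moreover have "C.outer_content (s <# E) = C.outer_content E"
      using out_le[OF s, of E] out_le[of "inv s" "s <# E"] s l_coset_inv[OF s EG] by (simp add: antisym)
    ultimately show ?thesis using E by (simp add: C.emeasure_content_measure)
  qed
  ultimately have "left_haar_measure G T C.content_measure"
    unfolding left_haar_measure_iff radon_space[OF r] using r by force
  then show ?thesis by (rule that)
qed

end

section \<open>The modular function\<close>

lemma ennreal_scale_cancel:
  assumes "0 < m" "m < (\<infinity>::ennreal)" "0 < c" "0 < d" "ennreal c * m = ennreal d * m"
  shows "c = d"
proof (cases m rule: ennreal_cases)
  case (real r)
  then have "0 < r" using assms(1) by simp
  have "ennreal (c * r) = ennreal (d * r)" using assms real by (simp add: ennreal_mult)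
  then show ?thesis using \<open>0 < r\<close> assms by simp
qed (use assms in simp)

context lc_group
begin

lemma haar_unique_pos:
  assumes \<mu>: "left_haar_measure G T \<mu>" and J: "invariant_functional J"
    and f: "f \<in> Cc_plus T" "0 < J f"
  obtains c where "0 < c" "\<And>f. f \<in> Cc_plus T \<Longrightarrow> J f = c * (\<integral>x. f x \<partial>\<mu>)"
proof -
  obtain c where c: "0 \<le> c" "\<And>f. f \<in> Cc_plus T \<Longrightarrow> J f = c * (\<integral>x. f x \<partial>\<mu>)"
    using haar_unique[OF \<mu> J] by blast
  have "c \<noteq> 0" using c(2)[OF f(1)] f(2) by auto
  then have "0 < c" using c(1) by simp
  then show ?thesis using that c(2) by blast
qed

lemma bump:
  obtains f where "f \<in> Cc_plus T" "f \<one> = 1"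
  using small_bump[OF openin_topspace] topspace one_closed by metis

text \<open>The map \<open>h x = x s\<inverse>\<close> gives the modular function at \<open>s\<close>. On a normal subgroup, \<open>h x = s\<inverse> x s\<close> gives
  the constant \<open>\<phi>(s)\<close> of the statement.\<close>

definition haar_scaling :: "('a \<Rightarrow> 'a) \<Rightarrow> real \<Rightarrow> bool" where
  "haar_scaling h c \<longleftrightarrow> (\<forall>\<mu>. left_haar_measure G T \<mu> \<longrightarrow>
     (\<forall>f\<in>Cc_plus T. (\<integral>x. f (h x) \<partial>\<mu>) = c * (\<integral>x. f x \<partial>\<mu>)) \<and>
     (\<forall>E\<in>sets \<mu>. emeasure \<mu> {x \<in> carrier G. h x \<in> E} = ennreal c * emeasure \<mu> E))"

lemma haar_scaling_integral:
  "haar_scaling h c \<Longrightarrow> left_haar_measure G T \<mu> \<Longrightarrow> f \<in> Cc_plus T \<Longrightarrow>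
    (\<integral>x. f (h x) \<partial>\<mu>) = c * (\<integral>x. f x \<partial>\<mu>)"
  unfolding haar_scaling_def by blast

lemma haar_scaling_emeasure:
  "haar_scaling h c \<Longrightarrow> left_haar_measure G T \<mu> \<Longrightarrow> E \<in> sets \<mu> \<Longrightarrow>
    emeasure \<mu> {x \<in> carrier G. h x \<in> E} = ennreal c * emeasure \<mu> E"
  unfolding haar_scaling_def by blast

text \<open>The hypothesis \<open>equiv\<close> says that \<open>h\<close> intertwines left
  translations. Hence integrating \<open>f (h x)\<close> is again left invariant and uniqueness
  yields the factor.\<close>

lemma haar_scaling_exists:
  assumes h: "homeomorphic_map T T h"
    and equiv: "\<And>s. s \<in> carrier G \<Longrightarrow> \<exists>t\<in>carrier G. \<forall>x\<in>carrier G. s \<otimes> h x = h (t \<otimes> x)"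
  obtains c where "0 < c" "haar_scaling h c"
proof -
  obtain \<mu> where \<mu>: "left_haar_measure G T \<mu>" using haar_measure_exists by blast
  have inv: "invariant_functional (\<lambda>f. \<integral>x. f (h x) \<partial>\<nu>)" if \<nu>: "left_haar_measure G T \<nu>" for \<nu>
  proof -
    note r = haar_radon[OF \<nu>]
    have space: "space \<nu> = carrier G" using radon_space[OF r] topspace by simp
    have Cc: "(\<lambda>x. f (h x)) \<in> Cc_plus T" if "f \<in> Cc_plus T" for f by (rule Cc_plus_compose[OF that h])
    note int = Cc_plus_integrable[OF r Cc]
    have hG: "h x \<in> carrier G" if "x \<in> carrier G" for x
      using homeomorphic_imp_continuous_map[OF h] that topspace by (auto simp: continuous_map_def)
    show ?thesis
      unfolding invariant_functional_def
    proof (intro conjI ballI allI impI)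
      show "(\<integral>x. f (h x) \<partial>\<nu>) \<le> (\<integral>x. g (h x) \<partial>\<nu>)"
        if "f \<in> Cc_plus T" "g \<in> Cc_plus T" "\<forall>x\<in>carrier G. f x \<le> g x" for f g
        using that int space hG by (intro integral_mono) auto
      show "(\<integral>x. f (s \<otimes> h x) \<partial>\<nu>) = (\<integral>x. f (h x) \<partial>\<nu>)" if f: "f \<in> Cc_plus T" and s: "s \<in> carrier G" for f s
      proof -
        obtain t where t: "t \<in> carrier G" "\<forall>x\<in>carrier G. s \<otimes> h x = h (t \<otimes> x)" using equiv[OF s] by blast
        have "(\<integral>x. f (s \<otimes> h x) \<partial>\<nu>) = (\<integral>x. (\<lambda>x. f (h x)) (t \<otimes> x) \<partial>\<nu>)"
          by (rule Bochner_Integration.integral_cong) (use t space in auto)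
        also have "\<dots> = (\<integral>x. f (h x) \<partial>\<nu>)"
          by (rule haar_integral_left[OF \<nu> t(1) borel_measurable_integrable[OF int[OF f]]])
        finally show ?thesis .
      qed
    qed (use int in auto)
  qed
  obtain f where f: "f \<in> Cc_plus T" "f \<one> = 1" using bump by blast
  \<comment> \<open>A bump at the identity, pulled back along \<open>h\<close>, is nonzero at this
    \<open>x\<close>. So the new functional does not vanish and the factor is positive.\<close>
  obtain x where x: "x \<in> carrier G" "h x = \<one>"
    using homeomorphic_imp_surjective_map[OF h] topspace one_closed by (metis imageE)
  have "0 < (\<integral>x. f (h x) \<partial>\<mu>)"
    by (rule haar_integral_pos[OF \<mu> Cc_plus_compose[OF f(1) h] x(1)]) (simp add: x f)
  then obtain c where c: "0 < c" "\<And>f. f \<in> Cc_plus T \<Longrightarrow> (\<integral>x. f (h x) \<partial>\<mu>) = c * (\<integral>x. f x \<partial>\<mu>)"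
    using haar_unique_pos[OF \<mu> inv[OF \<mu>] f(1)] by blast
  have "haar_scaling h c"
    unfolding haar_scaling_def
  proof (intro allI impI conjI)
    fix \<nu> assume \<nu>: "left_haar_measure G T \<nu>"
    note r = haar_radon[OF \<nu>]
    \<comment> \<open>The factor was found for one measure only. Any other Haar integral is a
      multiple of it, and \<open>d\<close> multiplies both sides of the scaling identity.\<close>
    obtain d where d: "\<And>f. f \<in> Cc_plus T \<Longrightarrow> (\<integral>x. f x \<partial>\<nu>) = d * (\<integral>x. f x \<partial>\<mu>)"
      using haar_unique[OF \<mu> haar_functional[OF \<nu>]] by blast
    have eq: "(\<integral>x. f (h x) \<partial>\<nu>) = c * (\<integral>x. f x \<partial>\<nu>)" if "f \<in> Cc_plus T" for f
      using d[OF that] d[OF Cc_plus_compose[OF that h]] c(2)[OF that] by simp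
    then show "\<forall>f\<in>Cc_plus T. (\<integral>x. f (h x) \<partial>\<nu>) = c * (\<integral>x. f x \<partial>\<nu>)" by blast
    have hm: "h \<in> measurable \<nu> \<nu>"
      by (rule measurable_continuous_map[OF r radon_sets_eq[OF r] homeomorphic_imp_continuous_map[OF h]])
    have "(\<integral>x. f x \<partial>(distr \<nu> \<nu> h)) = c * (\<integral>x. f x \<partial>\<nu>)" if f: "f \<in> Cc_plus T" for f
      using integral_distr[OF hm borel_measurable_integrable[OF Cc_plus_integrable[OF r f]]] eq[OF f] by simp
    then have "emeasure (distr \<nu> \<nu> h) E = ennreal c * emeasure \<nu> E" if "E \<in> sets \<nu>" for E
      by (rule radon_eq_scaled[OF r radon_distr[OF r h] c(1) _ that])
    then show "\<forall>E\<in>sets \<nu>. emeasure \<nu> {x \<in> carrier G. h x \<in> E} = ennreal c * emeasure \<nu> E"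
      using emeasure_distr_homeomorphic[OF r h] topspace by simp
  qed
  then show ?thesis using that c(1) by blast
qed

text \<open>Cancelling the measure of such a set is what makes the constants under
  \<open>THE\<close> unique, here and for conjugation on a normal subgroup.\<close>

lemma finite_positive_set:
  assumes \<mu>: "left_haar_measure G T \<mu>"
  obtains E where "E \<in> sets \<mu>" "0 < emeasure \<mu> E" "emeasure \<mu> E < \<infinity>"
proof -
  note r = haar_radon[OF \<mu>]
  obtain V K where V: "openin T V" "compactin T K" "\<one> \<in> V" "V \<subseteq> K" by (rule compact_nbhd_one)
  have K: "K \<in> sets \<mu>" using radon_closed[OF r compact_closed[OF V(2)]] .
  have "emeasure \<mu> V \<noteq> 0" using haar_open_pos[OF \<mu> V(1)] V(3) by blast
  then have "0 < emeasure \<mu> K" using emeasure_mono[OF V(4) K] by (metis not_gr_zero le_zero_eq)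
  then show ?thesis using that K radon_compact_finite[OF r V(2)] by blast
qed

lemma r_coset_scaling:
  assumes s: "s \<in> carrier G" and E: "E \<subseteq> carrier G"
  shows "{x \<in> carrier G. x \<otimes> inv s \<in> E} = E #> s"
  using r_coset_vimage[OF s E] by simp

lemma modular_function:
  assumes s: "s \<in> carrier G"
  shows "0 < modular_function G T s" and "haar_scaling (\<lambda>x. x \<otimes> inv s) (modular_function G T s)"
proof -
  obtain c where c: "0 < c" "haar_scaling (\<lambda>x. x \<otimes> inv s) c"
    by (rule haar_scaling_exists[OF homeomorphic_right[of "inv s"]]) (use s in \<open>auto simp: m_assoc\<close>)
  obtain \<mu> where \<mu>: "left_haar_measure G T \<mu>" using haar_measure_exists by blast
  obtain E where E: "E \<in> sets \<mu>" "0 < emeasure \<mu> E" "emeasure \<mu> E < \<infinity>" by (rule finite_positive_set[OF \<mu>])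
  have cE: "emeasure \<nu> (E #> s) = ennreal c * emeasure \<nu> E" if "left_haar_measure G T \<nu>" "E \<in> sets \<nu>" for \<nu> E
  proof -
    have "E \<subseteq> carrier G"
      using sets.sets_into_space[OF that(2)] radon_space[OF haar_radon[OF that(1)]] topspace by simp
    then show ?thesis using haar_scaling_emeasure[OF c(2) that] r_coset_scaling[OF s] by simp
  qed
  have "modular_function G T s = c"
    unfolding modular_function_def
  proof (rule the_equality)
    show "0 < c \<and> (\<forall>\<mu>. left_haar_measure G T \<mu> \<longrightarrow> (\<forall>E\<in>sets \<mu>. emeasure \<mu> (E #> s) = ennreal c * emeasure \<mu> E))"
      using c(1) cE by blast
    fix d assume d: "0 < d \<and> (\<forall>\<mu>. left_haar_measure G T \<mu> \<longrightarrow> (\<forall>E\<in>sets \<mu>. emeasure \<mu> (E #> s) = ennreal d * emeasure \<mu> E))"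
    then have "ennreal d * emeasure \<mu> E = ennreal c * emeasure \<mu> E" using \<mu> E(1) cE[OF \<mu> E(1)] by metis
    then show "d = c" using ennreal_scale_cancel[OF E(2,3)] c(1) d by blast
  qed
  then show "0 < modular_function G T s" "haar_scaling (\<lambda>x. x \<otimes> inv s) (modular_function G T s)"
    using c by auto
qed

lemma modular_function_integral:
  assumes "s \<in> carrier G" "left_haar_measure G T \<mu>" "f \<in> Cc_plus T"
  shows "(\<integral>x. f (x \<otimes> inv s) \<partial>\<mu>) = modular_function G T s * (\<integral>x. f x \<partial>\<mu>)"
  by (rule haar_scaling_integral[OF modular_function(2)[OF assms(1)] assms(2,3)])

lemma modular_function_mult:
  assumes s: "s \<in> carrier G" and t: "t \<in> carrier G"
  shows "modular_function G T (s \<otimes> t) = modular_function G T s * modular_function G T t"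
proof -
  obtain \<mu> where \<mu>: "left_haar_measure G T \<mu>" using haar_measure_exists by blast
  obtain f where f: "f \<in> Cc_plus T" "f \<one> = 1" using bump by blast
  have pos: "0 < (\<integral>x. f x \<partial>\<mu>)" by (rule haar_integral_pos[OF \<mu> f(1) one_closed]) (simp add: f)
  have space: "space \<mu> = carrier G" using radon_space[OF haar_radon[OF \<mu>]] topspace by simp
  have fs: "(\<lambda>x. f (x \<otimes> inv s)) \<in> Cc_plus T"
    by (rule Cc_plus_compose[OF f(1) homeomorphic_right]) (use s in simp)
  have "modular_function G T (s \<otimes> t) * (\<integral>x. f x \<partial>\<mu>) = (\<integral>x. f (x \<otimes> inv (s \<otimes> t)) \<partial>\<mu>)"
    using modular_function_integral[OF _ \<mu> f(1)] s t by simp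
  also have "\<dots> = (\<integral>x. f ((x \<otimes> inv t) \<otimes> inv s) \<partial>\<mu>)"
    by (rule Bochner_Integration.integral_cong) (use s t space in \<open>auto simp: inv_mult_group m_assoc\<close>)
  also have "\<dots> = modular_function G T t * (modular_function G T s * (\<integral>x. f x \<partial>\<mu>))"
    using modular_function_integral[OF t \<mu> fs] modular_function_integral[OF s \<mu> f(1)] by simp
  finally show ?thesis using pos by simp
qed

text \<open>A point \<open>s\<close> of the kernel has the translate \<open>s <# U\<close> as a
  neighbourhood inside it. The function is arbitrary so that it can also be a modular function
  composed with the projection to the quotient.\<close>

lemma multiplicative_kernel_open:
  fixes \<psi> :: "'a \<Rightarrow> real"
  assumes mult: "\<And>s t. s \<in> carrier G \<Longrightarrow> t \<in> carrier G \<Longrightarrow> \<psi> (s \<otimes> t) = \<psi> s * \<psi> t"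
    and U: "openin T U" "\<one> \<in> U" "\<And>u. u \<in> U \<Longrightarrow> \<psi> u = 1"
  shows "openin T {s \<in> carrier G. \<psi> s = 1}"
proof (subst openin_subopen, intro ballI)
  fix s assume "s \<in> {s \<in> carrier G. \<psi> s = 1}"
  then have s: "s \<in> carrier G" "\<psi> s = 1" by auto
  have UG: "U \<subseteq> carrier G" using U(1) openin_subset topspace by blast
  have "s \<otimes> \<one> \<in> s <# U" using U(2) unfolding l_coset_image by blast
  then have "s \<in> s <# U" using s by simp
  moreover have "s <# U \<subseteq> {s \<in> carrier G. \<psi> s = 1}"
    using s UG U(3) mult unfolding l_coset_image by (auto simp: subset_iff)
  ultimately show "\<exists>V. openin T V \<and> s \<in> V \<and> V \<subseteq> {s \<in> carrier G. \<psi> s = 1}"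
    using open_l_coset[OF s(1) U(1)] by blast
qed

end

section \<open>Closed normal subgroups and quotients\<close>

locale closed_normal = lc_group G T + normal N G for G (structure) and T N +
  assumes closed: "closedin T N"
begin

abbreviation Q where "Q \<equiv> G Mod N"
abbreviation TQ where "TQ \<equiv> quotient_topology G T N"
abbreviation S where "S \<equiv> G\<lparr>carrier := N\<rparr>"
abbreviation TS where "TS \<equiv> subtopology T N"

lemma topspace_sub: "topspace TS = N"
  using subset topspace by auto

lemma lc_group_sub: "lc_group S TS"
proof -
  have "group S" by (rule subgroup_is_group[OF is_group])
  moreover have "locally_compact_space TS" by (rule locally_compact_space_closed_subset[OF locally_compact closed])
  moreover have "Hausdorff_space TS" by (rule Hausdorff_space_subtopology[OF Hausdorff])
  moreover have "continuous_map (prod_topology TS TS) TS (\<lambda>(x, y). x \<otimes>\<^bsub>S\<^esub> y)"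
  proof -
    have "continuous_map (subtopology (prod_topology T T) (N \<times> N)) T (\<lambda>(x, y). x \<otimes> y)"
      by (rule continuous_map_from_subtopology[OF mult_continuous])
    then show ?thesis
      unfolding continuous_map_in_subtopology subtopology_Times[symmetric] by auto
  qed
  moreover have "continuous_map TS TS (\<lambda>x. inv\<^bsub>S\<^esub> x)"
  proof -
    have "continuous_map TS TS (\<lambda>x. inv x)"
      unfolding continuous_map_in_subtopology
      using continuous_map_from_subtopology[OF inv_continuous] by auto
    then show ?thesis
      by (rule continuous_map_eq) (use is_subgroup in \<open>auto simp: topspace_sub\<close>)
  qed
  moreover have "topspace TS = carrier S" unfolding topspace_sub by simp
  ultimately show ?thesis
    unfolding lc_group_def lc_group_axioms_def lc_space_def by blast
qed

lemma coset_eq_iff: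
  assumes "x \<in> carrier G" "y \<in> carrier G"
  shows "N #> x = N #> y \<longleftrightarrow> y \<otimes> inv x \<in> N"
proof
  assume "N #> x = N #> y"
  then have "y \<in> N #> x" using assms is_subgroup rcos_self by metis
  then obtain n where "n \<in> N" "y = n \<otimes> x" unfolding r_coset_image by blast
  then show "y \<otimes> inv x \<in> N" using assms(1) subset by (simp add: m_assoc subset_iff)
next
  assume "y \<otimes> inv x \<in> N"
  moreover have "y = (y \<otimes> inv x) \<otimes> x" using assms by (simp add: m_assoc)
  ultimately have "y \<in> N #> x" unfolding r_coset_image by blast
  then show "N #> x = N #> y" using assms(1) is_subgroup by (rule repr_independence)
qed

lemma coset_in: "x \<in> carrier G \<Longrightarrow> N #> x \<in> carrier Q"
  by (auto simp: FactGroup_def RCOSETS_def)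

lemma cosetE:
  assumes "X \<in> carrier Q"
  obtains x where "x \<in> carrier G" "X = N #> x"
  using assms by (auto simp: FactGroup_def RCOSETS_def)

lemma coset_mult: "x \<in> carrier G \<Longrightarrow> y \<in> carrier G \<Longrightarrow> (N #> x) \<otimes>\<^bsub>Q\<^esub> (N #> y) = N #> (x \<otimes> y)"
  by (simp add: FactGroup_def rcos_sum)

lemma coset_inv: "x \<in> carrier G \<Longrightarrow> inv\<^bsub>Q\<^esub> (N #> x) = N #> inv x"
  by (simp add: inv_FactGroup[OF coset_in] rcos_inv)

lemma quotient_map_coset: "quotient_map T TQ (\<lambda>x. N #> x)"
  by (rule quotient_map_quotient_topology[OF topspace])

lemma continuous_coset: "continuous_map T TQ (\<lambda>x. N #> x)"
  by (rule quotient_imp_continuous_map[OF quotient_map_coset])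

lemma topspace_quotient: "topspace TQ = carrier Q"
proof -
  have "(\<lambda>x. N #> x) ` carrier G = topspace TQ"
    using quotient_imp_surjective_map[OF quotient_map_coset] topspace by simp
  then show ?thesis by (auto simp: FactGroup_def RCOSETS_def)
qed

text \<open>The saturation of \<open>U\<close> is a union of translates of \<open>U\<close> by
  elements of \<open>N\<close>. Openness of the projection, not only continuity, drives the proofs
  for the quotient group.\<close>

lemma open_coset_image:
  assumes U: "openin T U"
  shows "openin TQ ((\<lambda>x. N #> x) ` U)"
proof -
  have UG: "U \<subseteq> carrier G" using U openin_subset topspace by blast
  have "{x \<in> carrier G. N #> x \<in> (\<lambda>x. N #> x) ` U} = (\<Union>n\<in>N. n <# U)"
  proof (intro equalityI subsetI)
    fix x assume "x \<in> {x \<in> carrier G. N #> x \<in> (\<lambda>x. N #> x) ` U}"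
    then obtain u where x: "x \<in> carrier G" and u: "u \<in> U" "N #> u = N #> x" by auto
    then have "x \<otimes> inv u \<in> N" using coset_eq_iff UG by blast
    moreover have "x = (x \<otimes> inv u) \<otimes> u" using x u(1) UG by (simp add: m_assoc subset_iff)
    ultimately show "x \<in> (\<Union>n\<in>N. n <# U)" using u(1) unfolding l_coset_image by blast
  next
    fix x assume "x \<in> (\<Union>n\<in>N. n <# U)"
    then obtain n u where nu: "n \<in> N" "u \<in> U" "x = n \<otimes> u" unfolding l_coset_image by blast
    then have G: "n \<in> carrier G" "u \<in> carrier G" using UG subset by auto
    then have "x \<otimes> inv u = n" using nu by (simp add: m_assoc)
    then have "N #> u = N #> x" using coset_eq_iff[of u x] G nu by simp
    then have "N #> x \<in> (\<lambda>x. N #> x) ` U" using nu(2) by (metis imageI)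
    then show "x \<in> {x \<in> carrier G. N #> x \<in> (\<lambda>x. N #> x) ` U}" using nu(3) G by simp
  qed
  moreover have "openin T (\<Union>n\<in>N. n <# U)"
    using open_l_coset[OF _ U] subset by (intro openin_Union) auto
  moreover have "(\<lambda>x. N #> x) ` U \<subseteq> rcosets N" using UG by (auto simp: RCOSETS_def)
  ultimately show ?thesis by (simp add: openin_quotient_topology[OF topspace])
qed

text \<open>Local compactness passes through the open projection, and closedness of \<open>N\<close>
  gives the Hausdorff property. Inversion descends because the projection is a quotient map;
  multiplication needs more care.\<close>

lemma lc_group_quotient: "lc_group Q TQ"
proof -
  have "group Q" by (rule factorgroup_is_group)
  moreover have "locally_compact_space TQ"
    by (rule locally_compact_space_continuous_open_map_image[OF continuous_coset _ _ locally_compact])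
      (use open_coset_image quotient_imp_surjective_map[OF quotient_map_coset] in \<open>auto simp: open_map_def\<close>)
  moreover have "Hausdorff_space TQ"
    unfolding Hausdorff_space_def
  proof (intro allI impI)
    fix X Y assume XY: "X \<in> topspace TQ \<and> Y \<in> topspace TQ \<and> X \<noteq> Y"
    obtain x where x: "x \<in> carrier G" "X = N #> x" using XY topspace_quotient cosetE by metis
    obtain y where y: "y \<in> carrier G" "Y = N #> y" using XY topspace_quotient cosetE by metis
    have ne: "y \<otimes> inv x \<notin> N" using XY x y coset_eq_iff by blast
    \<comment> \<open>The pairs of points with distinct cosets. This set is open since
      \<open>N\<close> is closed, and the images of an open box inside it separate the two
      cosets.\<close>
    define P where "P = {p \<in> topspace (prod_topology T T). snd p \<otimes> inv (fst p) \<in> topspace T - N}"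
    have "openin (prod_topology T T) P"
      unfolding P_def using closed
      by (intro openin_continuous_map_preimage[OF continuous_mult[OF continuous_map_snd continuous_inv[OF continuous_map_fst]]]) auto
    moreover have "(x, y) \<in> P" using x y ne by (simp add: P_def topspace)
    ultimately obtain U V where UV: "openin T U" "openin T V" "x \<in> U" "y \<in> V" "U \<times> V \<subseteq> P"
      using openin_prod_topology_alt[of T T P] by metis
    have "disjnt ((\<lambda>x. N #> x) ` U) ((\<lambda>x. N #> x) ` V)"
      unfolding disjnt_iff
    proof (intro allI notI, elim conjE imageE)
      fix Z u v assume uv: "u \<in> U" "v \<in> V" "Z = N #> u" "Z = N #> v"
      have "(u, v) \<in> P" using uv UV by blast
      then have "v \<otimes> inv u \<notin> N" "u \<in> carrier G" "v \<in> carrier G" by (auto simp: P_def topspace)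
      then show False using coset_eq_iff uv by metis
    qed
    then show "\<exists>U V. openin TQ U \<and> openin TQ V \<and> X \<in> U \<and> Y \<in> V \<and> disjnt U V"
      using open_coset_image UV x y by (metis imageI)
  qed
  \<comment> \<open>A product of two quotient maps need not be a quotient map, so continuity is
    checked by hand: an open box in \<open>G\<close> is projected to an open box in the
    quotient.\<close>
  moreover have "continuous_map (prod_topology TQ TQ) TQ (\<lambda>(X, Y). X \<otimes>\<^bsub>Q\<^esub> Y)"
    unfolding continuous_map_def
  proof (intro conjI allI impI)
    show "(\<lambda>(X, Y). X \<otimes>\<^bsub>Q\<^esub> Y) \<in> topspace (prod_topology TQ TQ) \<rightarrow> topspace TQ"
      using monoid.m_closed[OF group.is_monoid[OF \<open>group Q\<close>]] by (auto simp: topspace_quotient)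
    fix W assume W: "openin TQ W"
    let ?P = "{p \<in> topspace (prod_topology TQ TQ). (case p of (X, Y) \<Rightarrow> X \<otimes>\<^bsub>Q\<^esub> Y) \<in> W}"
    define R where "R = {p \<in> topspace (prod_topology T T). N #> (fst p \<otimes> snd p) \<in> W}"
    have R: "openin (prod_topology T T) R"
      unfolding R_def using continuous_map_compose[OF continuous_mult[OF continuous_map_fst continuous_map_snd] continuous_coset]
      by (intro openin_continuous_map_preimage[OF _ W]) (simp add: o_def)
    show "openin (prod_topology TQ TQ) ?P"
      unfolding openin_prod_topology_alt
    proof (intro allI impI)
      fix X Y assume XY: "(X, Y) \<in> ?P"
      then have "X \<in> carrier Q" "Y \<in> carrier Q" by (auto simp: topspace_quotient)
      then obtain x y where x: "x \<in> carrier G" "X = N #> x" and y: "y \<in> carrier G" "Y = N #> y"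
        using cosetE by metis
      have "(x, y) \<in> R" using XY x y coset_mult by (simp add: R_def topspace)
      then obtain U V where UV: "openin T U" "openin T V" "x \<in> U" "y \<in> V" "U \<times> V \<subseteq> R"
        using R openin_prod_topology_alt[of T T R] by metis
      have UG: "U \<subseteq> carrier G" "V \<subseteq> carrier G" using UV openin_subset topspace by blast+
      have sub: "((\<lambda>x. N #> x) ` U) \<times> ((\<lambda>x. N #> x) ` V) \<subseteq> ?P"
      proof clarify
        fix u v assume uv: "u \<in> U" "v \<in> V"
        then have "(u, v) \<in> R" using UV(5) by blast
        then have "N #> (u \<otimes> v) \<in> W" by (simp add: R_def)
        moreover have "u \<in> carrier G" "v \<in> carrier G" using uv UG by auto
        ultimately show "(N #> u, N #> v) \<in> topspace (prod_topology TQ TQ) \<and> (N #> u) \<otimes>\<^bsub>Q\<^esub> (N #> v) \<in> W"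
          using coset_mult coset_in by (simp add: topspace_quotient)
      qed
      show "\<exists>U V. openin TQ U \<and> openin TQ V \<and> X \<in> U \<and> Y \<in> V \<and> U \<times> V \<subseteq> ?P"
      proof (rule exI[of _ "(\<lambda>x. N #> x) ` U"], rule exI[of _ "(\<lambda>x. N #> x) ` V"], intro conjI)
        show "((\<lambda>x. N #> x) ` U) \<times> ((\<lambda>x. N #> x) ` V) \<subseteq> ?P" by (rule sub)
      qed (use open_coset_image UV x y in auto)
    qed
  qed
  moreover have "continuous_map TQ TQ (\<lambda>X. inv\<^bsub>Q\<^esub> X)"
  proof (rule continuous_compose_quotient_map[OF quotient_map_coset])
    have "continuous_map T TQ (\<lambda>x. N #> inv x)"
      using continuous_map_compose[OF inv_continuous continuous_coset] by (simp add: o_def)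
    then show "continuous_map T TQ ((\<lambda>X. inv\<^bsub>Q\<^esub> X) \<circ> (\<lambda>x. N #> x))"
      by (rule continuous_map_eq) (simp add: coset_inv topspace)
  qed
  ultimately show ?thesis
    using topspace_quotient unfolding lc_group_def lc_group_axioms_def lc_space_def by blast
qed

sublocale S: lc_group S TS by (rule lc_group_sub)

sublocale Q: lc_group Q TQ by (rule lc_group_quotient)

end

section \<open>The Weil formula\<close>

context closed_normal
begin

lemma one_carrier: "\<one> \<in> carrier G"
  using one_closed subset by blast

lemma Cc_plus_restrict:
  assumes f: "f \<in> Cc_plus T"
  shows "f \<in> Cc_plus TS"
proof -
  obtain K where K: "compactin T K" "\<And>x. x \<in> topspace T \<Longrightarrow> x \<notin> K \<Longrightarrow> f x = 0"
    using f Cc_plusE by blast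
  show ?thesis
  proof (rule Cc_plusI[where K="N \<inter> K"])
    show "continuous_map TS euclideanreal f" by (rule continuous_map_from_subtopology[OF Cc_plusD(1)[OF f]])
    show "compactin TS (N \<inter> K)" using closed_Int_compactin[OF closed K(1)] by (simp add: compactin_subtopology)
  qed (use K(2) Cc_plusD(2)[OF f] in auto)
qed

lemma Cc_plus_coset: "x \<in> carrier G \<Longrightarrow> f \<in> Cc_plus T \<Longrightarrow> (\<lambda>n. f (x \<otimes> n)) \<in> Cc_plus TS"
  by (rule Cc_plus_restrict[OF Cc_plus_compose[OF _ homeomorphic_left]])

lemma homeomorphic_Ad:
  assumes s: "s \<in> carrier G"
  shows "homeomorphic_map TS TS (Ad G s)"
proof -
  have c: "continuous_map TS TS (Ad G t)" if t: "t \<in> carrier G" for t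
  proof -
    have "continuous_map T T (Ad G t)"
      unfolding Ad_def using t by (intro continuous_mult continuous_const continuous_map_id[unfolded id_def]) auto
    then show ?thesis
      unfolding continuous_map_in_subtopology
      using continuous_map_from_subtopology inv_op_closed2[OF t] topspace_sub by (auto simp: Ad_def)
  qed
  have inv: "Ad G (inv t) (Ad G t x) = x" if "t \<in> carrier G" "x \<in> N" for t x
  proof -
    have x: "x \<in> carrier G" using that subset by blast
    have "Ad G (inv t) (Ad G t x) = (inv t \<otimes> t) \<otimes> x \<otimes> (inv t \<otimes> t)"
      unfolding Ad_def using that(1) x by (simp add: m_assoc inv_mult_cancel)
    then show ?thesis using that(1) x by simp
  qed
  show ?thesis
    unfolding homeomorphic_map_maps homeomorphic_maps_def
    by (rule exI[of _ "Ad G (inv s)"])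
      (use c[OF s] c[of "inv s"] inv[OF s] inv[of "inv s"] s in \<open>auto simp: topspace_sub simp del: topspace_subtopology\<close>)
qed

text \<open>Conjugation intertwines translation by \<open>t\<close> with translation by
  \<open>Ad G s t\<close>, which stays in \<open>N\<close> by normality. The inverse of
  \<open>s\<close> occurs because the preimage of \<open>E\<close> under \<open>Ad G (inv s)\<close>
  is the image of \<open>E\<close> under \<open>Ad G s\<close>.\<close>

lemma haar_scaling_Ad:
  assumes s: "s \<in> carrier G"
  obtains c where "0 < c" "S.haar_scaling (Ad G (inv s)) c"
proof (rule S.haar_scaling_exists[OF homeomorphic_Ad])
  show "inv s \<in> carrier G" using s by simp
  fix t assume t: "t \<in> carrier S"
  then have tG: "t \<in> carrier G" and tN: "t \<in> N" using subset by auto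
  have "t \<otimes> Ad G (inv s) x = Ad G (inv s) (Ad G s t \<otimes> x)" if "x \<in> N" for x
  proof -
    have x: "x \<in> carrier G" using that subset by blast
    have "Ad G (inv s) (Ad G s t \<otimes> x) = (inv s \<otimes> s) \<otimes> t \<otimes> (inv s \<otimes> x \<otimes> s)"
      unfolding Ad_def using s tG x by (simp add: m_assoc inv_mult_cancel)
    then show ?thesis using s tG x by (simp add: Ad_def)
  qed
  moreover have "Ad G s t \<in> N" using inv_op_closed2[OF s tN] by (simp add: Ad_def)
  ultimately show "\<exists>t'\<in>carrier S. \<forall>x\<in>carrier S. t \<otimes>\<^bsub>S\<^esub> Ad G (inv s) x = Ad G (inv s) (t' \<otimes>\<^bsub>S\<^esub> x)" by auto
qed (use that in blast)

lemma Ad_derivative: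
  assumes s: "s \<in> carrier G" and \<mu>: "left_haar_measure S TS \<mu>"
  shows "0 < Ad_derivative G \<mu> s" and "S.haar_scaling (Ad G (inv s)) (Ad_derivative G \<mu> s)"
proof -
  obtain c where c: "0 < c" "S.haar_scaling (Ad G (inv s)) c" by (rule haar_scaling_Ad[OF s])
  obtain E where E: "E \<in> sets \<mu>" "0 < emeasure \<mu> E" "emeasure \<mu> E < \<infinity>" by (rule S.finite_positive_set[OF \<mu>])
  have homeo: "homeomorphic_map TS TS (Ad G (inv s))" using s by (intro homeomorphic_Ad) simp
  have em: "emeasure (comp_Ad G \<mu> s) E = ennreal c * emeasure \<mu> E" if E: "E \<in> sets \<mu>" for E
  proof -
    have "emeasure (comp_Ad G \<mu> s) E = emeasure \<mu> {x \<in> topspace TS. Ad G (inv s) x \<in> E}"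
      unfolding comp_Ad_def by (rule emeasure_distr_homeomorphic[OF S.haar_radon[OF \<mu>] homeo E])
    also have "\<dots> = ennreal c * emeasure \<mu> E"
      unfolding S.topspace by (rule S.haar_scaling_emeasure[OF c(2) \<mu> E])
    finally show ?thesis .
  qed
  have "Ad_derivative G \<mu> s = c"
    unfolding Ad_derivative_def
  proof (rule the_equality)
    have "comp_Ad G \<mu> s = density \<mu> (\<lambda>_. ennreal c)"
      by (rule measure_eqI) (use em in \<open>auto simp: comp_Ad_def emeasure_density_const\<close>)
    then show "0 < c \<and> comp_Ad G \<mu> s = density \<mu> (\<lambda>_. ennreal c)" using c(1) by simp
    fix d assume d: "0 < d \<and> comp_Ad G \<mu> s = density \<mu> (\<lambda>_. ennreal d)"
    then have "ennreal d * emeasure \<mu> E = ennreal c * emeasure \<mu> E"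
      using em[OF E(1)] emeasure_density_const[OF E(1)] by metis
    then show "d = c" using ennreal_scale_cancel[OF E(2,3)] c(1) d by blast
  qed
  then show "0 < Ad_derivative G \<mu> s" "S.haar_scaling (Ad G (inv s)) (Ad_derivative G \<mu> s)"
    using c by auto
qed

text \<open>One invariant set of finite positive measure decides the constant. For compact
  \<open>N\<close> it will be \<open>N\<close> itself, for discrete \<open>N\<close> the set
  containing only the identity.\<close>

lemma Ad_derivative_eq_1:
  assumes s: "s \<in> carrier G" and \<mu>: "left_haar_measure S TS \<mu>"
    and E: "E \<in> sets \<mu>" "0 < emeasure \<mu> E" "emeasure \<mu> E < \<infinity>"
    and inv: "{x \<in> N. Ad G (inv s) x \<in> E} = E"
  shows "Ad_derivative G \<mu> s = 1"
proof -
  have "emeasure \<mu> {x \<in> N. Ad G (inv s) x \<in> E} = ennreal (Ad_derivative G \<mu> s) * emeasure \<mu> E"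
    using S.haar_scaling_emeasure[OF Ad_derivative(2)[OF s \<mu>] \<mu> E(1)] by simp
  then have "ennreal (Ad_derivative G \<mu> s) * emeasure \<mu> E = ennreal 1 * emeasure \<mu> E" using inv by simp
  then show ?thesis using ennreal_scale_cancel[OF E(2,3)] Ad_derivative(1)[OF s \<mu>] by simp
qed

section \<open>Integration over the fibres\<close>

text \<open>Elements of the quotient are right cosets, but by normality the same coset is
  parametrised as \<open>x N\<close>. On this side left invariance on \<open>N\<close> absorbs a
  change of representative, and left translation by \<open>G\<close> acts on \<open>x\<close>
  alone.\<close>

definition fibre_integral :: "'a measure \<Rightarrow> ('a \<Rightarrow> real) \<Rightarrow> 'a \<Rightarrow> real" where
  "fibre_integral \<mu> f x = (\<integral>n. f (x \<otimes> n) \<partial>\<mu>)"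

text \<open>By left invariance of \<open>\<mu>\<close> the value does not depend on the representative of the coset.\<close>

definition push :: "'a measure \<Rightarrow> ('a \<Rightarrow> real) \<Rightarrow> 'a set \<Rightarrow> real" where
  "push \<mu> f X = fibre_integral \<mu> f (SOME x. x \<in> carrier G \<and> X = N #> x)"

context
  fixes \<mu> assumes \<mu>: "left_haar_measure S TS \<mu>"
begin

lemma radon_fibre: "radon_measure TS \<mu>"
  by (rule S.haar_radon[OF \<mu>])

lemma space_fibre: "space \<mu> = N"
  using radon_space[OF radon_fibre] topspace_sub by simp

lemma integrable_fibre: "x \<in> carrier G \<Longrightarrow> f \<in> Cc_plus T \<Longrightarrow> integrable \<mu> (\<lambda>n. f (x \<otimes> n))"
  by (rule S.Cc_plus_integrable[OF radon_fibre Cc_plus_coset])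

lemma fibre_integral_mono:
  assumes x: "x \<in> carrier G" and "f \<in> Cc_plus T" "g \<in> Cc_plus T" "\<And>x. x \<in> carrier G \<Longrightarrow> f x \<le> g x"
  shows "fibre_integral \<mu> f x \<le> fibre_integral \<mu> g x"
  unfolding fibre_integral_def
  using assms subset integrable_fibre by (intro integral_mono) (auto simp: space_fibre)

lemma fibre_integral_nonneg: "x \<in> carrier G \<Longrightarrow> f \<in> Cc_plus T \<Longrightarrow> 0 \<le> fibre_integral \<mu> f x"
  unfolding fibre_integral_def by (rule S.functional_nonneg[OF S.haar_functional[OF \<mu>] Cc_plus_coset])

lemma fibre_integral_right:
  assumes x: "x \<in> carrier G" and f: "f \<in> Cc_plus T" and m: "m \<in> N"
  shows "fibre_integral \<mu> f (x \<otimes> m) = fibre_integral \<mu> f x"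
proof -
  have mG: "m \<in> carrier G" using m subset by blast
  have "fibre_integral \<mu> f (x \<otimes> m) = (\<integral>n. (\<lambda>n. f (x \<otimes> n)) (m \<otimes> n) \<partial>\<mu>)"
    unfolding fibre_integral_def
    by (rule Bochner_Integration.integral_cong) (use x mG subset in \<open>auto simp: space_fibre m_assoc subset_iff\<close>)
  also have "\<dots> = (\<integral>n. f (x \<otimes> n) \<partial>\<mu>)"
    using S.haar_integral_left[OF \<mu> _ borel_measurable_integrable[OF integrable_fibre[OF x f]], of m] m by simp
  finally show ?thesis by (simp add: fibre_integral_def)
qed

lemma push_coset:
  assumes x: "x \<in> carrier G" and f: "f \<in> Cc_plus T"
  shows "push \<mu> f (N #> x) = fibre_integral \<mu> f x"
proof -
  define y where "y = (SOME y. y \<in> carrier G \<and> N #> x = N #> y)"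
  have "y \<in> carrier G \<and> N #> x = N #> y" unfolding y_def by (rule someI[of _ x]) (use x in simp)
  then have y: "y \<in> carrier G" "y \<otimes> inv x \<in> N" using coset_eq_iff[OF x] by auto
  have "inv x \<otimes> (y \<otimes> inv x) \<otimes> x \<in> N" by (rule inv_op_closed1[OF x y(2)])
  moreover have "y = x \<otimes> (inv x \<otimes> (y \<otimes> inv x) \<otimes> x)"
  proof -
    have "x \<otimes> (inv x \<otimes> (y \<otimes> inv x) \<otimes> x) = (x \<otimes> inv x) \<otimes> y \<otimes> (inv x \<otimes> x)"
      using x y(1) by (simp add: m_assoc inv_mult_cancel)
    then show ?thesis using x y(1) by simp
  qed
  ultimately have "fibre_integral \<mu> f y = fibre_integral \<mu> f x" using fibre_integral_right[OF x f] by metis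
  then show ?thesis by (simp add: push_def y_def)
qed

text \<open>Uniform smallness of the integrand is not enough, since \<open>N\<close> may have
  infinite measure. For \<open>y\<close> near \<open>x\<close> the integrands vanish off one common
  compact set, so a fixed bump \<open>F\<close> with finite integral over \<open>N\<close> dominates
  the error.\<close>

lemma fibre_integral_near:
  assumes f: "f \<in> Cc_plus T" and x: "x \<in> carrier G" and e: "0 < (e::real)"
  obtains W where "openin T W" "x \<in> W" "\<And>y. y \<in> W \<Longrightarrow> \<bar>fibre_integral \<mu> f y - fibre_integral \<mu> f x\<bar> < e"
proof -
  obtain K where K: "compactin T K" "\<And>x. x \<in> topspace T \<Longrightarrow> x \<notin> K \<Longrightarrow> f x = 0"
    using f Cc_plusE by blast
  obtain V0 C where V0: "openin T V0" "compactin T C" "\<one> \<in> V0" "V0 \<subseteq> C" by (rule compact_nbhd_one)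
  have KG: "K \<subseteq> carrier G" and CG: "C \<subseteq> carrier G"
    using K(1) V0(2) compactin_subset_topspace topspace by blast+
  \<comment> \<open>If \<open>v \<otimes> (x \<otimes> n)\<close> lies in \<open>K\<close> for some
    \<open>v\<close> in \<open>C\<close>, then \<open>n\<close> lies in this set. So it contains all
    \<open>n\<close> where any of the integrands is nonzero.\<close>
  define L where "L = inv x <# ((\<lambda>x. inv x) ` C <#> K)"
  have L: "compactin T L"
    unfolding L_def using x by (intro compact_l_coset compact_set_mult compact_inv V0 K) auto
  obtain F where F: "F \<in> Cc_plus T" "\<And>x. x \<in> L \<Longrightarrow> F x = 1"
    using Urysohn_Cc_plus[OF L openin_topspace] L compactin_subset_topspace by metis
  have F0: "0 \<le> F x" if "x \<in> carrier G" for x using that Cc_plusD(2)[OF F(1)] topspace by simp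
  have FN: "integrable \<mu> F" by (rule S.Cc_plus_integrable[OF radon_fibre Cc_plus_restrict[OF F(1)]])
  define M where "M = (\<integral>n. F n \<partial>\<mu>)"
  have M: "0 \<le> M" unfolding M_def by (rule S.functional_nonneg[OF S.haar_functional[OF \<mu>] Cc_plus_restrict[OF F(1)]])
  define d where "d = e / (M + 1)"
  have d: "0 < d" using e M by (simp add: d_def)
  obtain V where V: "openin T V" "\<one> \<in> V" "\<And>y v. y \<in> carrier G \<Longrightarrow> v \<in> V \<Longrightarrow> \<bar>f (v \<otimes> y) - f y\<bar> < d"
    using uniformly_continuous_right[OF f d] by blast
  have in_L: "n \<in> L" if n: "n \<in> carrier G" and v: "v \<in> C" and vk: "v \<otimes> (x \<otimes> n) \<in> K" for n v
  proof -
    have vG: "v \<in> carrier G" using v CG by blast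
    have "n = inv x \<otimes> (inv v \<otimes> (v \<otimes> (x \<otimes> n)))" using n vG x by (simp flip: m_assoc)
    then show ?thesis unfolding L_def l_coset_image set_mult_def using v vk by blast
  qed
  show ?thesis
  proof
    show "openin T ((V \<inter> V0) #> x)" using V V0 by (intro open_r_coset[OF x]) auto
    have "\<one> \<otimes> x \<in> (V \<inter> V0) #> x" using V V0 unfolding r_coset_image by blast
    then show "x \<in> (V \<inter> V0) #> x" using x by simp
    fix y assume "y \<in> (V \<inter> V0) #> x"
    then obtain v where v: "v \<in> V" "v \<in> C" "y = v \<otimes> x" using V0 unfolding r_coset_image by blast
    have vG: "v \<in> carrier G" using v CG by blast
    have yG: "y \<in> carrier G" using v vG x by simp
    have pt: "\<bar>f (y \<otimes> n) - f (x \<otimes> n)\<bar> \<le> d * F n" if n: "n \<in> N" for n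
    proof -
      have nG: "n \<in> carrier G" using n subset by blast
      have yn: "y \<otimes> n = v \<otimes> (x \<otimes> n)" using v(3) vG x nG by (simp add: m_assoc)
      show ?thesis
      proof (cases "n \<in> L")
        case True
        then show ?thesis using V(3)[of "x \<otimes> n" v] v(1) x nG F(2) yn by simp
      next
        case False
        have "\<one> \<otimes> (x \<otimes> n) \<notin> K" using in_L[OF nG, of \<one>] V0 False by blast
        then have "x \<otimes> n \<notin> K" using x nG by simp
        moreover have "y \<otimes> n \<notin> K" using in_L[OF nG v(2)] False yn by auto
        ultimately have "f (y \<otimes> n) = 0" "f (x \<otimes> n) = 0" using K(2) x yG nG topspace by auto
        then show ?thesis using F0[OF nG] d by simp
      qed
    qed
    have "fibre_integral \<mu> f y - fibre_integral \<mu> f x = (\<integral>n. f (y \<otimes> n) - f (x \<otimes> n) \<partial>\<mu>)"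
      unfolding fibre_integral_def using integrable_fibre[OF _ f] x yG by simp
    also have "\<bar>\<dots>\<bar> \<le> (\<integral>n. \<bar>f (y \<otimes> n) - f (x \<otimes> n)\<bar> \<partial>\<mu>)" by (rule integral_abs_bound)
    also have "\<dots> \<le> (\<integral>n. d * F n \<partial>\<mu>)"
      by (rule integral_mono) (use integrable_fibre[OF _ f] x yG FN pt space_fibre in auto)
    also have "\<dots> = d * M" by (simp add: M_def)
    also have "\<dots> < d * (M + 1)" using d by simp
    also have "\<dots> = e" using M by (simp add: d_def)
    finally show "\<bar>fibre_integral \<mu> f y - fibre_integral \<mu> f x\<bar> < e" .
  qed
qed

lemma fibre_integral_continuous:
  assumes f: "f \<in> Cc_plus T"
  shows "continuous_map T euclideanreal (fibre_integral \<mu> f)"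
  unfolding continuous_map_def
proof (intro conjI allI impI)
  fix U :: "real set" assume "openin euclideanreal U"
  then have U: "open U" by simp
  show "openin T {x \<in> topspace T. fibre_integral \<mu> f x \<in> U}"
  proof (subst openin_subopen, intro ballI)
    fix x assume "x \<in> {x \<in> topspace T. fibre_integral \<mu> f x \<in> U}"
    then have x: "x \<in> carrier G" "fibre_integral \<mu> f x \<in> U" using topspace by auto
    obtain e where e: "0 < e" "\<And>r. dist r (fibre_integral \<mu> f x) < e \<Longrightarrow> r \<in> U"
      using U x(2) unfolding open_dist by blast
    obtain W where W: "openin T W" "x \<in> W" "\<And>y. y \<in> W \<Longrightarrow> \<bar>fibre_integral \<mu> f y - fibre_integral \<mu> f x\<bar> < e"
      using fibre_integral_near[OF f x(1) e(1)] by blast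
    have "W \<subseteq> {x \<in> topspace T. fibre_integral \<mu> f x \<in> U}"
      using W(3) e(2) openin_subset[OF W(1)] by (auto simp: dist_real_def)
    then show "\<exists>W. openin T W \<and> x \<in> W \<and> W \<subseteq> {x \<in> topspace T. fibre_integral \<mu> f x \<in> U}"
      using W by blast
  qed
qed auto

lemma push_Cc_plus:
  assumes f: "f \<in> Cc_plus T"
  shows "push \<mu> f \<in> Cc_plus TQ"
proof -
  obtain K where K: "compactin T K" "\<And>x. x \<in> topspace T \<Longrightarrow> x \<notin> K \<Longrightarrow> f x = 0"
    using f Cc_plusE by blast
  show ?thesis
  proof (rule Cc_plusI[where K="(\<lambda>x. N #> x) ` K"])
    show "continuous_map TQ euclideanreal (push \<mu> f)"
    proof (rule continuous_compose_quotient_map[OF quotient_map_coset])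
      show "continuous_map T euclideanreal (push \<mu> f \<circ> (\<lambda>x. N #> x))"
        by (rule continuous_map_eq[OF fibre_integral_continuous[OF f]]) (simp add: push_coset f topspace)
    qed
    show "compactin TQ ((\<lambda>x. N #> x) ` K)" by (rule image_compactin[OF K(1) continuous_coset])
    fix X assume "X \<in> topspace TQ"
    then obtain x where x: "x \<in> carrier G" "X = N #> x" using topspace_quotient cosetE by metis
    show "0 \<le> push \<mu> f X" using push_coset[OF x(1) f] fibre_integral_nonneg[OF x(1) f] x(2) by simp
    assume X: "X \<notin> (\<lambda>x. N #> x) ` K"
    have "f (x \<otimes> n) = 0" if n: "n \<in> N" for n
    proof -
      have nG: "n \<in> carrier G" using n subset by blast
      have "N #> x = N #> (x \<otimes> n)"
        using coset_eq_iff[of x "x \<otimes> n"] inv_op_closed2[OF x(1) n] x(1) nG by simp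
      then have "x \<otimes> n \<notin> K" using X x(2) by blast
      then show ?thesis using K(2) x(1) nG topspace by simp
    qed
    then have "fibre_integral \<mu> f x = (\<integral>n. 0 \<partial>\<mu>)"
      unfolding fibre_integral_def by (intro Bochner_Integration.integral_cong) (auto simp: space_fibre)
    then show "push \<mu> f X = 0" using push_coset[OF x(1) f] x(2) by simp
  qed
qed

context
  fixes \<nu> assumes \<nu>: "left_haar_measure Q TQ \<nu>"
begin

lemma space_quotient: "space \<nu> = carrier Q"
  using radon_space[OF Q.haar_radon[OF \<nu>]] topspace_quotient by simp

lemma integrable_push: "f \<in> Cc_plus T \<Longrightarrow> integrable \<nu> (push \<mu> f)"
  by (rule Q.Cc_plus_integrable[OF Q.haar_radon[OF \<nu>] push_Cc_plus])

text \<open>All laws hold fibre by fibre. Left translation by \<open>s\<close> becomes left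
  translation by the coset of \<open>s\<close>, which the Haar measure of the quotient
  ignores.\<close>

lemma Weil_functional: "invariant_functional (\<lambda>f. \<integral>X. push \<mu> f X \<partial>\<nu>)"
  unfolding invariant_functional_def
proof (intro conjI ballI allI impI)
  fix f g assume f: "f \<in> Cc_plus T" and g: "g \<in> Cc_plus T"
  have "(\<integral>X. push \<mu> (\<lambda>x. f x + g x) X \<partial>\<nu>) = (\<integral>X. push \<mu> f X + push \<mu> g X \<partial>\<nu>)"
  proof (rule Bochner_Integration.integral_cong[OF refl])
    fix X assume "X \<in> space \<nu>"
    then obtain x where x: "x \<in> carrier G" "X = N #> x" using space_quotient cosetE by metis
    show "push \<mu> (\<lambda>x. f x + g x) X = push \<mu> f X + push \<mu> g X"
      using integrable_fibre[OF x(1)] f g push_coset[OF x(1)] Cc_plus_add[OF f g]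
      by (simp add: x(2) fibre_integral_def)
  qed
  then show "(\<integral>X. push \<mu> (\<lambda>x. f x + g x) X \<partial>\<nu>) = (\<integral>X. push \<mu> f X \<partial>\<nu>) + (\<integral>X. push \<mu> g X \<partial>\<nu>)"
    using integrable_push f g by simp
  assume le: "\<forall>x\<in>carrier G. f x \<le> g x"
  show "(\<integral>X. push \<mu> f X \<partial>\<nu>) \<le> (\<integral>X. push \<mu> g X \<partial>\<nu>)"
  proof (rule integral_mono[OF integrable_push[OF f] integrable_push[OF g]])
    fix X assume "X \<in> space \<nu>"
    then obtain x where x: "x \<in> carrier G" "X = N #> x" using space_quotient cosetE by metis
    show "push \<mu> f X \<le> push \<mu> g X"
      using fibre_integral_mono[OF x(1) f g] le push_coset[OF x(1)] f g by (simp add: x(2))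
  qed
next
  fix f c assume f: "f \<in> Cc_plus T" and c: "(0::real) \<le> c"
  have "(\<integral>X. push \<mu> (\<lambda>x. c * f x) X \<partial>\<nu>) = (\<integral>X. c * push \<mu> f X \<partial>\<nu>)"
  proof (rule Bochner_Integration.integral_cong[OF refl])
    fix X assume "X \<in> space \<nu>"
    then obtain x where x: "x \<in> carrier G" "X = N #> x" using space_quotient cosetE by metis
    show "push \<mu> (\<lambda>x. c * f x) X = c * push \<mu> f X"
      using f push_coset[OF x(1)] Cc_plus_mult[OF c f] by (simp add: x(2) fibre_integral_def)
  qed
  then show "(\<integral>X. push \<mu> (\<lambda>x. c * f x) X \<partial>\<nu>) = c * (\<integral>X. push \<mu> f X \<partial>\<nu>)" by simp
next
  fix f s assume f: "f \<in> Cc_plus T" and s: "s \<in> carrier G"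
  have fs: "(\<lambda>x. f (s \<otimes> x)) \<in> Cc_plus T" by (rule Cc_plus_compose[OF f homeomorphic_left[OF s]])
  have "(\<integral>X. push \<mu> (\<lambda>x. f (s \<otimes> x)) X \<partial>\<nu>) = (\<integral>X. push \<mu> f ((N #> s) \<otimes>\<^bsub>Q\<^esub> X) \<partial>\<nu>)"
  proof (rule Bochner_Integration.integral_cong[OF refl])
    fix X assume "X \<in> space \<nu>"
    then obtain x where x: "x \<in> carrier G" "X = N #> x" using space_quotient cosetE by metis
    have "fibre_integral \<mu> (\<lambda>x. f (s \<otimes> x)) x = fibre_integral \<mu> f (s \<otimes> x)"
      unfolding fibre_integral_def
      by (rule Bochner_Integration.integral_cong) (use s x subset in \<open>auto simp: space_fibre m_assoc subset_iff\<close>)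
    then show "push \<mu> (\<lambda>x. f (s \<otimes> x)) X = push \<mu> f ((N #> s) \<otimes>\<^bsub>Q\<^esub> X)"
      unfolding x(2) coset_mult[OF s x(1)] using push_coset[OF x(1) fs] push_coset[OF _ f] s x(1) by simp
  qed
  also have "\<dots> = (\<integral>X. push \<mu> f X \<partial>\<nu>)"
    by (rule Q.haar_integral_left[OF \<nu> coset_in[OF s] borel_measurable_integrable[OF integrable_push[OF f]]])
  finally show "(\<integral>X. push \<mu> (\<lambda>x. f (s \<otimes> x)) X \<partial>\<nu>) = (\<integral>X. push \<mu> f X \<partial>\<nu>)" .
qed

text \<open>Because \<open>x n s\<^sup>-\<^sup>1 = (x s\<^sup>-\<^sup>1)(s n
  s\<^sup>-\<^sup>1)\<close>, right translation shifts the fibre and conjugates its parameter.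
  Conjugation accounts for the derivative on the left side, the shift of cosets for the modular
  function of the quotient on the right.\<close>

lemma Weil_right_translate:
  assumes s: "s \<in> carrier G" and f: "f \<in> Cc_plus T"
  shows "Ad_derivative G \<mu> s * (\<integral>X. push \<mu> (\<lambda>x. f (x \<otimes> inv s)) X \<partial>\<nu>) =
    modular_function Q TQ (N #> s) * (\<integral>X. push \<mu> f X \<partial>\<nu>)"
proof -
  let ?\<phi> = "Ad_derivative G \<mu> s"
  have inv_s: "inv s \<in> carrier G" using s by simp
  have fs: "(\<lambda>x. f (x \<otimes> inv s)) \<in> Cc_plus T" by (rule Cc_plus_compose[OF f homeomorphic_right[OF inv_s]])
  have "?\<phi> * push \<mu> (\<lambda>x. f (x \<otimes> inv s)) X = push \<mu> f (X \<otimes>\<^bsub>Q\<^esub> inv\<^bsub>Q\<^esub> (N #> s))" if X: "X \<in> space \<nu>" for X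
  proof -
    obtain x where x: "x \<in> carrier G" "X = N #> x" using X space_quotient cosetE by metis
    let ?h = "\<lambda>n. f (x \<otimes> n \<otimes> inv s)"
    have h: "?h \<in> Cc_plus TS"
      by (rule Cc_plus_restrict[OF Cc_plus_compose[OF fs homeomorphic_left[OF x(1)]]])
    have "?\<phi> * fibre_integral \<mu> (\<lambda>x. f (x \<otimes> inv s)) x = (\<integral>n. ?h (Ad G (inv s) n) \<partial>\<mu>)"
      unfolding fibre_integral_def by (rule S.haar_scaling_integral[OF Ad_derivative(2)[OF s \<mu>] \<mu> h, symmetric])
    also have "\<dots> = fibre_integral \<mu> f (x \<otimes> inv s)"
      unfolding fibre_integral_def
    proof (rule Bochner_Integration.integral_cong[OF refl])
      fix n assume "n \<in> space \<mu>"
      then have n: "n \<in> carrier G" using space_fibre subset by auto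
      have "x \<otimes> Ad G (inv s) n \<otimes> inv s = x \<otimes> inv s \<otimes> n \<otimes> (s \<otimes> inv s)"
        unfolding Ad_def using s x n by (simp add: m_assoc inv_mult_cancel)
      then show "f (x \<otimes> Ad G (inv s) n \<otimes> inv s) = f (x \<otimes> inv s \<otimes> n)" using s x n by simp
    qed
    finally show ?thesis
      unfolding x(2) coset_inv[OF s] coset_mult[OF x(1) inv_s]
      using push_coset[OF x(1) fs] push_coset[OF _ f, of "x \<otimes> inv s"] s x(1) by simp
  qed
  then have "(\<integral>X. ?\<phi> * push \<mu> (\<lambda>x. f (x \<otimes> inv s)) X \<partial>\<nu>) = (\<integral>X. push \<mu> f (X \<otimes>\<^bsub>Q\<^esub> inv\<^bsub>Q\<^esub> (N #> s)) \<partial>\<nu>)"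
    by (rule Bochner_Integration.integral_cong[OF refl])
  also have "\<dots> = modular_function Q TQ (N #> s) * (\<integral>X. push \<mu> f X \<partial>\<nu>)"
    by (rule Q.modular_function_integral[OF coset_in[OF s] \<nu> push_Cc_plus[OF f]])
  finally show ?thesis by simp
qed

end

theorem modular_function_quotient:
  assumes s: "s \<in> carrier G"
  shows "modular_function Q TQ (N #> s) = Ad_derivative G \<mu> s * modular_function G T s"
proof -
  obtain \<nu> where \<nu>: "left_haar_measure Q TQ \<nu>" by (rule Q.haar_measure_exists)
  obtain \<kappa> where \<kappa>: "left_haar_measure G T \<kappa>" by (rule haar_measure_exists)
  define J where "J = (\<lambda>f. \<integral>X. push \<mu> f X \<partial>\<nu>)"
  have J: "invariant_functional J" unfolding J_def by (rule Weil_functional[OF \<nu>])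
  obtain f where f: "f \<in> Cc_plus T" "f \<one> = 1" using bump by blast
  have "0 < (\<integral>n. f (\<one> \<otimes> n) \<partial>\<mu>)"
    by (rule S.haar_integral_pos[OF \<mu> Cc_plus_coset[OF one_carrier f(1)], of \<one>]) (simp_all add: f)
  then have "push \<mu> f (N #> \<one>) \<noteq> 0" using push_coset[OF one_carrier f(1)] by (simp add: fibre_integral_def)
  \<comment> \<open>Both descriptions of right translation are multiples of \<open>J f\<close>, so a
    function with nonzero iterated integral is needed to cancel it.\<close>
  then have pos: "0 < J f"
    unfolding J_def by (rule Q.haar_integral_pos[OF \<nu> push_Cc_plus[OF f(1)] coset_in[OF one_carrier]])
  obtain c where c: "\<And>f. f \<in> Cc_plus T \<Longrightarrow> J f = c * (\<integral>x. f x \<partial>\<kappa>)"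
    using haar_unique[OF \<kappa> J] by blast
  have fs: "(\<lambda>x. f (x \<otimes> inv s)) \<in> Cc_plus T" by (rule Cc_plus_compose[OF f(1) homeomorphic_right]) (use s in simp)
  have "J (\<lambda>x. f (x \<otimes> inv s)) = modular_function G T s * J f"
    using c[OF fs] c[OF f(1)] modular_function_integral[OF s \<kappa> f(1)] by simp
  then have "Ad_derivative G \<mu> s * (modular_function G T s * J f) = modular_function Q TQ (N #> s) * J f"
    using Weil_right_translate[OF \<nu> s f(1)] unfolding J_def by simp
  then show ?thesis using pos by simp
qed

end

section \<open>The three kernels\<close>

lemma almost_unimodular_iff:
  "almost_unimodular G T \<longleftrightarrow> openin T {s \<in> carrier G. modular_function G T s = 1}"
  by (simp add: almost_unimodular_def kernel_def pos_real_group_def)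

text \<open>A set in the quotient is open exactly when its preimage is, which moves the statement
  about the quotient into \<open>G\<close>, where all three kernels can be compared.\<close>

lemma almost_unimodular_quotient_iff:
  "almost_unimodular Q TQ \<longleftrightarrow> openin T {s \<in> carrier G. modular_function Q TQ (N #> s) = 1}"
proof -
  have "{s \<in> carrier G. N #> s \<in> {X \<in> carrier Q. modular_function Q TQ X = 1}} =
      {s \<in> carrier G. modular_function Q TQ (N #> s) = 1}"
    using coset_in by blast
  moreover have "{X \<in> carrier Q. modular_function Q TQ X = 1} \<subseteq> rcosets N" by (auto simp: FactGroup_def)
  ultimately show ?thesis
    by (simp add: almost_unimodular_def kernel_def pos_real_group_def openin_quotient_topology[OF topspace])
qed

lemma two_imply_third:
  assumes \<mu>: "left_haar_measure S TS \<mu>"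
  defines "A \<equiv> {s \<in> carrier G. modular_function G T s = 1}"
    and "B \<equiv> {s \<in> carrier G. modular_function Q TQ (N #> s) = 1}"
    and "C \<equiv> {s \<in> carrier G. Ad_derivative G \<mu> s = 1}"
  shows "openin T A \<Longrightarrow> openin T B \<Longrightarrow> openin T C"
    and "openin T A \<Longrightarrow> openin T C \<Longrightarrow> openin T B"
    and "openin T B \<Longrightarrow> openin T C \<Longrightarrow> openin T A"
proof -
  note rel = modular_function_quotient[OF \<mu>]
  have multG: "modular_function G T (s \<otimes> t) = modular_function G T s * modular_function G T t"
    if "s \<in> carrier G" "t \<in> carrier G" for s t using that by (rule modular_function_mult)
  have multQ: "modular_function Q TQ (N #> (s \<otimes> t)) = modular_function Q TQ (N #> s) * modular_function Q TQ (N #> t)"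
    if "s \<in> carrier G" "t \<in> carrier G" for s t
    using Q.modular_function_mult[OF coset_in[OF that(1)] coset_in[OF that(2)]] by (simp only: coset_mult[OF that])
  \<comment> \<open>Multiplicativity of the derivative is read off from the formula: the other two
    functions are multiplicative and the modular function of \<open>G\<close> can be
    cancelled.\<close>
  have multC: "Ad_derivative G \<mu> (s \<otimes> t) = Ad_derivative G \<mu> s * Ad_derivative G \<mu> t"
    if "s \<in> carrier G" "t \<in> carrier G" for s t
  proof -
    have "Ad_derivative G \<mu> (s \<otimes> t) * (modular_function G T s * modular_function G T t) =
        Ad_derivative G \<mu> s * modular_function G T s * (Ad_derivative G \<mu> t * modular_function G T t)"
      using multQ[OF that] multG[OF that] rel that by simp
    then show ?thesis using modular_function(1)[OF that(1)] modular_function(1)[OF that(2)] by simp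
  qed
  have pos: "modular_function G T s \<noteq> 0" "Ad_derivative G \<mu> s \<noteq> 0" if "s \<in> carrier G" for s
    using modular_function(1)[OF that] Ad_derivative(1)[OF that \<mu>] by auto
  have one: "\<psi> \<one> = 1" if "\<And>s t. s \<in> carrier G \<Longrightarrow> t \<in> carrier G \<Longrightarrow> \<psi> (s \<otimes> t) = \<psi> s * \<psi> t" "\<psi> \<one> \<noteq> 0" for \<psi> :: "'a \<Rightarrow> real"
    using that(1)[of \<one> \<one>] that(2) by simp
  have oneG: "modular_function G T \<one> = 1" by (rule one[OF multG pos(1)]) auto
  have oneC: "Ad_derivative G \<mu> \<one> = 1" by (rule one[OF multC pos(2)]) auto
  have oneQ: "modular_function Q TQ (N #> \<one>) = 1" using rel[OF one_carrier] oneG oneC by simp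
  have in1: "\<one> \<in> A" "\<one> \<in> B" "\<one> \<in> C" using oneG oneC oneQ by (auto simp: A_def B_def C_def)
  show "openin T A \<Longrightarrow> openin T B \<Longrightarrow> openin T C"
    unfolding C_def
    by (rule multiplicative_kernel_open[OF multC, of "A \<inter> B"]) (use in1 rel in \<open>auto simp: A_def B_def\<close>)
  show "openin T A \<Longrightarrow> openin T C \<Longrightarrow> openin T B"
    unfolding B_def
    by (rule multiplicative_kernel_open[OF multQ, of "A \<inter> C"]) (use in1 rel in \<open>auto simp: A_def C_def\<close>)
  show "openin T B \<Longrightarrow> openin T C \<Longrightarrow> openin T A"
    unfolding A_def
    by (rule multiplicative_kernel_open[OF multG, of "B \<inter> C"]) (use in1 rel in \<open>auto simp: B_def C_def\<close>)
qed

lemma Ad_vimage_sub: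
  assumes "s \<in> carrier G"
  shows "{x \<in> N. Ad G (inv s) x \<in> N} = N"
  using inv_op_closed2[of "inv s"] assms by (auto simp: Ad_def)

lemma Ad_derivative_compact_or_discrete:
  assumes s: "s \<in> carrier G" and \<mu>: "left_haar_measure S TS \<mu>"
    and N: "compactin T N \<or> TS = discrete_topology N"
  shows "Ad_derivative G \<mu> s = 1"
  using N
proof
  assume "compactin T N"
  then have c: "compactin TS N" by (simp add: compactin_subtopology)
  have o: "openin TS N" using openin_topspace[of TS] by (simp only: topspace_sub)
  show ?thesis
  proof (rule Ad_derivative_eq_1[OF s \<mu>])
    show "N \<in> sets \<mu>" by (rule radon_open[OF radon_fibre[OF \<mu>] o])
    have "N \<noteq> {}" using one_closed by blast
    then show "0 < emeasure \<mu> N" using S.haar_open_pos[OF \<mu> o] by (simp add: zero_less_iff_neq_zero)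
    show "emeasure \<mu> N < \<infinity>" by (rule radon_compact_finite[OF radon_fibre[OF \<mu>] c])
    show "{x \<in> N. Ad G (inv s) x \<in> N} = N" by (rule Ad_vimage_sub[OF s])
  qed
next
  assume d: "TS = discrete_topology N"
  have 1: "\<one> \<in> N" by (rule subgroup.one_closed[OF is_subgroup])
  have o: "openin TS {\<one>}" using d 1 by simp
  have c: "compactin TS {\<one>}" using 1 topspace_sub by simp
  show ?thesis
  proof (rule Ad_derivative_eq_1[OF s \<mu>])
    show "{\<one>} \<in> sets \<mu>" by (rule radon_open[OF radon_fibre[OF \<mu>] o])
    show "0 < emeasure \<mu> {\<one>}" using S.haar_open_pos[OF \<mu> o] by (auto simp: zero_less_iff_neq_zero)
    show "emeasure \<mu> {\<one>} < \<infinity>" by (rule radon_compact_finite[OF radon_fibre[OF \<mu>] c])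
    have "x = \<one>" if x: "x \<in> N" "Ad G (inv s) x = \<one>" for x
    proof -
      have xG: "x \<in> carrier G" using x subset by blast
      have "Ad G s (Ad G (inv s) x) = (s \<otimes> inv s) \<otimes> x \<otimes> (s \<otimes> inv s)"
        unfolding Ad_def using s xG by (simp add: m_assoc inv_mult_cancel)
      then show ?thesis using x s xG by (simp add: Ad_def)
    qed
    then show "{x \<in> N. Ad G (inv s) x \<in> {\<one>}} = {\<one>}" using 1 s by (auto simp: Ad_def)
  qed
qed

end

theorem proposition3p2:
  fixes G :: "('a, 'b) monoid_scheme" and T :: "'a topology" and N :: "'a set"
  assumes "locally_compact_group G T"
    and "N \<lhd> G"
    and "closedin T N"
  shows "(\<forall>\<mu>\<^sub>N. left_haar_measure (G\<lparr>carrier := N\<rparr>) (subtopology T N) \<mu>\<^sub>N \<longrightarrow>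
      (let \<phi> = Ad_derivative G \<mu>\<^sub>N;
           i = almost_unimodular G T;
           ii = almost_unimodular (G Mod N) (quotient_topology G T N);
           iii = openin T (kernel G pos_real_group \<phi>)
       in (i \<and> ii \<longrightarrow> iii) \<and> (i \<and> iii \<longrightarrow> ii) \<and> (ii \<and> iii \<longrightarrow> i))) \<and>
    (compactin T N \<or> subtopology T N = discrete_topology N \<longrightarrow>
      (almost_unimodular G T \<longleftrightarrow>
       almost_unimodular (G Mod N) (quotient_topology G T N)))"
proof -
  interpret closed_normal G T N
    using assms by (simp add: closed_normal_def closed_normal_axioms_def lc_group_iff)
  have iii: "openin T (kernel G pos_real_group (Ad_derivative G \<mu>)) \<longleftrightarrow>
      openin T {s \<in> carrier G. Ad_derivative G \<mu> s = 1}" for \<mu>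
    by (simp add: kernel_def pos_real_group_def)
  show ?thesis
  proof (intro conjI allI impI)
    fix \<mu> assume \<mu>: "left_haar_measure S TS \<mu>"
    show "let \<phi> = Ad_derivative G \<mu>;
           i = almost_unimodular G T;
           ii = almost_unimodular (G Mod N) (quotient_topology G T N);
           iii = openin T (kernel G pos_real_group \<phi>)
       in (i \<and> ii \<longrightarrow> iii) \<and> (i \<and> iii \<longrightarrow> ii) \<and> (ii \<and> iii \<longrightarrow> i)"
      unfolding Let_def iii almost_unimodular_iff almost_unimodular_quotient_iff
      using two_imply_third[OF \<mu>] by blast
  next
    assume N: "compactin T N \<or> TS = discrete_topology N"
    \<comment> \<open>This part of the claim names no measure on \<open>N\<close>, so one has to be
      produced before the first part can be applied.\<close>
    obtain \<mu> where \<mu>: "left_haar_measure S TS \<mu>" by (rule S.haar_measure_exists)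
    have "{s \<in> carrier G. Ad_derivative G \<mu> s = 1} = topspace T"
      using Ad_derivative_compact_or_discrete[OF _ \<mu> N] topspace by auto
    then have "openin T {s \<in> carrier G. Ad_derivative G \<mu> s = 1}" by simp
    then show "almost_unimodular G T \<longleftrightarrow> almost_unimodular (G Mod N) (quotient_topology G T N)"
      unfolding almost_unimodular_iff almost_unimodular_quotient_iff
      using two_imply_third[OF \<mu>] by blast
  qed
qed

end
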